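(* Suppose Assumptions (A), (B'), (D'), (D''), (E), (F) and (G) (stated in the context) hold. If $d^5\log d=o(n)$, $s_1=o(\sqrt n/(\lambda\sqrt d\,\kappa_n))$ and $s_2=o(\sqrt n/(\sqrt d\,\kappa_n\gamma_n))$, then $$\sqrt n\,\boldsymbol A_n(\hat{\boldsymbol\beta}-\boldsymbol\beta^\star)\to N(0,\sigma^2\boldsymbol G_X)\quad\text{in distribution.}$$
   Context: Notation: $a_n\ll b_n$ (equivalently $b_n\gg a_n$) means $a_n=o(b_n)$; all limits are as $n\to\infty$; $\|\cdot\|_F$ is the Frobenius norm and $\|\cdot\|_{F,d}=d^{-1/2}\|\cdot\|_F$. Model: $d=d_n\to\infty$ with $d\ll n$. For each $n$ the data satisfy $Y_i=\mu_i^\star+\boldsymbol X_i^T\boldsymbol\beta^\star+\epsilon_i$, $1\le i\le n$, where $\boldsymbol\beta^\star\in\mathbb R^d$ and $\boldsymbol\mu^\star\in\mathbb R^n$ are deterministic (and may vary with $n$). The $\boldsymbol X_i$ are i.i.d. copies of a random vector $\boldsymbol X_0=(X_{01},\dots,X_{0d})^T\in\mathbb R^d$ with mean zero and positive definite covariance matrix $\boldsymbol\Sigma_X$; they are independent of the $\epsilon_i$, which are i.i.d. copies of a random variable $\epsilon_0$ with mean zero and variance $\sigma^2>0$. $\boldsymbol X$ is the $n\times d$ matrix with rows $\boldsymbol X_i^T$ and $\boldsymbol Y=(Y_1,\dots,Y_n)^T$. Assumption (A): there are positive sequences $\kappa_n\ll\sqrt n$, $\gamma_n\ll\sqrt n$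 with $P(\max_{1\le i\le n}\|\boldsymbol X_i\|_2>\kappa_n)\to0$ and $P(\max_{1\le i\le n}|\epsilon_i|>\gamma_n)\to0$. Incidental parameters: with $s=s_1+s_2$ and $s_1+s_2=o(n)$: $|\mu_i^\star|\gg\max\{\kappa_n,\gamma_n\}$ for $1\le i\le s_1$; $0<|\mu_i^\star|\le\gamma_n$ for $s_1+1\le i\le s$; $\mu_i^\star=0$ for $s+1\le i\le n$. Let $\mu^\star=\min_{1\le i\le s_1}|\mu_i^\star|$. Assumption (B'): the regularization parameter $\lambda=\lambda_n>0$ satisfies $\sqrt d\,\kappa_n\ll\lambda$, $\alpha\gamma_n\le\lambda$ for a constant $\alpha>2$, and $\lambda\ll\mu^\star$. Assumption (D'): the smallest eigenvalue $\lambda_{\min}(\boldsymbol\Sigma_X)$ is bounded away from zero. Assumption (D''): $\|\boldsymbol\Sigma_X\|_{F,d}$ is bounded. Assumption (E): $\kappa_X=d^{-1}\sum_{j=1}^d(E[X_{0j}^4])^{1/2}$ is bounded. $\boldsymbol A_n$ is a (deterministic) $q\times d$ matrix with $q$ a fixed integer, $\boldsymbol G_n=\boldsymbol A_n\boldsymbol A_n^T$ and $\boldsymbol G_{X,n}=\boldsymbol A_n\boldsymbol\Sigma_X^{-1}\boldsymbol A_n^T$. Assumption (F): $\|\boldsymbol A_n\|_F$ and the largest eigenvalue $\lambda_{\max}(\boldsymbol G_n)$ are bounded, and $\boldsymbol G_{X,n}$ converges to a $q\times q$ symmetric matrix $\boldsymbol G_X$ with respect to $\|\cdot\|_F$. Let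 $\sigma_{X,\max}^2=\max_{j\le d}\mathrm{Var}[X_{0j}]$, $\sigma_{X,\min}^2=\min_{j\le d}\mathrm{Var}[X_{0j}]$, $\gamma_{X,\max}=\max_{j\le d}E|X_{0j}|^3$. Assumption (G): $\sigma_{X,\max}>0$; $\sigma_{X,\max}$ and $\gamma_{X,\max}$ are bounded from above and $\sigma_{X,\min}$ is bounded away from zero. Estimator: $(\hat{\boldsymbol\mu},\hat{\boldsymbol\beta})$ is a minimizer over $\mathbb R^n\times\mathbb R^d$ of $\|\boldsymbol Y-\boldsymbol\mu-\boldsymbol X\boldsymbol\beta\|_2^2+2\lambda\sum_{i=1}^n|\mu_i|$. *)

theory Defs
  imports
    "HOL-Probability.Probability"
    "HOL-Library.Landau_Symbols"
    "Jordan_Normal_Form.Gauss_Jordan_Elimination"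
    "Jordan_Normal_Form.Spectral_Radius"
begin

(* The dimension d = d_n varies with n, so R^d cannot be a type here: its points are functions
   nat => real of which only the coordinates below d matter, and its Borel space is the product
   below (whose points are undefined outside {..<d}). All indices start at 0, so i < n stands
   for 1 <= i <= n. The target dimension q is fixed, and R^q is the type real ^ 'q. *)
abbreviation Rvec :: "nat \<Rightarrow> (nat \<Rightarrow> real) measure" where
  "Rvec m \<equiv> PiM {..<m} (\<lambda>_. borel)"

(* prob_space.indep_var forces both random elements to have the same type; here the types differ. *)
definition independent_elements ::
    "'a measure \<Rightarrow> 'b measure \<Rightarrow> ('a \<Rightarrow> 'b) \<Rightarrow> 'c measure \<Rightarrow> ('a \<Rightarrow> 'c) \<Rightarrow> bool" where
  "independent_elements M S f T g \<longleftrightarrow> f \<in> measurable M S \<and> g \<in> measurable M T \<and>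
     prob_space.indep_set M {f -` B \<inter> space M |B. B \<in> sets S} {g -` C \<inter> space M |C. C \<in> sets T}"

definition covariance_matrix :: "(nat \<Rightarrow> real) measure \<Rightarrow> nat \<Rightarrow> real mat" where
  "covariance_matrix L m = Matrix.mat m m (\<lambda>(j, k).
     LINT x|L. (x j - (LINT y|L. y j)) * (x k - (LINT y|L. y k)))"

definition pos_def_mat :: "real mat \<Rightarrow> bool" where
  "pos_def_mat S \<longleftrightarrow> square_mat S \<and> transpose_mat S = S \<and>
     (\<forall>v \<in> carrier_vec (dim_row S). v \<noteq> 0\<^sub>v (dim_row S) \<longrightarrow> 0 < scalar_prod v (S *\<^sub>v v))"

definition lambda_min :: "real mat \<Rightarrow> real" where
  "lambda_min S = Min (spectrum S)"

definition lambda_max :: "real ^ 'q ^ 'q \<Rightarrow> real" where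
  "lambda_max G = Max {k. \<exists>v. v \<noteq> 0 \<and> G *v v = k *\<^sub>R v}"

definition frobenius_norm :: "'i set \<Rightarrow> 'j set \<Rightarrow> ('i \<Rightarrow> 'j \<Rightarrow> real) \<Rightarrow> real" where
  "frobenius_norm I J a = sqrt (\<Sum>i\<in>I. \<Sum>j\<in>J. (a i j)\<^sup>2)"

(* For a q x m matrix a and an m x m matrix S: the vector a v and the matrices a a^T and
   a S^(-1) a^T. *)
definition rect_mult_vec :: "nat \<Rightarrow> ('q \<Rightarrow> nat \<Rightarrow> real) \<Rightarrow> (nat \<Rightarrow> real) \<Rightarrow> real ^ 'q" where
  "rect_mult_vec m a v = (\<chi> r. \<Sum>j<m. a r j * v j)"

definition gram :: "nat \<Rightarrow> ('q \<Rightarrow> nat \<Rightarrow> real) \<Rightarrow> real ^ 'q ^ 'q" where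
  "gram m a = (\<chi> r s. \<Sum>j<m. a r j * a s j)"

definition gram_inv :: "nat \<Rightarrow> ('q \<Rightarrow> nat \<Rightarrow> real) \<Rightarrow> real mat \<Rightarrow> real ^ 'q ^ 'q" where
  "gram_inv m a S = (\<chi> r s. \<Sum>j<m. \<Sum>k<m. a r j * (the (mat_inverse S) $$ (j, k)) * a s k)"

(* The minimum of |mu_i| over i < s, with the usual convention that it is infinite if s = 0. *)
definition mu_star :: "(nat \<Rightarrow> real) \<Rightarrow> nat \<Rightarrow> ereal" where
  "mu_star \<mu> s = (INF i\<in>{..<s}. ereal \<bar>\<mu> i\<bar>)"

definition penalized_loss ::
    "nat \<Rightarrow> nat \<Rightarrow> real \<Rightarrow> (nat \<Rightarrow> nat \<Rightarrow> real) \<Rightarrow> (nat \<Rightarrow> real) \<Rightarrow> (nat \<Rightarrow> real) \<Rightarrow> (nat \<Rightarrow> real) \<Rightarrow> real" where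
  "penalized_loss n m lam x y \<mu> \<beta> =
     (\<Sum>i<n. (y i - \<mu> i - (\<Sum>j<m. x i j * \<beta> j))\<^sup>2) + 2 * lam * (\<Sum>i<n. \<bar>\<mu> i\<bar>)"

definition normal_law :: "real \<Rightarrow> real \<Rightarrow> real measure" where
  "normal_law m v =
     (if v = 0 then return borel m else density lborel (\<lambda>x. ennreal (normal_density m (sqrt v) x)))"

(* N is the normal law N(m, S) on R^q, possibly degenerate: every linear functional t has the
   univariate law N(t.m, t.S t). This determines N. *)
definition is_multivariate_normal :: "real ^ 'q \<Rightarrow> real ^ 'q ^ 'q \<Rightarrow> (real ^ 'q) measure \<Rightarrow> bool" where
  "is_multivariate_normal m S N \<longleftrightarrow> prob_space N \<and> sets N = sets borel \<and>
     (\<forall>t. distr N borel (\<lambda>x. inner t x) = normal_law (inner t m) (inner t (S *v t)))"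

definition converges_in_distribution ::
    "(nat \<Rightarrow> 'a measure) \<Rightarrow> (nat \<Rightarrow> 'a \<Rightarrow> 'b::metric_space) \<Rightarrow> 'b measure \<Rightarrow> bool" where
  "converges_in_distribution M Z N \<longleftrightarrow>
     (\<forall>n. Z n \<in> borel_measurable (M n)) \<and>
     (\<forall>f :: 'b \<Rightarrow> real. continuous_on UNIV f \<longrightarrow> bounded (range f) \<longrightarrow>
        (\<lambda>n. LINT \<omega>|M n. f (Z n \<omega>)) \<longlonglongrightarrow> (LINT x|N. f x))"

end

theory Submission
  imports Defs
begin

text \<open>Let \<open>\<delta>\<close> be the estimation error of \<open>\<beta>\<close>. Minimising over \<open>\<mu>\<close> first turns the normal equations
  into the estimating equation \<open>\<Sum>i. clip \<lambda> (\<mu>\<^sub>i + \<epsilon>\<^sub>i - X\<^sub>i \<bullet> \<delta>) X\<^sub>i = 0\<close>, where \<open>clip \<lambda>\<close> truncates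
  to \<open>[-\<lambda>, \<lambda>]\<close>. On an event of probability tending to one, the residuals with \<open>i < s1\<close> are clipped
  and the others are not, as long as \<open>\<kappa> \<parallel>\<delta>\<parallel> \<le> (1 - 2 / \<alpha>) \<lambda>\<close>; monotonicity of \<open>clip \<lambda>\<close> excludes
  solutions outside this ball. Inside it the equation is linear in \<open>\<delta>\<close>. Since the sample covariance
  matrix is within \<open>O(d / sqrt n)\<close> of \<open>\<Sigma>\<close> in Frobenius norm, \<open>sqrt n A \<delta>\<close> differs from
  \<open>(\<Sum>i. \<epsilon>\<^sub>i A \<Sigma>\<inverse> X\<^sub>i) / sqrt n\<close> by a term that tends to zero in probability. The latter sum is
  asymptotically normal by Lindeberg's theorem for arrays with i.i.d. rows. Characteristic functions
  determine weak convergence in several dimensions by the Stone-Weierstrass theorem.\<close>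

section \<open>Characteristic functions and weak convergence in several dimensions\<close>

no_notation vec_index (infixl "$" 100)

inductive trig_polynomial :: "('b::real_inner \<Rightarrow> complex) \<Rightarrow> bool" where
  iexp: "trig_polynomial (\<lambda>x. iexp (inner t x))"
| scale: "trig_polynomial f \<Longrightarrow> trig_polynomial (\<lambda>x. c * f x)"
| add: "trig_polynomial f \<Longrightarrow> trig_polynomial g \<Longrightarrow> trig_polynomial (\<lambda>x. f x + g x)"

lemma trig_polynomial_const: "trig_polynomial (\<lambda>x. c)"
  using scale[OF iexp[of 0], of c] by simp

lemma trig_polynomial_sum:
  assumes "\<And>i. i \<in> I \<Longrightarrow> trig_polynomial (f i)"
  shows "trig_polynomial (\<lambda>x. \<Sum>i\<in>I. f i x)"
  using assms
  by (induction I rule: infinite_finite_induct) (auto intro: trig_polynomial_const trig_polynomial.add)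

lemma trig_polynomial_mult:
  assumes f: "trig_polynomial f" and g: "trig_polynomial g"
  shows "trig_polynomial (\<lambda>x. f x * g x)"
  using f
proof induction
  case (iexp t)
  show ?case
    using g
  proof induction
    case (iexp u)
    have "trig_polynomial (\<lambda>x. iexp (inner (t + u) x))"
      by (rule trig_polynomial.iexp)
    then show ?case
      by (simp add: inner_add_left distrib_left exp_add)
  next
    case (scale f c)
    then show ?case
      using trig_polynomial.scale[of "\<lambda>x. iexp (inner t x) * f x" c] by (simp add: ac_simps)
  next
    case (add f g)
    then show ?case
      using trig_polynomial.add[OF add.IH] by (simp add: distrib_left)
  qed
next
  case (scale f c)
  then show ?case
    using trig_polynomial.scale[of "\<lambda>x. f x * g x" c] by (simp add: ac_simps)
next
  case (add f h)
  then show ?case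
    using trig_polynomial.add[OF add.IH] by (simp add: distrib_right)
qed

lemma trig_polynomial_cos: "trig_polynomial (\<lambda>x. complex_of_real (cos (inner t x)))"
proof -
  have "trig_polynomial (\<lambda>x. (1/2) * (iexp (inner t x) + iexp (inner (- t) x)))"
    by (intro trig_polynomial.intros)
  then show ?thesis
    by (simp add: cos_exp_eq cos_of_real[symmetric] del: cos_of_real)
qed

lemma trig_polynomial_sin: "trig_polynomial (\<lambda>x. complex_of_real (sin (inner t x)))"
proof -
  have "trig_polynomial (\<lambda>x. (1/(2*\<i>)) * (iexp (inner t x) + (-1) * iexp (inner (- t) x)))"
    by (intro trig_polynomial.intros)
  then show ?thesis
    by (simp add: sin_exp_eq sin_of_real[symmetric] del: sin_of_real)
qed

definition torus_map :: "real \<Rightarrow> real ^ 'q \<Rightarrow> (real ^ 'q) \<times> (real ^ 'q)" where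
  "torus_map h x = ((\<chi> i. sin (h * x $ i)), (\<chi> i. cos (h * x $ i)))"

lemma trig_polynomial_torus_map:
  assumes "real_polynomial_function p"
  shows "trig_polynomial (\<lambda>x. complex_of_real (p (torus_map h x)))"
  using assms
proof induction
  case (linear f)
  interpret bounded_linear f by fact
  have expand: "f (a, b) = (\<Sum>i\<in>UNIV. a $ i * f (axis i 1, 0) + b $ i * f (0, axis i 1))" for a b
  proof -
    have "(a, b) = (\<Sum>i\<in>UNIV. (a $ i) *\<^sub>R (axis i 1, 0) + (b $ i) *\<^sub>R (0, axis i 1))"
      using basis_expansion[of a] basis_expansion[of b]
      by (simp add: prod_eq_iff fst_sum snd_sum scalar_mult_eq_scaleR)
    then have "f (a, b) = f (\<Sum>i\<in>UNIV. (a $ i) *\<^sub>R (axis i 1, 0) + (b $ i) *\<^sub>R (0, axis i 1))"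
      by (rule arg_cong)
    also have "\<dots> = (\<Sum>i\<in>UNIV. a $ i * f (axis i 1, 0) + b $ i * f (0, axis i 1))"
      by (simp only: sum add scaleR real_scaleR_def)
    finally show ?thesis .
  qed
  have inner: "inner (h *\<^sub>R axis i 1) x = h * x $ i" for i and x :: "real ^ 'a"
    by (simp add: inner_axis')
  have eq: "complex_of_real (f (torus_map h x)) =
      (\<Sum>i\<in>UNIV. complex_of_real (f (axis i 1, 0)) * complex_of_real (sin (inner (h *\<^sub>R axis i 1) x)) +
        complex_of_real (f (0, axis i 1)) * complex_of_real (cos (inner (h *\<^sub>R axis i 1) x)))" for x
    unfolding torus_map_def inner by (subst expand) (simp only: of_real_sum of_real_add of_real_mult vec_lambda_beta mult.commute)
  show ?case
    unfolding eq
    by (intro trig_polynomial_sum trig_polynomial.intros trig_polynomial_sin trig_polynomial_cos)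
next
  case (const c)
  show ?case by (rule trig_polynomial_const)
next
  case (add f g)
  then show ?case using trig_polynomial.add by simp
next
  case (mult f g)
  then show ?case using trig_polynomial_mult by simp
qed

lemma trig_polynomial_borel:
  fixes f :: "'b::euclidean_space \<Rightarrow> complex"
  assumes "trig_polynomial f"
  shows "f \<in> borel_measurable borel \<and> (\<exists>B. \<forall>x. norm (f x) \<le> B)"
  using assms
proof induction
  case (iexp t)
  then show ?case by (auto intro!: exI[of _ 1])
next
  case (scale f c)
  then obtain B where "\<forall>x. norm (f x) \<le> B" by blast
  then have "norm (c * f x) \<le> norm c * B" for x
    by (simp add: norm_mult mult_left_mono)
  with scale show ?case by auto
next
  case (add f g)
  then obtain B B' where "\<forall>x. norm (f x) \<le> B" "\<forall>x. norm (g x) \<le> B'" by blast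
  then have "norm (f x + g x) \<le> B + B'" for x
    by (meson norm_triangle_mono)
  with add show ?case by auto
qed

lemma trig_polynomial_integrable:
  fixes f :: "'b::euclidean_space \<Rightarrow> complex"
  assumes "trig_polynomial f" "prob_space P" "Z \<in> borel_measurable P"
  shows "integrable P (\<lambda>w. f (Z w))"
proof -
  interpret prob_space P by fact
  obtain B where "\<forall>x. norm (f x) \<le> B"
    using trig_polynomial_borel[OF assms(1)] by blast
  then show ?thesis
    using trig_polynomial_borel[OF assms(1)] assms(3)
    by (intro integrable_const_bound[of _ B]) auto
qed

lemma trig_polynomial_convergence:
  fixes f :: "'b::euclidean_space \<Rightarrow> complex"
  assumes prob: "\<And>n. prob_space (M n)" "prob_space N" "sets N = sets borel"
    and Z: "\<And>n. Z n \<in> borel_measurable (M n)"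
    and char: "\<And>t. (\<lambda>n. LINT \<omega>|M n. iexp (inner t (Z n \<omega>))) \<longlonglongrightarrow> (LINT x|N. iexp (inner t x))"
    and f: "trig_polynomial f"
  shows "(\<lambda>n. LINT \<omega>|M n. f (Z n \<omega>)) \<longlonglongrightarrow> (LINT x|N. f x)"
  using f
proof induction
  case (iexp t)
  show ?case by (rule char)
next
  case (scale f c)
  then show ?case by (simp add: tendsto_mult_left)
next
  case (add f g)
  have N: "(\<lambda>x. x) \<in> borel_measurable N"
    using prob(3) by (simp add: measurable_ident_sets)
  show ?case
    using tendsto_add[OF add.IH] trig_polynomial_integrable[OF _ prob(1) Z] trig_polynomial_integrable[OF _ prob(2) N] add.hyps
    by simp
qed

lemma cos_ge_one_minus_square: "1 - x\<^sup>2 / 2 \<le> cos (x::real)"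
proof -
  have "(sin (x/2))\<^sup>2 \<le> (x/2)\<^sup>2"
    using abs_sin_x_le_abs_x[of "x/2"] by (subst abs_le_square_iff[symmetric])
  moreover have "cos x = 1 - 2 * (sin (x/2))\<^sup>2"
    using cos_double_sin[of "x/2"] by simp
  ultimately show ?thesis by (simp add: power_divide)
qed

text \<open>A continuous function is approximated on a ball by a trigonometric polynomial which is
  uniformly bounded on the whole space: the function \<open>\<lambda>(s, c). f (arcsin s / h) * (\<Prod>i. max 0 (c i))\<close>
  is continuous on a cube, hence close to a polynomial there, and for small \<open>h\<close> its composition
  with \<open>x \<mapsto> (sin (h x), cos (h x))\<close> is close to \<open>f\<close> on the ball.\<close>

lemma trig_polynomial_approx:
  fixes f :: "real ^ 'q \<Rightarrow> real"
  assumes f: "continuous_on UNIV f" and K: "\<And>x. \<bar>f x\<bar> \<le> K" and e: "0 < e" and R: "0 < R"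
  obtains g where "trig_polynomial (\<lambda>x. complex_of_real (g x))"
    "\<And>x. norm x \<le> R \<Longrightarrow> \<bar>f x - g x\<bar> \<le> e * (1 + K)"
    "\<And>x. \<bar>g x\<bar> \<le> K + e"
proof -
  have K0: "0 \<le> K" using K[of 0] by linarith
  define q where "q = real CARD('q)"
  have q: "1 \<le> q"
    unfolding q_def using zero_less_card_finite[where 'a='q] by linarith
  define \<delta> where "\<delta> = min 1 (e / q)"
  have \<delta>: "0 < \<delta>" "\<delta> \<le> 1" "q * \<delta> \<le> e"
    using e q by (auto simp: \<delta>_def min_def field_simps)
  define h where "h = \<delta> / R"
  have h: "0 < h" using \<delta> R by (simp add: h_def)
  define S :: "((real ^ 'q) \<times> (real ^ 'q)) set" where "S = cbox (\<chi> i. -1, \<chi> i. -1) (\<chi> i. 1, \<chi> i. 1)"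
  define G :: "(real ^ 'q) \<times> (real ^ 'q) \<Rightarrow> real"
    where "G y = f (\<chi> i. arcsin (fst y $ i) / h) * (\<Prod>i\<in>UNIV. max 0 (snd y $ i))" for y
  have S_iff: "y \<in> S \<longleftrightarrow> (\<forall>i. -1 \<le> fst y $ i \<and> fst y $ i \<le> 1 \<and> -1 \<le> snd y $ i \<and> snd y $ i \<le> 1)" for y
    unfolding S_def by (cases y) (auto simp: cbox_Pair_eq mem_box_cart)
  have "continuous_on S (\<lambda>y. f (\<chi> i. arcsin (fst y $ i) / h))"
    by (rule continuous_on_compose2[OF f])
      (auto intro!: continuous_intros simp: S_iff h[THEN less_imp_neq, symmetric])
  then have "continuous_on S G"
    unfolding G_def by (intro continuous_intros)
  moreover have "compact S" unfolding S_def by (rule compact_cbox)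
  ultimately obtain p where p: "real_polynomial_function p" "\<And>y. y \<in> S \<Longrightarrow> \<bar>G y - p y\<bar> < e"
    using Stone_Weierstrass_real_polynomial_function e by metis
  define g where "g x = p (torus_map h x)" for x
  have in_S: "torus_map h x \<in> S" for x
    by (simp add: S_iff torus_map_def)
  have Gg: "\<bar>G (torus_map h x) - g x\<bar> < e" for x
    unfolding g_def by (rule p(2)[OF in_S])
  have prod01: "0 \<le> (\<Prod>i\<in>UNIV. max 0 (cos (h * x $ i)))" "(\<Prod>i\<in>UNIV. max 0 (cos (h * x $ i))) \<le> 1" for x :: "real ^ 'q"
    by (auto intro!: prod_nonneg prod_le_1)
  have G_le: "\<bar>G (torus_map h x)\<bar> \<le> K" for x
  proof -
    have "\<bar>G (torus_map h x)\<bar> \<le> K * 1"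
      unfolding G_def abs_mult torus_map_def
      using prod01[of x] K K0 by (intro mult_mono) auto
    then show ?thesis by simp
  qed
  show ?thesis
  proof
    show "trig_polynomial (\<lambda>x. complex_of_real (g x))"
      unfolding g_def by (rule trig_polynomial_torus_map[OF p(1)])
    show "\<bar>g x\<bar> \<le> K + e" for x
      using Gg[of x] G_le[of x] by linarith
    show "\<bar>f x - g x\<bar> \<le> e * (1 + K)" if x: "norm x \<le> R" for x
    proof -
      have hx: "\<bar>h * x $ i\<bar> \<le> \<delta>" for i
      proof -
        have "\<bar>x $ i\<bar> \<le> R" using component_le_norm_cart[of x i] x by linarith
        then show ?thesis using R \<delta> by (simp add: h_def abs_mult field_simps)
      qed
      have c: "1 - \<delta> \<le> cos (h * x $ i)" for i
      proof -
        have "(h * x $ i)\<^sup>2 \<le> \<delta>\<^sup>2" using hx[of i] \<delta> abs_le_square_iff by fastforce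
        moreover have "\<delta>\<^sup>2 \<le> \<delta>" using \<delta> by (simp add: power2_eq_square mult_left_le)
        ultimately show ?thesis using cos_ge_one_minus_square[of "h * x $ i"] \<delta> by linarith
      qed
      have "1 - e \<le> 1 + q * (- \<delta>)" using \<delta> by simp
      also have "\<dots> \<le> (1 + (- \<delta>)) ^ CARD('q)"
        unfolding q_def using \<delta> by (intro Bernoulli_inequality) auto
      also have "\<dots> = (\<Prod>i\<in>(UNIV::'q set). 1 - \<delta>)" by simp
      also have "\<dots> \<le> (\<Prod>i\<in>UNIV. max 0 (cos (h * x $ i)))"
        using c \<delta> by (intro prod_mono) (auto simp: le_max_iff_disj)
      finally have P: "1 - e \<le> (\<Prod>i\<in>UNIV. max 0 (cos (h * x $ i)))" .
      have "arcsin (sin (h * x $ i)) = h * x $ i" for i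
        using hx[of i] \<delta> pi_ge_two by (intro arcsin_sin) (auto simp: abs_le_iff)
      then have G: "G (torus_map h x) = f x * (\<Prod>i\<in>UNIV. max 0 (cos (h * x $ i)))"
        using h by (simp add: G_def torus_map_def)
      have "\<bar>f x - G (torus_map h x)\<bar> = \<bar>f x\<bar> * \<bar>1 - (\<Prod>i\<in>UNIV. max 0 (cos (h * x $ i)))\<bar>"
        by (simp add: G abs_mult[symmetric] algebra_simps)
      also have "\<dots> \<le> K * e"
        using K[of x] K0 P prod01[of x] by (intro mult_mono) auto
      finally show ?thesis using Gg[of x] by (simp add: algebra_simps)
    qed
  qed
qed

lemma prob_integral_diff_bound:
  fixes f g :: "'b::euclidean_space \<Rightarrow> real"
  assumes P: "prob_space P" and Z: "Z \<in> borel_measurable P"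
    and f: "f \<in> borel_measurable borel" "\<And>x. \<bar>f x\<bar> \<le> K"
    and g: "g \<in> borel_measurable borel" "\<And>x. \<bar>g x\<bar> \<le> L"
    and near: "\<And>x. norm x \<le> R \<Longrightarrow> \<bar>f x - g x\<bar> \<le> a"
    and a: "0 \<le> a"
    and tail: "\<P>(\<omega> in P. R < norm (Z \<omega>)) \<le> b"
  shows "\<bar>(LINT \<omega>|P. f (Z \<omega>)) - (LINT \<omega>|P. g (Z \<omega>))\<bar> \<le> a + (K + L) * b"
proof -
  interpret prob_space P by fact
  have KL: "0 \<le> K + L" using f(2)[of 0] g(2)[of 0] by linarith
  have [measurable]: "f \<in> borel_measurable borel" "g \<in> borel_measurable borel" "Z \<in> borel_measurable P"
    by fact+
  have i: "integrable P (\<lambda>\<omega>. f (Z \<omega>))" "integrable P (\<lambda>\<omega>. g (Z \<omega>))"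
    subgoal using f(2) by (intro integrable_const_bound[where B=K]) auto
    subgoal using g(2) by (intro integrable_const_bound[where B=L]) auto
    done
  define B where "B = {\<omega> \<in> space P. R < norm (Z \<omega>)}"
  have [measurable]: "B \<in> sets P" unfolding B_def by measurable
  have "\<bar>(LINT \<omega>|P. f (Z \<omega>)) - (LINT \<omega>|P. g (Z \<omega>))\<bar> = \<bar>LINT \<omega>|P. f (Z \<omega>) - g (Z \<omega>)\<bar>"
    using i by simp
  also have "\<dots> \<le> (LINT \<omega>|P. \<bar>f (Z \<omega>) - g (Z \<omega>)\<bar>)"
    by (rule integral_abs_bound)
  also have "\<dots> \<le> (LINT \<omega>|P. a + (K + L) * indicator B \<omega>)"
  proof (rule integral_mono)
    show "integrable P (\<lambda>\<omega>. \<bar>f (Z \<omega>) - g (Z \<omega>)\<bar>)" using i by auto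
    show "integrable P (\<lambda>\<omega>. a + (K + L) * indicator B \<omega>)"
      by (auto intro!: Bochner_Integration.integrable_add integrable_mult_right simp: emeasure_eq_measure)
    show "\<bar>f (Z \<omega>) - g (Z \<omega>)\<bar> \<le> a + (K + L) * indicator B \<omega>" if "\<omega> \<in> space P" for \<omega>
      using that near[of "Z \<omega>"] f(2)[of "Z \<omega>"] g(2)[of "Z \<omega>"] a
      by (auto simp: B_def indicator_def not_less)
  qed
  also have "\<dots> = a + (K + L) * measure P B"
    by (subst Bochner_Integration.integral_add) (auto simp: prob_space emeasure_eq_measure)
  also have "\<dots> \<le> a + (K + L) * b"
    using tail KL by (auto simp: B_def intro!: mult_left_mono)
  finally show ?thesis .
qed

lemma prob_space_tight:
  fixes N :: "'b::euclidean_space measure"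
  assumes N: "prob_space N" "sets N = sets borel" and e: "0 < e"
  shows "\<exists>R. \<P>(x in N. R < norm x) \<le> e"
proof -
  interpret prob_space N by fact
  have meas: "{x \<in> space N. real k < norm x} \<in> sets N" for k
    using N(2) sets_eq_imp_space_eq[OF N(2)] by simp
  have "(\<lambda>k. \<P>(x in N. real k < norm x)) \<longlonglongrightarrow> measure N (\<Inter>k. {x \<in> space N. real k < norm x})"
    using meas by (intro finite_Lim_measure_decseq) (auto simp: decseq_def)
  moreover have "(\<Inter>k. {x \<in> space N. real k < norm x}) = {}"
  proof (intro equals0I)
    fix x assume x: "x \<in> (\<Inter>k. {x \<in> space N. real k < norm x})"
    obtain k :: nat where "norm x < real k" using reals_Archimedean2 by blast
    moreover have "real k < norm x" using x by blast
    ultimately show False by simp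
  qed
  ultimately have "(\<lambda>k. \<P>(x in N. real k < norm x)) \<longlonglongrightarrow> 0"
    by simp
  then have "\<forall>\<^sub>F k in sequentially. \<P>(x in N. real k < norm x) < e"
    using e by (rule order_tendstoD)
  then show ?thesis
    by (auto simp: eventually_sequentially intro: less_imp_le)
qed

lemma converges_in_distribution_char:
  fixes Z :: "nat \<Rightarrow> 'a \<Rightarrow> real ^ 'q" and N :: "(real ^ 'q) measure"
  assumes prob: "\<And>n. prob_space (M n)" "prob_space N" "sets N = sets borel"
    and Z: "\<And>n. Z n \<in> borel_measurable (M n)"
    and tight: "\<And>e. 0 < e \<Longrightarrow> \<exists>R. \<forall>\<^sub>F n in sequentially. \<P>(\<omega> in M n. R < norm (Z n \<omega>)) \<le> e"
    and char: "\<And>t. (\<lambda>n. LINT \<omega>|M n. iexp (inner t (Z n \<omega>))) \<longlonglongrightarrow> (LINT x|N. iexp (inner t x))"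
  shows "converges_in_distribution M Z N"
  unfolding converges_in_distribution_def
proof (intro conjI allI impI)
  show "Z n \<in> borel_measurable (M n)" for n by (rule Z)
  fix f :: "real ^ 'q \<Rightarrow> real"
  assume f: "continuous_on UNIV f" "bounded (range f)"
  have fm: "f \<in> borel_measurable borel" using f(1) by (rule borel_measurable_continuous_onI)
  obtain K where K: "0 < K" "\<And>x. \<bar>f x\<bar> \<le> K"
    using f(2) by (auto simp: bounded_pos)
  have N: "(\<lambda>x. x) \<in> borel_measurable N"
    using prob(3) by (simp add: measurable_ident_sets)
  show "(\<lambda>n. LINT \<omega>|M n. f (Z n \<omega>)) \<longlonglongrightarrow> (LINT x|N. f x)"
  proof (rule LIMSEQ_I)
    fix r :: real assume r: "0 < r"
    define e where "e = min 1 (r / (4 * (2 + 3 * K)))"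
    have e: "0 < e" "e \<le> 1" "2 * (e * (2 + 3 * K)) < r"
    proof -
      have "e * (4 * (2 + 3 * K)) \<le> r / (4 * (2 + 3 * K)) * (4 * (2 + 3 * K))"
        unfolding e_def using K by (intro mult_right_mono) auto
      also have "\<dots> = r" using K by auto
      finally show "2 * (e * (2 + 3 * K)) < r" using r by linarith
    qed (use r K in \<open>auto simp: e_def\<close>)
    obtain R1 where R1: "\<forall>\<^sub>F n in sequentially. \<P>(\<omega> in M n. R1 < norm (Z n \<omega>)) \<le> e"
      using tight[OF e(1)] by blast
    obtain R2 where R2: "\<P>(x in N. R2 < norm x) \<le> e"
      using prob_space_tight[OF prob(2,3) e(1)] by blast
    define R where "R = max 1 (max R1 R2)"
    have R: "0 < R" "R1 \<le> R" "R2 \<le> R" by (auto simp: R_def)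
    obtain g where g: "trig_polynomial (\<lambda>x. complex_of_real (g x))"
        "\<And>x. norm x \<le> R \<Longrightarrow> \<bar>f x - g x\<bar> \<le> e * (1 + K)" "\<And>x. \<bar>g x\<bar> \<le> K + e"
      using trig_polynomial_approx[OF f(1) K(2) e(1) R(1)] by blast
    have gm: "g \<in> borel_measurable borel"
      using measurable_compose[OF conjunct1[OF trig_polynomial_borel[OF g(1)]] borel_measurable_Re] by simp
    have bound: "\<bar>(LINT \<omega>|P. f (W \<omega>)) - (LINT \<omega>|P. g (W \<omega>))\<bar> \<le> e * (2 + 3 * K)"
      if P: "prob_space P" and W: "W \<in> borel_measurable P"
        and t: "\<P>(\<omega> in P. R' < norm (W \<omega>)) \<le> e" and R': "R' \<le> R"
      for P :: "'c measure" and W R'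
    proof -
      interpret prob_space P by fact
      have "\<P>(\<omega> in P. R < norm (W \<omega>)) \<le> \<P>(\<omega> in P. R' < norm (W \<omega>))"
        using R' W by (intro finite_measure_mono) auto
      then have "\<P>(\<omega> in P. R < norm (W \<omega>)) \<le> e" using t by linarith
      from prob_integral_diff_bound[OF P W fm K(2) gm g(3) g(2) _ this]
      have "\<bar>(LINT \<omega>|P. f (W \<omega>)) - (LINT \<omega>|P. g (W \<omega>))\<bar> \<le> e * (1 + K) + (K + (K + e)) * e"
        using e K by simp
      moreover have "e * e \<le> e * 1" using e by (intro mult_left_mono) auto
      moreover have "e * (1 + K) + (K + (K + e)) * e = e + 3 * (e * K) + e * e" "e * (2 + 3 * K) = 2 * e + 3 * (e * K)"
        by (simp_all add: algebra_simps)
      ultimately show ?thesis by linarith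
    qed
    have lim: "(\<lambda>n. LINT \<omega>|M n. g (Z n \<omega>)) \<longlonglongrightarrow> (LINT x|N. g x)"
    proof -
      have "(\<lambda>n. LINT \<omega>|M n. complex_of_real (g (Z n \<omega>))) \<longlonglongrightarrow> (LINT x|N. complex_of_real (g x))"
        by (rule trig_polynomial_convergence[OF prob Z char g(1)])
      then show ?thesis
        unfolding integral_complex_of_real by (simp add: tendsto_of_real_iff)
    qed
    have "0 < r - 2 * (e * (2 + 3 * K))" using e by simp
    from LIMSEQ_D[OF lim this] obtain n0 where n0:
      "\<And>n. n \<ge> n0 \<Longrightarrow> norm ((LINT \<omega>|M n. g (Z n \<omega>)) - (LINT x|N. g x)) < r - 2 * (e * (2 + 3 * K))"
      by blast
    obtain n1 where n1: "\<And>n. n \<ge> n1 \<Longrightarrow> \<P>(\<omega> in M n. R1 < norm (Z n \<omega>)) \<le> e"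
      using R1 by (auto simp: eventually_sequentially)
    have "norm ((LINT \<omega>|M n. f (Z n \<omega>)) - (LINT x|N. f x)) < r" if n: "n \<ge> max n0 n1" for n
      using n0[of n] bound[OF prob(1) Z n1[of n] R(2)] bound[OF prob(2) N R2 R(3)] n by auto
    then show "\<exists>no. \<forall>n\<ge>no. norm ((LINT \<omega>|M n. f (Z n \<omega>)) - (LINT x|N. f x)) < r"
      by blast
  qed
qed

section \<open>Multivariate normal laws\<close>

abbreviation bilinear_form :: "'i set \<Rightarrow> ('i \<Rightarrow> 'i \<Rightarrow> real) \<Rightarrow> ('i \<Rightarrow> real) \<Rightarrow> ('i \<Rightarrow> real) \<Rightarrow> real" where
  "bilinear_form I g x y \<equiv> \<Sum>i\<in>I. \<Sum>j\<in>I. x i * g i j * y j"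

lemma quadratic_form_shift:
  fixes g :: "'i \<Rightarrow> 'i \<Rightarrow> real"
  assumes I: "finite I" "k \<in> I" and sym: "\<And>i j. i \<in> I \<Longrightarrow> j \<in> I \<Longrightarrow> g i j = g j i"
  shows "(\<Sum>i\<in>I. \<Sum>j\<in>I. (x i + s * of_bool (i = k)) * g i j * (x j + s * of_bool (j = k))) =
    bilinear_form I g x x + 2 * s * (\<Sum>j\<in>I. g k j * x j) + s\<^sup>2 * g k k"
proof -
  have delta: "(\<Sum>i\<in>I. of_bool (i = k) * F i) = F k" for F :: "'i \<Rightarrow> real"
    using I by (simp add: of_bool_def if_distrib[of "\<lambda>z. z * _"] cong: if_cong)
  have "(x i + s * of_bool (i = k)) * g i j * (x j + s * of_bool (j = k)) =
      x i * g i j * x j + of_bool (i = k) * (s * (g i j * x j)) + of_bool (j = k) * (s * (g j i * x i)) +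
      of_bool (i = k) * (of_bool (j = k) * (s\<^sup>2 * g i j))" if "i \<in> I" "j \<in> I" for i j
    using sym[OF that] by (simp add: algebra_simps power2_eq_square)
  then have "(\<Sum>i\<in>I. \<Sum>j\<in>I. (x i + s * of_bool (i = k)) * g i j * (x j + s * of_bool (j = k))) =
      bilinear_form I g x x +
      (\<Sum>i\<in>I. of_bool (i = k) * (\<Sum>j\<in>I. s * (g i j * x j))) +
      (\<Sum>i\<in>I. \<Sum>j\<in>I. of_bool (j = k) * (s * (g j i * x i))) +
      (\<Sum>i\<in>I. of_bool (i = k) * (\<Sum>j\<in>I. of_bool (j = k) * (s\<^sup>2 * g i j)))"
    by (simp add: sum.distrib sum_distrib_left cong: sum.cong)
  then show ?thesis
    by (simp only: delta) (simp flip: sum_distrib_left)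
qed

lemma quadratic_nonneg_imp_linear_zero:
  fixes b c :: real
  assumes nonneg: "\<And>s. 0 \<le> 2 * s * b + s\<^sup>2 * c"
  shows "b = 0"
proof -
  define G where "G = \<bar>c\<bar> + 1"
  have G: "0 < G" "c < G" by (auto simp: G_def)
  have "0 \<le> 2 * (- b / G) * b + (- b / G)\<^sup>2 * c" by (rule nonneg)
  also have "\<dots> \<le> 2 * (- b / G) * b + (- b / G)\<^sup>2 * G"
    using G by (intro add_left_mono mult_left_mono) auto
  also have "\<dots> = - (b\<^sup>2 / G)" using G by (simp add: power2_eq_square)
  finally have "b\<^sup>2 / G = 0" using G by (simp add: divide_le_0_iff)
  then show ?thesis using G by simp
qed

lemma psd_kernel:
  fixes g :: "'i \<Rightarrow> 'i \<Rightarrow> real"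
  assumes I: "finite I" "k \<in> I" and sym: "\<And>i j. i \<in> I \<Longrightarrow> j \<in> I \<Longrightarrow> g i j = g j i"
    and psd: "\<And>x. 0 \<le> bilinear_form I g x x"
    and null: "bilinear_form I g v v = 0"
  shows "(\<Sum>j\<in>I. g k j * v j) = 0"
  using psd[of "\<lambda>i. v i + s * of_bool (i = k)" for s] null
  by (intro quadratic_nonneg_imp_linear_zero[of _ "g k k"])
    (simp add: quadratic_form_shift[where g=g and x=v, OF I sym])

lemma psd_sum_rank_one:
  fixes g :: "'i::finite \<Rightarrow> 'i \<Rightarrow> real"
  assumes "finite S"
    and "\<And>i j. g i j = g j i"
    and "\<And>x. 0 \<le> bilinear_form UNIV g x x"
    and "\<And>i j. i \<notin> S \<Longrightarrow> g i j = 0"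
  shows "\<exists>b. \<forall>i j. g i j = (\<Sum>k\<in>S. b k i * b k j)"
  using assms
proof (induction S arbitrary: g rule: finite_induct)
  case empty
  then show ?case by auto
next
  case (insert k S)
  note sym = insert.prems(1) and psd = insert.prems(2) and supp = insert.prems(3)
  note shift = quadratic_form_shift[where I=UNIV and g=g, OF finite UNIV_I sym]
  have single: "(\<Sum>i\<in>UNIV. \<Sum>l\<in>UNIV. of_bool (i = k) * g i l * of_bool (l = k)) = g k k"
    using shift[of "\<lambda>_. 0" 1 k] by simp
  show ?case
  proof (cases "g k k = 0")
    case True
    have row: "g k j = 0" for j
    proof -
      have "(\<Sum>l\<in>UNIV. g j l * of_bool (l = k)) = 0"
        by (rule psd_kernel[where g=g]) (use single True sym psd in auto)
      then show ?thesis using sym[of k j] by simp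
    qed
    have "\<exists>b. \<forall>i j. g i j = (\<Sum>k\<in>S. b k i * b k j)"
    proof (rule insert.IH[OF sym psd])
      show "g i j = 0" if "i \<notin> S" for i j
        using that row supp[of i j] by (cases "i = k") auto
    qed
    then obtain b where b: "\<And>i j. g i j = (\<Sum>k\<in>S. b k i * b k j)" by blast
    have "g i j = (\<Sum>l\<in>insert k S. (b(k := \<lambda>_. 0)) l i * (b(k := \<lambda>_. 0)) l j)" for i j
    proof -
      have "(\<Sum>l\<in>S. (b(k := \<lambda>_. 0)) l i * (b(k := \<lambda>_. 0)) l j) = (\<Sum>l\<in>S. b l i * b l j)"
        using insert.hyps by (intro sum.cong) auto
      then show ?thesis using insert.hyps b by simp
    qed
    then show ?thesis by blast
  next
    case False
    have pos: "0 < g k k"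
      using psd[of "\<lambda>i. of_bool (i = k)"] False single by simp
    define h where "h i j = g i j - g k i * g k j / g k k" for i j
    have "\<exists>b. \<forall>i j. h i j = (\<Sum>k\<in>S. b k i * b k j)"
    proof (rule insert.IH)
      show "h i j = h j i" for i j
        using sym[of i j] by (simp add: h_def)
      show "h i j = 0" if "i \<notin> S" for i j
        using that supp[of i] pos sym[of i k] by (cases "i = k") (auto simp: h_def)
      show "0 \<le> bilinear_form UNIV h x x" for x
      proof -
        define m where "m = (\<Sum>j\<in>UNIV. g k j * x j)"
        have "bilinear_form UNIV h x x =
            bilinear_form UNIV g x x - (\<Sum>i\<in>UNIV. \<Sum>j\<in>UNIV. (g k i * x i) * (g k j * x j)) / g k k"
          by (simp add: h_def sum_subtractf[symmetric] sum_divide_distrib algebra_simps)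
        also have "(\<Sum>i\<in>UNIV. \<Sum>j\<in>UNIV. (g k i * x i) * (g k j * x j)) = m\<^sup>2"
          by (simp add: m_def power2_eq_square sum_product)
        also have "bilinear_form UNIV g x x - m\<^sup>2 / g k k =
            (\<Sum>i\<in>UNIV. \<Sum>j\<in>UNIV. (x i + (- m / g k k) * of_bool (i = k)) * g i j * (x j + (- m / g k k) * of_bool (j = k)))"
          unfolding shift m_def[symmetric] using pos by (simp add: power2_eq_square field_simps)
        finally show ?thesis using psd by simp
      qed
    qed
    then obtain b where b: "\<And>i j. h i j = (\<Sum>k\<in>S. b k i * b k j)" by blast
    define b' where "b' = b(k := \<lambda>i. g k i / sqrt (g k k))"
    have "g i j = (\<Sum>l\<in>insert k S. b' l i * b' l j)" for i j
    proof -
      have "(\<Sum>l\<in>S. b' l i * b' l j) = (\<Sum>l\<in>S. b l i * b l j)"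
        using insert.hyps by (intro sum.cong) (auto simp: b'_def)
      also have "\<dots> = g i j - g k i * g k j / g k k" by (simp add: b[symmetric] h_def)
      finally show ?thesis using insert.hyps pos by (simp add: b'_def)
    qed
    then show ?thesis by blast
  qed
qed

lemma prob_space_std_normal: "prob_space std_normal_distribution"
  using real_dist_normal_dist by (simp add: real_distribution_def)

lemma normal_law_eq_distr:
  assumes "0 \<le> v"
  shows "normal_law 0 v = distr std_normal_distribution borel (\<lambda>x. sqrt v * x)"
proof (cases "v = 0")
  case True
  interpret prob_space std_normal_distribution by (rule prob_space_std_normal)
  show ?thesis
    using True by (simp add: normal_law_def distr_const)
next
  case False
  interpret prob_space std_normal_distribution by (rule prob_space_std_normal)
  have "distributed std_normal_distribution lborel (\<lambda>x. x) (\<lambda>x. ennreal (normal_density 0 1 x))"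
    by (auto simp: distributed_def distr_id2)
  from normal_density_affine[OF this, of "sqrt v" 0] False assms
  have "distributed std_normal_distribution lborel (\<lambda>x. sqrt v * x) (\<lambda>x. ennreal (normal_density 0 (sqrt v) x))"
    by simp
  then have "distr std_normal_distribution lborel (\<lambda>x. sqrt v * x) = density lborel (\<lambda>x. ennreal (normal_density 0 (sqrt v) x))"
    by (rule distributed_distr_eq_density)
  moreover have "distr std_normal_distribution borel (\<lambda>x. sqrt v * x) = distr std_normal_distribution lborel (\<lambda>x. sqrt v * x)"
    by (rule distr_cong) auto
  ultimately show ?thesis using False by (simp add: normal_law_def)
qed

lemma real_distribution_normal_law:
  assumes "0 \<le> v"
  shows "real_distribution (normal_law 0 v)"
  unfolding normal_law_eq_distr[OF assms]
  by (rule prob_space.real_distribution_distr[OF prob_space_std_normal]) simp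

lemma char_normal_law:
  assumes "0 \<le> v"
  shows "char (normal_law 0 v) s = complex_of_real (exp (- (s\<^sup>2 * v) / 2))"
proof -
  have "char (normal_law 0 v) s = char std_normal_distribution (s * sqrt v)"
    unfolding normal_law_eq_distr[OF assms] char_def
    by (subst integral_distr) (auto simp: ac_simps)
  then show ?thesis using assms by (simp add: char_std_normal_distribution power_mult_distrib)
qed

lemma char_linear_functional_std_normal:
  fixes c :: "'q::finite \<Rightarrow> real"
  shows "(LINT z|PiM UNIV (\<lambda>_. std_normal_distribution). iexp (\<Sum>k\<in>UNIV. c k * z k)) =
    complex_of_real (exp (- (\<Sum>k\<in>UNIV. (c k)\<^sup>2) / 2))"
proof -
  interpret product_prob_space "\<lambda>_. std_normal_distribution" "UNIV :: 'q set"
    by (simp add: product_prob_spaceI prob_space_std_normal)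
  interpret std: prob_space std_normal_distribution by (rule prob_space_std_normal)
  have "(LINT z|PiM UNIV (\<lambda>_. std_normal_distribution). iexp (\<Sum>k\<in>UNIV. c k * z k)) =
      (LINT z|PiM UNIV (\<lambda>_. std_normal_distribution). (\<Prod>k\<in>UNIV. iexp (c k * z k)))"
    by (simp add: sum_distrib_left exp_sum)
  also have "\<dots> = (\<Prod>k\<in>UNIV. LINT x|std_normal_distribution. iexp (c k * x))"
    by (rule product_integral_prod) (auto intro!: prob_space.integrable_iexp[OF prob_space_std_normal] simp del: of_real_mult)
  also have "\<dots> = (\<Prod>k\<in>UNIV. char std_normal_distribution (c k))"
    by (simp add: char_def)
  also have "\<dots> = complex_of_real (exp (- (\<Sum>k\<in>UNIV. (c k)\<^sup>2) / 2))"
    unfolding char_std_normal_distribution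
    by (simp add: exp_sum[symmetric] sum_negf sum_divide_distrib flip: of_real_prod)
  finally show ?thesis .
qed

lemma multivariate_normal_exists:
  fixes G :: "real ^ 'q ^ 'q"
  assumes sym: "Finite_Cartesian_Product.transpose G = G" and psd: "\<And>t. 0 \<le> inner t (G *v t)"
  shows "\<exists>N. is_multivariate_normal 0 G N \<and>
    (\<forall>t. (LINT x|N. iexp (inner t x)) = complex_of_real (exp (- inner t (G *v t) / 2)))"
proof -
  have quad: "inner t (G *v t) = (\<Sum>i\<in>UNIV. \<Sum>j\<in>UNIV. t $ i * G $ i $ j * t $ j)" for t
    by (simp add: inner_vec_def matrix_vector_mult_def sum_distrib_left mult.assoc)
  have "\<exists>b :: 'q \<Rightarrow> 'q \<Rightarrow> real. \<forall>i j. G $ i $ j = (\<Sum>k\<in>UNIV. b k i * b k j)"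
  proof (rule psd_sum_rank_one)
    show "G $ i $ j = G $ j $ i" for i j
      using sym by (metis transpose_def vec_lambda_beta)
    show "0 \<le> (\<Sum>i\<in>UNIV. \<Sum>j\<in>UNIV. x i * G $ i $ j * x j)" for x
      using psd[of "\<chi> i. x i"] by (simp add: quad)
  qed auto
  then obtain b :: "'q \<Rightarrow> 'q \<Rightarrow> real" where b: "\<And>i j. G $ i $ j = (\<Sum>k\<in>UNIV. b k i * b k j)" by blast
  define P where "P = PiM (UNIV::'q set) (\<lambda>_. std_normal_distribution)"
  define T :: "('q \<Rightarrow> real) \<Rightarrow> real ^ 'q" where "T z = (\<chi> i. \<Sum>k\<in>UNIV. b k i * z k)" for z
  define c where "c t k = (\<Sum>i\<in>UNIV. t $ i * b k i)" for t :: "real ^ 'q" and k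
  interpret P: prob_space P
    unfolding P_def by (intro prob_space_PiM prob_space_std_normal)
  have T_inner: "inner t (T z) = (\<Sum>k\<in>UNIV. c t k * z k)" for t z
    by (simp add: inner_vec_def T_def c_def sum_distrib_left sum_distrib_right ac_simps) (rule sum.swap)
  have c_sum: "(\<Sum>k\<in>UNIV. (c t k)\<^sup>2) = inner t (G *v t)" for t
  proof -
    have "(\<Sum>k\<in>UNIV. (c t k)\<^sup>2) = (\<Sum>k\<in>UNIV. \<Sum>i\<in>UNIV. \<Sum>j\<in>UNIV. t $ i * (b k i * b k j) * t $ j)"
      by (simp add: c_def power2_eq_square sum_product ac_simps)
    also have "\<dots> = (\<Sum>i\<in>UNIV. \<Sum>k\<in>UNIV. \<Sum>j\<in>UNIV. t $ i * (b k i * b k j) * t $ j)"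
      by (rule sum.swap)
    also have "\<dots> = (\<Sum>i\<in>UNIV. \<Sum>j\<in>UNIV. \<Sum>k\<in>UNIV. t $ i * (b k i * b k j) * t $ j)"
      by (intro sum.cong refl sum.swap)
    finally show ?thesis by (simp add: quad b sum_distrib_left sum_distrib_right)
  qed
  have T: "T \<in> borel_measurable P"
  proof (rule borel_measurable_euclidean_space[THEN iffD2], intro ballI)
    fix e :: "real ^ 'q"
    have comp: "(\<lambda>z. z k) \<in> borel_measurable P" for k
      using measurable_component_singleton[of k UNIV "\<lambda>_. std_normal_distribution"]
      unfolding P_def by simp
    have "inner (T z) e = (\<Sum>k\<in>UNIV. c e k * z k)" for z
      by (simp add: T_inner inner_commute)
    then show "(\<lambda>z. inner (T z) e) \<in> borel_measurable P"
      using comp by simp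
  qed
  define N where "N = distr P borel T"
  have charN: "(LINT x|N. iexp (inner t x)) = complex_of_real (exp (- inner t (G *v t) / 2))" for t
  proof -
    have "(LINT x|N. iexp (inner t x)) = (LINT z|P. iexp (inner t (T z)))"
      unfolding N_def by (rule integral_distr[OF T]) simp
    also have "\<dots> = complex_of_real (exp (- inner t (G *v t) / 2))"
      unfolding T_inner P_def char_linear_functional_std_normal c_sum ..
    finally show ?thesis .
  qed
  have "is_multivariate_normal 0 G N"
    unfolding is_multivariate_normal_def
  proof (intro conjI allI)
    show N: "prob_space N" unfolding N_def by (rule P.prob_space_distr[OF T])
    show sN: "sets N = sets borel" by (simp add: N_def)
    fix t :: "real ^ 'q"
    have m: "(\<lambda>x. inner t x) \<in> borel_measurable N" using sN by measurable
    show "distr N borel (\<lambda>x. inner t x) = normal_law (inner t 0) (inner t (G *v t))"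
    proof (rule Levy_uniqueness)
      show "real_distribution (distr N borel (\<lambda>x. inner t x))"
        by (rule prob_space.real_distribution_distr[OF N m])
      show "real_distribution (normal_law (inner t 0) (inner t (G *v t)))"
        using real_distribution_normal_law[OF psd] by simp
      show "char (distr N borel (\<lambda>x. inner t x)) = char (normal_law (inner t 0) (inner t (G *v t)))"
      proof
        fix s
        have "char (distr N borel (\<lambda>x. inner t x)) s = (LINT x|N. iexp (inner (s *\<^sub>R t) x))"
          unfolding char_def by (subst integral_distr[OF m]) auto
        then show "char (distr N borel (\<lambda>x. inner t x)) s = char (normal_law (inner t 0) (inner t (G *v t))) s"
          unfolding charN
          by (simp add: char_normal_law[OF psd] matrix_vector_mult_scaleR power2_eq_square ac_simps)
      qed
    qed
  qed
  with charN show ?thesis by blast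
qed

section \<open>A central limit theorem for row-wise identically distributed arrays\<close>

lemma integrable_abs_le:
  fixes f g :: "'a \<Rightarrow> real"
  assumes "integrable P g" "f \<in> borel_measurable P" "\<And>x. \<bar>f x\<bar> \<le> g x"
  shows "integrable P f"
  by (rule Bochner_Integration.integrable_bound[OF assms(1,2)]) (use assms(3) in \<open>auto intro!: AE_I2 intro: order_trans[OF _ abs_ge_self]\<close>)

text \<open>The proof of the central limit theorem in the library, with a Lindeberg condition in place of
  dominated convergence.\<close>

lemma row_iid_central_limit:
  fixes \<xi> :: "nat \<Rightarrow> nat \<Rightarrow> 'a \<Rightarrow> real"
  assumes M: "\<And>n. prob_space (M n)"
    and indep: "\<And>n. prob_space.indep_vars (M n) (\<lambda>_. borel) (\<xi> n) {..<n}"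
    and law: "\<And>n i. i < n \<Longrightarrow> distr (M n) borel (\<xi> n i) = L n"
    and L: "\<And>n. real_distribution (L n)"
    and mean: "\<And>n. integrable (L n) (\<lambda>x. x)" "\<And>n. (LINT x|L n. x) = 0"
    and square: "\<And>n. integrable (L n) (\<lambda>x. x\<^sup>2)"
    and var: "(\<lambda>n. LINT x|L n. x\<^sup>2) \<longlonglongrightarrow> v"
    and lindeberg: "\<And>\<eta>. 0 < \<eta> \<Longrightarrow>
      (\<lambda>n. LINT x|L n. x\<^sup>2 * indicator {x. \<eta> * sqrt (real n) < \<bar>x\<bar>} x) \<longlonglongrightarrow> 0"
  shows "(\<lambda>n. LINT \<omega>|M n. iexp ((\<Sum>i<n. \<xi> n i \<omega>) / sqrt (real n))) \<longlonglongrightarrow> complex_of_real (exp (- v / 2))"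
proof -
  define V where "V n = (LINT x|L n. x\<^sup>2)" for n
  define r where "r n = (LINT x|L n. min (6 * x\<^sup>2) (\<bar>1 / sqrt (real n)\<bar> * \<bar>x\<bar> ^ 3))" for n
  define \<phi> where "\<phi> n = (LINT \<omega>|M n. iexp ((\<Sum>i<n. \<xi> n i \<omega>) / sqrt (real n)))" for n
  have V0: "0 \<le> V n" for n by (simp add: V_def)
  have v0: "0 \<le> v" using var unfolding V_def[symmetric] by (rule LIMSEQ_le_const) (use V0 in auto)
  have [measurable_cong]: "sets (L n) = sets borel" for n
    using real_distribution.events_eq_borel[OF L] by simp
  have main: "norm (\<phi> n - (1 + (- v / 2) / n) ^ n) \<le> r n / 6 + \<bar>V n - v\<bar> / 2"
    if n: "0 < n" "v / 4 \<le> n" for n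
  proof -
    interpret M: prob_space "M n" by (rule M)
    interpret L: real_distribution "L n" by (rule L)
    define t where "t = 1 / sqrt (real n)"
    define w where "w = complex_of_real (1 + (- v / 2) / n)"
    have t2: "t\<^sup>2 = 1 / n" by (simp add: t_def power_divide)
    have \<xi>: "\<xi> n i \<in> borel_measurable (M n)" if "i < n" for i
      using indep[of n] that unfolding M.indep_vars_def2 by blast
    have "\<phi> n = char (distr (M n) borel (\<lambda>\<omega>. \<Sum>i<n. \<xi> n i \<omega>)) t"
      unfolding char_def \<phi>_def t_def using \<xi>
      by (subst integral_distr) (auto intro!: borel_measurable_sum)
    also have "\<dots> = (\<Prod>i<n. char (distr (M n) borel (\<xi> n i)) t)"
      by (rule M.char_distr_sum[OF indep])
    also have "\<dots> = char (L n) t ^ n" by (simp add: law)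
    finally have \<phi>: "\<phi> n = char (L n) t ^ n" .
    define z where "z = complex_of_real (1 - t\<^sup>2 * V n / 2)"
    have "r n = (LINT x|L n. min (6 * x\<^sup>2) (\<bar>t\<bar> * \<bar>x\<bar> ^ 3))"
      by (simp only: r_def t_def)
    moreover have "norm (char (L n) t - z) \<le> t\<^sup>2 / 6 * (LINT x|L n. min (6 * x\<^sup>2) (\<bar>t\<bar> * \<bar>x\<bar> ^ 3))"
      unfolding z_def by (rule L.char_approx3) (use mean square in \<open>simp_all add: V_def\<close>)
    ultimately have "norm (char (L n) t - z) \<le> t\<^sup>2 / 6 * r n"
      by simp
    then have 1: "norm (char (L n) t - z) \<le> r n / (6 * n)"
      by (simp add: t2)
    have "z - w = complex_of_real ((v - V n) / (2 * n))"
      unfolding z_def w_def t2 using n by (simp add: field_simps)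
    then have 2: "norm (z - w) = \<bar>V n - v\<bar> / (2 * n)"
      by (simp only: norm_of_real) (simp add: abs_minus_commute)
    have "norm w \<le> 1"
      unfolding w_def norm_of_real using n v0 by (auto simp: abs_le_iff field_simps)
    then have "norm (\<phi> n - w ^ n) \<le> n * norm (char (L n) t - w)"
      unfolding \<phi> by (intro norm_power_diff L.cmod_char_le_1)
    also have "\<dots> \<le> n * (r n / (6 * n) + \<bar>V n - v\<bar> / (2 * n))"
      using norm_triangle_ineq[of "char (L n) t - z" "z - w"] 1 2
      by (intro mult_left_mono) auto
    also have "\<dots> = r n / 6 + \<bar>V n - v\<bar> / 2" using n by (simp add: field_simps)
    finally show ?thesis unfolding w_def by simp
  qed
  have r0: "r \<longlonglongrightarrow> 0"
  proof (rule LIMSEQ_I)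
    fix e :: real assume e: "0 < e"
    define \<eta> where "\<eta> = e / (2 * (v + 1))"
    have \<eta>: "0 < \<eta>" using e v0 by (simp add: \<eta>_def)
    have "v + 1 \<noteq> 0" using v0 by linarith
    then have \<eta>2: "\<eta> * (v + 1) = e / 2"
      unfolding \<eta>_def by (simp only: times_divide_eq_left nonzero_mult_divide_mult_cancel_right not_False_eq_True)
    let ?f = "\<lambda>n x :: real. x\<^sup>2 * indicator {x. \<eta> * sqrt (real n) < \<bar>x\<bar>} x"
    define l where "l n = (LINT x|L n. ?f n x)" for n
    have r_le: "r n \<le> 6 * l n + \<eta> * V n" for n
    proof -
      interpret L: real_distribution "L n" by (rule L)
      note [simp] = square
      have i: "integrable (L n) (?f n)"
        by (rule integrable_abs_le[OF square]) (auto simp: indicator_def)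
      have "r n \<le> (LINT x|L n. 6 * ?f n x + \<eta> * x\<^sup>2)"
        unfolding r_def
      proof (rule integral_mono)
        show "integrable (L n) (\<lambda>x. min (6 * x\<^sup>2) (\<bar>1 / sqrt (real n)\<bar> * \<bar>x\<bar> ^ 3))"
          by (rule integrable_abs_le[of _ "\<lambda>x. 6 * x\<^sup>2"]) auto
        show "integrable (L n) (\<lambda>x. 6 * ?f n x + \<eta> * x\<^sup>2)"
          using i by simp
        fix x
        show "min (6 * x\<^sup>2) (\<bar>1 / sqrt (real n)\<bar> * \<bar>x\<bar> ^ 3) \<le>
            6 * ?f n x + \<eta> * x\<^sup>2"
        proof (cases "\<eta> * sqrt (real n) < \<bar>x\<bar>")
          case True
          then show ?thesis using \<eta> by (simp add: min.coboundedI1)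
        next
          case False
          have "\<bar>1 / sqrt (real n)\<bar> * \<bar>x\<bar> \<le> \<eta>"
            using False \<eta> by (cases "n = 0") (auto simp: field_simps not_less)
          then have "\<bar>1 / sqrt (real n)\<bar> * \<bar>x\<bar> * x\<^sup>2 \<le> \<eta> * x\<^sup>2" by (rule mult_right_mono) simp
          then have "\<bar>1 / sqrt (real n)\<bar> * \<bar>x\<bar> ^ 3 \<le> \<eta> * x\<^sup>2"
            by (simp add: power3_eq_cube power2_eq_square)
          then show ?thesis using False by (auto intro: min.coboundedI2)
        qed
      qed
      also have "\<dots> = 6 * l n + \<eta> * V n"
        using i by (simp add: l_def V_def)
      finally show ?thesis .
    qed
    have rn: "0 \<le> r n" for n unfolding r_def by (rule Bochner_Integration.integral_nonneg) auto
    have "(\<lambda>n. 6 * l n + \<eta> * V n) \<longlonglongrightarrow> 6 * 0 + \<eta> * v"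
      unfolding l_def V_def by (intro tendsto_intros lindeberg \<eta> var)
    moreover have "6 * 0 + \<eta> * v < e" using \<eta> \<eta>2 e by (simp add: algebra_simps)
    ultimately have "\<forall>\<^sub>F n in sequentially. 6 * l n + \<eta> * V n < e" by (rule order_tendstoD)
    then obtain no where "\<And>n. n \<ge> no \<Longrightarrow> 6 * l n + \<eta> * V n < e" by (auto simp: eventually_sequentially)
    then have "norm (r n - 0) < e" if "n \<ge> no" for n
      using r_le[of n] rn[of n] that by (fastforce simp: abs_of_nonneg)
    then show "\<exists>no. \<forall>n\<ge>no. norm (r n - 0) < e" by blast
  qed
  have "(\<lambda>n. r n / 6 + \<bar>V n - v\<bar> / 2) \<longlonglongrightarrow> 0 / 6 + \<bar>v - v\<bar> / 2"
    using var unfolding V_def[symmetric] by (intro tendsto_intros r0) simp_all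
  then have "(\<lambda>n. r n / 6 + \<bar>V n - v\<bar> / 2) \<longlonglongrightarrow> 0" by simp
  moreover have "\<forall>\<^sub>F n in sequentially. norm (\<phi> n - (1 + (- v / 2) / n) ^ n) \<le> r n / 6 + \<bar>V n - v\<bar> / 2"
    by (rule eventually_sequentiallyI[of "max 1 (nat \<lceil>v / 4\<rceil>)"]) (rule main, auto simp: nat_ceiling_le_eq)
  ultimately have "(\<lambda>n. \<phi> n - (1 + (- v / 2) / n) ^ n) \<longlonglongrightarrow> 0"
    by (rule Lim_null_comparison[rotated])
  moreover have "(\<lambda>n. complex_of_real ((1 + (- v / 2) / n) ^ n)) \<longlonglongrightarrow> complex_of_real (exp (- v / 2))"
    by (rule isCont_tendsto_compose[OF _ tendsto_exp_limit_sequentially]) auto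
  ultimately have "(\<lambda>n. (\<phi> n - (1 + (- v / 2) / n) ^ n) + complex_of_real ((1 + (- v / 2) / n) ^ n))
      \<longlonglongrightarrow> 0 + complex_of_real (exp (- v / 2))"
    by (rule tendsto_add)
  then have "\<phi> \<longlonglongrightarrow> complex_of_real (exp (- v / 2))" by simp
  then show ?thesis unfolding \<phi>_def .
qed

section \<open>Smallest eigenvalue and inverse of a positive definite matrix\<close>

lemma compact_unit_sphere_fun:
  "compact {x :: nat \<Rightarrow> real. (\<forall>i. i \<notin> {..<m} \<longrightarrow> x i = 0) \<and> (\<Sum>i<m. (x i)\<^sup>2) = 1}"
proof -
  define B :: "nat \<Rightarrow> real set" where "B i = (if i < m then {-1..1} else {0})" for i
  have "compactin (product_topology (\<lambda>_. euclidean) UNIV) (Pi\<^sub>E UNIV B)"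
    unfolding compactin_PiE by (auto simp: compactin_euclidean_iff B_def)
  then have "compact (Pi\<^sub>E UNIV B)"
    by (simp add: euclidean_product_topology compactin_euclidean_iff)
  moreover have "closed {x :: nat \<Rightarrow> real. (\<Sum>i<m. (x i)\<^sup>2) = 1}"
    by (intro closed_Collect_eq continuous_intros continuous_on_product_coordinates)
  ultimately have "compact (Pi\<^sub>E UNIV B \<inter> {x. (\<Sum>i<m. (x i)\<^sup>2) = 1})"
    by (rule compact_Int_closed)
  moreover have B: "x i \<in> B i" if "\<forall>i. i \<notin> {..<m} \<longrightarrow> x i = 0" "(\<Sum>i<m. (x i)\<^sup>2) = 1" for x i
  proof (cases "i < m")
    case True
    then have "(x i)\<^sup>2 \<le> (\<Sum>i<m. (x i)\<^sup>2)"
      by (intro member_le_sum) auto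
    then have "\<bar>x i\<bar> \<le> 1" using that by (simp add: abs_square_le_1)
    then show ?thesis using True by (simp add: B_def abs_le_iff)
  next
    case False
    then show ?thesis using that by (simp add: B_def)
  qed
  have "Pi\<^sub>E UNIV B \<inter> {x. (\<Sum>i<m. (x i)\<^sup>2) = 1} =
      {x. (\<forall>i. i \<notin> {..<m} \<longrightarrow> x i = 0) \<and> (\<Sum>i<m. (x i)\<^sup>2) = 1}"
  proof (intro equalityI subsetI)
    fix x assume "x \<in> Pi\<^sub>E UNIV B \<inter> {x. (\<Sum>i<m. (x i)\<^sup>2) = 1}"
    then show "x \<in> {x. (\<forall>i. i \<notin> {..<m} \<longrightarrow> x i = 0) \<and> (\<Sum>i<m. (x i)\<^sup>2) = 1}"
      by (auto simp: PiE_def Pi_def B_def split: if_splits)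
  qed (use B in auto)
  ultimately show ?thesis by simp
qed

text \<open>A minimiser of the Rayleigh quotient is an eigenvector.\<close>

lemma lambda_min_le_quadratic_form:
  fixes S :: "real mat"
  assumes S: "S \<in> carrier_mat m m" and m: "0 < m" and sym: "transpose_mat S = S"
  shows "lambda_min S * (\<Sum>j<m. (u j)\<^sup>2) \<le> (\<Sum>j<m. \<Sum>k<m. u j * S $$ (j, k) * u k)"
proof -
  define Q where "Q u = (\<Sum>j<m. \<Sum>k<m. u j * S $$ (j, k) * u k)" for u :: "nat \<Rightarrow> real"
  define K where "K = {x :: nat \<Rightarrow> real. (\<forall>i. i \<notin> {..<m} \<longrightarrow> x i = 0) \<and> (\<Sum>i<m. (x i)\<^sup>2) = 1}"
  have sym': "S $$ (j, k) = S $$ (k, j)" if "j < m" "k < m" for j k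
    using sym S that by (metis carrier_matD index_transpose_mat(1))
  have Q_cong: "Q u = Q u'" if "\<And>i. i < m \<Longrightarrow> u i = u' i" for u u'
    unfolding Q_def using that by (intro sum.cong) auto
  have "(\<lambda>i. of_bool (i = 0)) \<in> K"
    using m by (auto simp: K_def of_bool_def if_distrib[of "\<lambda>x. x\<^sup>2"] cong: if_cong)
  then have "K \<noteq> {}" by auto
  moreover have "continuous_on K Q"
    unfolding Q_def
    by (intro continuous_intros continuous_on_subset[OF continuous_on_product_coordinates] subset_UNIV)
  moreover have "compact K"
    unfolding K_def by (rule compact_unit_sphere_fun)
  ultimately have "\<exists>v\<in>K. \<forall>x\<in>K. Q v \<le> Q x"
    by (intro continuous_attains_inf)
  then obtain v where v: "v \<in> K" "\<And>x. x \<in> K \<Longrightarrow> Q v \<le> Q x"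
    by blast
  define \<kappa> where "\<kappa> = Q v"
  have ge: "\<kappa> * (\<Sum>j<m. (x j)\<^sup>2) \<le> Q x" for x
  proof (cases "(\<Sum>j<m. (x j)\<^sup>2) = 0")
    case True
    then have "x j = 0" if "j < m" for j
      using that by (simp add: sum_nonneg_eq_0_iff)
    then have "Q x = 0" by (simp add: Q_def)
    then show ?thesis using True by simp
  next
    case False
    define r where "r = sqrt (\<Sum>j<m. (x j)\<^sup>2)"
    have r2: "r\<^sup>2 = (\<Sum>j<m. (x j)\<^sup>2)" by (simp add: r_def sum_nonneg)
    have r: "r \<noteq> 0" using False by (simp add: r_def)
    define y where "y i = (if i < m then x i / r else 0)" for i
    have "(\<Sum>j<m. (y j)\<^sup>2) = (\<Sum>j<m. (x j)\<^sup>2) / r\<^sup>2"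
      by (simp add: y_def power_divide sum_divide_distrib)
    then have "y \<in> K" using r by (simp add: K_def r2[symmetric]) (simp add: y_def)
    then have "\<kappa> \<le> Q y" using v by (simp add: \<kappa>_def)
    also have "Q y = Q x / r\<^sup>2"
      by (simp add: Q_def y_def sum_divide_distrib power2_eq_square)
    finally show ?thesis using r by (simp add: field_simps flip: r2)
  qed
  define g where "g j k = S $$ (j, k) - \<kappa> * of_bool (j = k)" for j k
  have delta: "(\<Sum>k<m. x k * of_bool (j = k)) = x j" if "j < m" for x :: "nat \<Rightarrow> real" and j
    using that by (simp add: of_bool_def if_distrib[of "\<lambda>z. _ * z"] cong: if_cong)
  have Qg: "bilinear_form {..<m} g x x = Q x - \<kappa> * (\<Sum>j<m. (x j)\<^sup>2)" for x
  proof -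
    have "bilinear_form {..<m} g x x = Q x - (\<Sum>j<m. \<kappa> * x j * (\<Sum>k<m. x k * of_bool (j = k)))"
    proof -
      have "x j * g j k * x k = x j * S $$ (j, k) * x k - \<kappa> * x j * (x k * of_bool (j = k))" for j k
        by (simp add: g_def algebra_simps)
      then show ?thesis by (simp only: Q_def sum_subtractf sum_distrib_left)
    qed
    also have "(\<Sum>j<m. \<kappa> * x j * (\<Sum>k<m. x k * of_bool (j = k))) = \<kappa> * (\<Sum>j<m. (x j)\<^sup>2)"
      by (simp add: delta power2_eq_square mult.assoc flip: sum_distrib_left)
    finally show ?thesis .
  qed
  have eig: "(\<Sum>k<m. S $$ (j, k) * v k) = \<kappa> * v j" if j: "j < m" for j
  proof -
    have "(\<Sum>k<m. g j k * v k) = 0"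
    proof (rule psd_kernel[where g=g])
      show "0 \<le> bilinear_form {..<m} g x x" for x using ge by (simp add: Qg)
      show "bilinear_form {..<m} g v v = 0" using v(1) by (simp add: Qg \<kappa>_def K_def)
    qed (use j sym' in \<open>auto simp: g_def\<close>)
    also have "(\<Sum>k<m. g j k * v k) = (\<Sum>k<m. S $$ (j, k) * v k) - \<kappa> * (\<Sum>k<m. v k * of_bool (j = k))"
    proof -
      have "g j k * v k = S $$ (j, k) * v k - \<kappa> * (v k * of_bool (j = k))" for k
        by (simp add: g_def algebra_simps)
      then show ?thesis by (simp only: sum_subtractf sum_distrib_left)
    qed
    finally show ?thesis using delta[OF j] by simp
  qed
  have "eigenvector S (Matrix.vec m v) \<kappa>"
    unfolding eigenvector_def
  proof (intro conjI)
    show "Matrix.vec m v \<in> carrier_vec (dim_row S)" using S by simp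
    show "S *\<^sub>v Matrix.vec m v = \<kappa> \<cdot>\<^sub>v Matrix.vec m v"
    proof (rule Matrix.eq_vecI)
      fix j assume "j < dim_vec (\<kappa> \<cdot>\<^sub>v Matrix.vec m v)"
      then show "vec_index (S *\<^sub>v Matrix.vec m v) j = vec_index (\<kappa> \<cdot>\<^sub>v Matrix.vec m v) j"
        using S eig[of j] by (simp add: scalar_prod_def lessThan_atLeast0)
    qed (use S in simp)
    show "Matrix.vec m v \<noteq> 0\<^sub>v (dim_row S)"
    proof
      assume *: "Matrix.vec m v = 0\<^sub>v (dim_row S)"
      have "v j = 0" if "j < m" for j
        using arg_cong[OF *, of "\<lambda>x. vec_index x j"] that S by simp
      then show False using v(1) by (simp add: K_def)
    qed
  qed
  then have "\<kappa> \<in> spectrum S"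
    by (auto simp: spectrum_def eigenvalue_def)
  then have "lambda_min S \<le> \<kappa>"
    unfolding lambda_min_def using card_finite_spectrum(1)[OF S] by (rule Min_le[rotated])
  then have "lambda_min S * (\<Sum>j<m. (u j)\<^sup>2) \<le> \<kappa> * (\<Sum>j<m. (u j)\<^sup>2)"
    by (intro mult_right_mono) (auto intro: sum_nonneg)
  with ge[of u] show ?thesis by (simp add: Q_def)
qed

lemma pos_def_mat_inverse:
  assumes S: "S \<in> carrier_mat m m" and pd: "pos_def_mat S"
  obtains B where "mat_inverse S = Some B" "B \<in> carrier_mat m m" "S * B = 1\<^sub>m m" "B * S = 1\<^sub>m m"
proof -
  have "Determinant.det S \<noteq> 0"
  proof
    assume "Determinant.det S = 0"
    then obtain v where v: "v \<in> carrier_vec m" "v \<noteq> 0\<^sub>v m" "S *\<^sub>v v = 0\<^sub>v m"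
      using det_0_iff_vec_prod_zero_field[OF S] by blast
    then have "0 < scalar_prod v (S *\<^sub>v v)"
      using pd S by (auto simp: pos_def_mat_def)
    then show False using v by simp
  qed
  then have "S \<in> Units (ring_mat TYPE(real) m (undefined :: unit))"
    by (rule det_non_zero_imp_unit[OF S])
  then have "mat_inverse S \<noteq> None"
    using mat_inverse(1)[OF S, of "undefined :: unit"] by blast
  then obtain B where "mat_inverse S = Some B" by blast
  with mat_inverse(2)[OF S this] that show ?thesis by blast
qed

lemma sum_mat_mult_inverse:
  fixes S B :: "real mat"
  assumes "S \<in> carrier_mat m m" "B \<in> carrier_mat m m" "S * B = 1\<^sub>m m" "j < m"
  shows "(\<Sum>k<m. S $$ (j, k) * (\<Sum>l<m. B $$ (k, l) * a l)) = a j"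
proof -
  have SB: "(\<Sum>k<m. S $$ (j, k) * B $$ (k, l)) = of_bool (j = l)" if "l < m" for l
  proof -
    have "(S * B) $$ (j, l) = (\<Sum>k<m. S $$ (j, k) * B $$ (k, l))"
      using assms(1,2,4) that by (simp add: scalar_prod_def lessThan_atLeast0)
    then show ?thesis using assms that by (cases "j = l") simp_all
  qed
  have "(\<Sum>k<m. S $$ (j, k) * (\<Sum>l<m. B $$ (k, l) * a l)) = (\<Sum>l<m. \<Sum>k<m. S $$ (j, k) * B $$ (k, l) * a l)"
    unfolding sum_distrib_left by (subst sum.swap) (simp add: mult.assoc)
  also have "\<dots> = (\<Sum>l<m. of_bool (j = l) * a l)"
    by (rule sum.cong) (auto simp: SB simp flip: sum_distrib_right)
  also have "\<dots> = a j"
    using assms by (simp add: of_bool_def if_distrib[of "\<lambda>z. z * _"] cong: if_cong)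
  finally show ?thesis .
qed

section \<open>The estimating equation\<close>

definition clip :: "real \<Rightarrow> real \<Rightarrow> real" where
  "clip l r = max (- l) (min l r)"

lemma clip_mono: "r \<le> r' \<Longrightarrow> clip l r \<le> clip l r'"
  by (auto simp: clip_def)

text \<open>The penalty makes the objective strongly convex, and its minimiser is the soft threshold
  \<open>r - clip l r\<close>.\<close>

lemma soft_threshold_minimizer:
  fixes l r u :: real
  assumes l: "0 < l" and min: "\<And>z. (r - u)\<^sup>2 + 2 * l * \<bar>u\<bar> \<le> (r - z)\<^sup>2 + 2 * l * \<bar>z\<bar>"
  shows "r - u = clip l r"
proof -
  define c where "c = clip l r"
  define z where "z = r - c"
  have c: "c * u \<le> l * \<bar>u\<bar>" "c * z = l * \<bar>z\<bar>"
  proof -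
    have "\<bar>c\<bar> \<le> l" using l by (auto simp: c_def clip_def)
    then have "\<bar>c\<bar> * \<bar>u\<bar> \<le> l * \<bar>u\<bar>" by (rule mult_right_mono) simp
    then show "c * u \<le> l * \<bar>u\<bar>" by (metis abs_ge_self abs_mult order_trans)
    show "c * z = l * \<bar>z\<bar>"
      using l by (auto simp: z_def c_def clip_def max_def min_def abs_if algebra_simps)
  qed
  have "(r - u)\<^sup>2 = (r - z)\<^sup>2 - 2 * (c * u) + 2 * (c * z) + (u - z)\<^sup>2"
    by (simp add: z_def power2_eq_square algebra_simps)
  then have "(u - z)\<^sup>2 \<le> 0" using min[of z] c by linarith
  then show ?thesis by (simp add: z_def c_def)
qed

lemma sum_lessThan_split:
  fixes f :: "nat \<Rightarrow> 'b::comm_monoid_add"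
  assumes "s \<le> n"
  shows "(\<Sum>i<n. f i) = (\<Sum>i<s. f i) + (\<Sum>i\<in>{s..<n}. f i)"
proof -
  have "{..<n} = {..<s} \<union> {s..<n}" using assms by auto
  then show ?thesis by (simp add: sum.union_disjoint ivl_disj_int)
qed

lemma L2_Cauchy_Schwarz: "\<bar>\<Sum>j\<in>I. u j * v j\<bar> \<le> L2_set u I * L2_set v I"
proof -
  have "\<bar>\<Sum>j\<in>I. u j * v j\<bar> \<le> (\<Sum>j\<in>I. \<bar>u j\<bar> * \<bar>v j\<bar>)"
    using sum_abs[of "\<lambda>j. u j * v j" I] by (simp add: abs_mult)
  also have "\<dots> \<le> L2_set u I * L2_set v I" by (rule L2_set_mult_ineq)
  finally show ?thesis .
qed

lemma L2_set_power2: "(L2_set u I)\<^sup>2 = (\<Sum>j\<in>I. (u j)\<^sup>2)"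
  by (simp add: L2_set_def sum_nonneg)

lemma frobenius_bilinear_bound:
  "\<bar>\<Sum>j\<in>I. \<Sum>k\<in>J. u j * D j k * v k\<bar> \<le> frobenius_norm I J D * L2_set u I * L2_set v J"
proof -
  have "\<bar>\<Sum>j\<in>I. \<Sum>k\<in>J. u j * D j k * v k\<bar> = \<bar>\<Sum>j\<in>I. u j * (\<Sum>k\<in>J. D j k * v k)\<bar>"
    by (simp add: sum_distrib_left mult.assoc)
  also have "\<dots> \<le> L2_set u I * L2_set (\<lambda>j. \<Sum>k\<in>J. D j k * v k) I"
    by (rule L2_Cauchy_Schwarz)
  also have "\<dots> \<le> L2_set u I * (frobenius_norm I J D * L2_set v J)"
  proof (rule mult_left_mono)
    show "L2_set (\<lambda>j. \<Sum>k\<in>J. D j k * v k) I \<le> frobenius_norm I J D * L2_set v J"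
    proof -
    have "(\<Sum>j\<in>I. (\<Sum>k\<in>J. D j k * v k)\<^sup>2) \<le> (\<Sum>j\<in>I. (\<Sum>k\<in>J. (D j k)\<^sup>2) * (\<Sum>k\<in>J. (v k)\<^sup>2))"
      by (intro sum_mono Cauchy_Schwarz_ineq_sum)
    then show ?thesis
      by (simp add: L2_set_def frobenius_norm_def sum_distrib_right real_sqrt_mult[symmetric])
    qed
  qed (rule L2_set_nonneg)
  finally show ?thesis by (simp add: ac_simps)
qed

lemma penalized_minimizer_stationary:
  fixes l :: real
  assumes l: "0 < l"
    and min: "is_arg_min (\<lambda>(m, b). penalized_loss n p l x y m b) (\<lambda>_. True) (mh, bh)"
  shows "\<And>j. j < p \<Longrightarrow> (\<Sum>i<n. clip l (y i - (\<Sum>k<p. x i k * bh k)) * x i j) = 0"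
proof -
  define r where "r i = y i - (\<Sum>k<p. x i k * bh k)" for i
  have le: "penalized_loss n p l x y mh bh \<le> penalized_loss n p l x y m b" for m b
    using min by (auto simp: is_arg_min_def not_less)
  have e: "r i - mh i = clip l (r i)" if i: "i < n" for i
  proof (rule soft_threshold_minimizer[OF l])
    fix z
    have loss: "penalized_loss n p l x y (mh(i := z)) bh =
        (r i - z)\<^sup>2 + 2 * l * \<bar>z\<bar> + (\<Sum>k\<in>{..<n} - {i}. (r k - mh k)\<^sup>2 + 2 * l * \<bar>mh k\<bar>)" for z
    proof -
      have "penalized_loss n p l x y (mh(i := z)) bh =
          (\<Sum>k<n. (r k - (mh(i := z)) k)\<^sup>2 + 2 * l * \<bar>(mh(i := z)) k\<bar>)"
        by (simp add: penalized_loss_def r_def sum.distrib sum_distrib_left algebra_simps)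
      also have "\<dots> = (r i - z)\<^sup>2 + 2 * l * \<bar>z\<bar> +
          (\<Sum>k\<in>{..<n} - {i}. (r k - (mh(i := z)) k)\<^sup>2 + 2 * l * \<bar>(mh(i := z)) k\<bar>)"
        using i by (subst sum.remove[of _ i]) auto
      also have "(\<Sum>k\<in>{..<n} - {i}. (r k - (mh(i := z)) k)\<^sup>2 + 2 * l * \<bar>(mh(i := z)) k\<bar>) =
          (\<Sum>k\<in>{..<n} - {i}. (r k - mh k)\<^sup>2 + 2 * l * \<bar>mh k\<bar>)"
        by (intro sum.cong) auto
      finally show ?thesis .
    qed
    have "penalized_loss n p l x y (mh(i := mh i)) bh \<le> penalized_loss n p l x y (mh(i := z)) bh"
      using le[of "mh(i := z)" bh] by simp
    then show "(r i - mh i)\<^sup>2 + 2 * l * \<bar>mh i\<bar> \<le> (r i - z)\<^sup>2 + 2 * l * \<bar>z\<bar>"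
      unfolding loss by simp
  qed
  fix j assume j: "j < p"
  have "(\<Sum>i<n. (r i - mh i) * x i j) = 0"
  proof (rule quadratic_nonneg_imp_linear_zero)
    fix s
    have row: "(\<Sum>k<p. x i k * (bh(j := bh j - s)) k) = (\<Sum>k<p. x i k * bh k) - s * x i j" for i
    proof -
      have "x i k * (bh(j := bh j - s)) k = x i k * bh k - (if k = j then s * x i j else 0)" for k
        by (simp add: algebra_simps)
      then show ?thesis using j by (simp add: sum_subtractf)
    qed
    have "penalized_loss n p l x y mh bh \<le> penalized_loss n p l x y mh (bh(j := bh j - s))"
      by (rule le)
    then have "(\<Sum>i<n. (r i - mh i)\<^sup>2) \<le> (\<Sum>i<n. (r i - mh i + s * x i j)\<^sup>2)"
      unfolding penalized_loss_def row by (simp add: r_def algebra_simps)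
    also have "(\<Sum>i<n. (r i - mh i + s * x i j)\<^sup>2) =
        (\<Sum>i<n. (r i - mh i)\<^sup>2) + 2 * s * (\<Sum>i<n. (r i - mh i) * x i j) + s\<^sup>2 * (\<Sum>i<n. (x i j)\<^sup>2)"
      by (simp add: power2_sum power_mult_distrib sum.distrib sum_distrib_left ac_simps)
    finally show "0 \<le> 2 * s * (\<Sum>i<n. (r i - mh i) * x i j) + s\<^sup>2 * (\<Sum>i<n. (x i j)\<^sup>2)" by simp
  qed
  moreover have "(\<Sum>i<n. (r i - mh i) * x i j) = (\<Sum>i<n. clip l (r i) * x i j)"
    by (intro sum.cong) (auto simp: e)
  ultimately show "(\<Sum>i<n. clip l (y i - (\<Sum>k<p. x i k * bh k)) * x i j) = 0"
    by (simp add: r_def)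
qed

text \<open>Inside the ball of radius \<open>R = (1 - 2 / \<alpha>) l / \<kappa>\<close> the residuals of the first \<open>s\<close> observations
  are clipped and the others are not, so that the estimating equation is linear there. By
  monotonicity of \<open>clip\<close> a solution outside the ball would produce a nonnegative radial component
  on its boundary.\<close>

lemma clipped_regression_linear:
  fixes x :: "nat \<Rightarrow> nat \<Rightarrow> real" and \<mu> e \<delta> W :: "nat \<Rightarrow> real" and l \<gamma> \<kappa> \<alpha> a :: real
  assumes pos: "0 < l" "0 < \<kappa>" "2 < \<alpha>" and \<gamma>: "0 < \<gamma>" "\<alpha> * \<gamma> \<le> l" and s: "s \<le> n"
    and eq: "\<And>j. j < p \<Longrightarrow> (\<Sum>i<n. clip l (\<mu> i + e i - (\<Sum>k<p. x i k * \<delta> k)) * x i j) = 0"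
    and e: "\<And>i. i < n \<Longrightarrow> \<bar>e i\<bar> \<le> \<gamma>" and x: "\<And>i. i < n \<Longrightarrow> L2_set (x i) {..<p} \<le> \<kappa>"
    and large: "\<And>i. i < s \<Longrightarrow> 3 * l \<le> \<bar>\<mu> i\<bar>" and small: "\<And>i. s \<le> i \<Longrightarrow> i < n \<Longrightarrow> \<bar>\<mu> i\<bar> \<le> \<gamma>"
    and a: "0 < a" "\<And>v. a * (\<Sum>j<p. (v j)\<^sup>2) \<le> (\<Sum>i\<in>{s..<n}. (\<Sum>j<p. x i j * v j)\<^sup>2)"
    and W: "\<And>j. W j = (\<Sum>i<s. l * sgn (\<mu> i) * x i j) + (\<Sum>i\<in>{s..<n}. (\<mu> i + e i) * x i j)"
    and R: "L2_set W {..<p} < a * ((1 - 2 / \<alpha>) * l / \<kappa>)"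
  shows "\<And>j. j < p \<Longrightarrow> (\<Sum>i\<in>{s..<n}. x i j * (\<Sum>k<p. x i k * \<delta> k)) = W j"
    and "a * L2_set \<delta> {..<p} \<le> L2_set W {..<p}"
proof -
  define R where "R = (1 - 2 / \<alpha>) * l / \<kappa>"
  define dot where "dot v i = (\<Sum>k<p. x i k * v k)" for v i
  define N where "N v = L2_set v {..<p}" for v :: "nat \<Rightarrow> real"
  have Rpos: "0 < R" using pos by (simp add: R_def)
  note split = sum_lessThan_split[OF s, where 'b=real]
  have dot_sum: "(\<Sum>j<p. u j * (\<Sum>i\<in>I. c i * x i j)) = (\<Sum>i\<in>I. c i * dot u i)" for u c and I :: "nat set"
    unfolding dot_def sum_distrib_left by (subst sum.swap) (simp add: ac_simps)
  have linear: "(\<Sum>i<n. clip l (\<mu> i + e i - dot v i) * x i j) = W j - (\<Sum>i\<in>{s..<n}. x i j * dot v i)"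
    if v: "N v \<le> R" for v j
  proof -
    have dot_le: "\<bar>dot v i\<bar> \<le> (1 - 2 / \<alpha>) * l" if "i < n" for i
    proof -
      have "\<bar>dot v i\<bar> \<le> L2_set (x i) {..<p} * N v"
        unfolding dot_def N_def by (rule L2_Cauchy_Schwarz)
      also have "\<dots> \<le> \<kappa> * R"
        using x[OF that] v pos by (intro mult_mono) (auto simp: N_def L2_set_nonneg)
      finally show ?thesis using pos by (simp add: R_def)
    qed
    have "\<gamma> \<le> l / \<alpha>" using \<gamma> pos by (simp add: field_simps)
    moreover have "l / \<alpha> \<le> l / 2" using pos by (intro divide_left_mono) auto
    moreover have "(1 - 2 / \<alpha>) * l = l - 2 * (l / \<alpha>)" by (simp add: algebra_simps)
    ultimately have \<gamma>l: "2 * \<gamma> + (1 - 2 / \<alpha>) * l \<le> l" "2 * \<gamma> \<le> l" "(1 - 2 / \<alpha>) * l \<le> l"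
      using \<gamma> by linarith+
    have big: "clip l (\<mu> i + e i - dot v i) = l * sgn (\<mu> i)" if "i < s" for i
      using large[OF that] e[of i] dot_le[of i] that s \<gamma>l pos
      by (cases "0 \<le> \<mu> i") (auto simp: clip_def sgn_if abs_if split: if_splits)
    have sml: "clip l (\<mu> i + e i - dot v i) = \<mu> i + e i - dot v i" if "s \<le> i" "i < n" for i
      using small[OF that] e[of i] dot_le[of i] that \<gamma>l pos
      by (auto simp: clip_def abs_if split: if_splits)
    have "(\<Sum>i<n. clip l (\<mu> i + e i - dot v i) * x i j) =
        (\<Sum>i<s. l * sgn (\<mu> i) * x i j) + (\<Sum>i\<in>{s..<n}. (\<mu> i + e i - dot v i) * x i j)"
      unfolding split by (intro arg_cong2[where f="(+)"] sum.cong) (auto simp: big sml)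
    also have "(\<Sum>i\<in>{s..<n}. (\<mu> i + e i - dot v i) * x i j) =
        (\<Sum>i\<in>{s..<n}. (\<mu> i + e i) * x i j) - (\<Sum>i\<in>{s..<n}. x i j * dot v i)"
      unfolding sum_subtractf[symmetric] by (intro sum.cong refl) (simp add: algebra_simps)
    finally show ?thesis by (simp add: W)
  qed
  have quad: "(\<Sum>j<p. v j * (\<Sum>i\<in>{s..<n}. x i j * dot v i)) = (\<Sum>i\<in>{s..<n}. (dot v i)\<^sup>2)" for v
    using dot_sum[of v "dot v" "{s..<n}"] by (simp add: power2_eq_square mult.commute)
  have quad_ge: "a * (N v)\<^sup>2 \<le> (\<Sum>i\<in>{s..<n}. (dot v i)\<^sup>2)" for v
    unfolding N_def L2_set_power2 dot_def by (rule a)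
  have W_le: "(\<Sum>j<p. v j * W j) \<le> N v * N W" for v
    using L2_Cauchy_Schwarz[of v W "{..<p}"] unfolding N_def by linarith
  have small: "N \<delta> \<le> R"
  proof (rule ccontr)
    assume "\<not> N \<delta> \<le> R"
    define t where "t = R / N \<delta>"
    have t: "0 < t" "t < 1" "t * N \<delta> = R"
      using \<open>\<not> N \<delta> \<le> R\<close> Rpos by (auto simp: t_def)
    define v where "v j = t * \<delta> j" for j
    have Nv: "N v = R"
      using t unfolding v_def N_def by (simp add: L2_set_right_distrib[symmetric])
    have dv: "dot v i = t * dot \<delta> i" for i
      by (simp add: dot_def v_def sum_distrib_left ac_simps)
    have "(\<Sum>i<n. clip l (\<mu> i + e i - dot \<delta> i) * dot \<delta> i) =
        (\<Sum>j<p. \<delta> j * (\<Sum>i<n. clip l (\<mu> i + e i - dot \<delta> i) * x i j))"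
      by (rule dot_sum[symmetric])
    also have "\<dots> = 0" using eq by (simp add: dot_def)
    finally have z: "(\<Sum>i<n. clip l (\<mu> i + e i - dot \<delta> i) * dot \<delta> i) = 0" .
    have "(\<Sum>i<n. clip l (\<mu> i + e i - dot \<delta> i) * dot \<delta> i) \<le> (\<Sum>i<n. clip l (\<mu> i + e i - dot v i) * dot \<delta> i)"
    proof (rule sum_mono)
      fix i
      show "clip l (\<mu> i + e i - dot \<delta> i) * dot \<delta> i \<le> clip l (\<mu> i + e i - dot v i) * dot \<delta> i"
      proof (cases "0 \<le> dot \<delta> i")
        case True
        then have "dot v i \<le> dot \<delta> i" using t by (simp add: dv mult_left_le_one_le)
        then show ?thesis using True by (intro mult_right_mono clip_mono) auto
      next
        case False
        then have "dot \<delta> i \<le> dot v i" using t by (simp add: dv)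
        then show ?thesis using False by (intro mult_right_mono_neg clip_mono) auto
      qed
    qed
    then have "0 \<le> t * (\<Sum>i<n. clip l (\<mu> i + e i - dot v i) * dot \<delta> i)"
      using z t by simp
    also have "\<dots> = (\<Sum>i<n. clip l (\<mu> i + e i - dot v i) * dot v i)"
      by (simp add: dv sum_distrib_left ac_simps)
    also have "\<dots> = (\<Sum>j<p. v j * (\<Sum>i<n. clip l (\<mu> i + e i - dot v i) * x i j))"
      by (rule dot_sum[symmetric])
    also have "\<dots> = (\<Sum>j<p. v j * W j) - (\<Sum>i\<in>{s..<n}. (dot v i)\<^sup>2)"
      unfolding quad[symmetric] using linear[of v] Nv by (simp add: right_diff_distrib sum_subtractf)
    also have "\<dots> \<le> R * N W - a * R\<^sup>2"
      using W_le[of v] quad_ge[of v] by (simp add: Nv)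
    also have "\<dots> = R * (N W - a * R)" by (simp add: power2_eq_square algebra_simps)
    also have "\<dots> < 0"
      using R Rpos unfolding R_def[symmetric] N_def by (intro mult_pos_neg) auto
    finally show False by simp
  qed
  show lin: "(\<Sum>i\<in>{s..<n}. x i j * (\<Sum>k<p. x i k * \<delta> k)) = W j" if "j < p" for j
    using linear[OF small, of j] eq[OF that] by (simp add: dot_def)
  have "a * (N \<delta>)\<^sup>2 \<le> (\<Sum>j<p. \<delta> j * (\<Sum>i\<in>{s..<n}. x i j * dot \<delta> i))"
    unfolding quad by (rule quad_ge)
  also have "\<dots> = (\<Sum>j<p. \<delta> j * W j)"
    using lin by (simp add: dot_def)
  also have "\<dots> \<le> N \<delta> * N W" by (rule W_le)
  finally have "N \<delta> * (a * N \<delta>) \<le> N \<delta> * N W" by (simp add: power2_eq_square ac_simps)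
  then show "a * L2_set \<delta> {..<p} \<le> L2_set W {..<p}"
    using L2_set_nonneg[of \<delta> "{..<p}"] L2_set_nonneg[of W "{..<p}"] mult_le_cancel_left_pos[of "N \<delta>"]
    by (cases "N \<delta> = 0") (auto simp: N_def less_le)
qed

lemma clipped_regression_error:
  fixes x :: "nat \<Rightarrow> nat \<Rightarrow> real" and \<mu> e \<delta> w a :: "nat \<Rightarrow> real" and l \<gamma> \<kappa> \<alpha> c F b u :: real and S :: "nat \<Rightarrow> nat \<Rightarrow> real" and s1 s2 n :: nat
  assumes pos: "0 < l" "0 < \<kappa>" "2 < \<alpha>" and \<gamma>: "0 < \<gamma>" "\<alpha> * \<gamma> \<le> l" and s: "s1 + s2 \<le> n" and n: "0 < n"
    and eq: "\<And>j. j < p \<Longrightarrow> (\<Sum>i<n. clip l (\<mu> i + e i - (\<Sum>k<p. x i k * \<delta> k)) * x i j) = 0"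
    and e: "\<And>i. i < n \<Longrightarrow> \<bar>e i\<bar> \<le> \<gamma>" and x: "\<And>i. i < n \<Longrightarrow> L2_set (x i) {..<p} \<le> \<kappa>"
    and large: "\<And>i. i < s1 \<Longrightarrow> 3 * l \<le> \<bar>\<mu> i\<bar>"
    and moderate: "\<And>i. s1 \<le> i \<Longrightarrow> i < s1 + s2 \<Longrightarrow> \<bar>\<mu> i\<bar> \<le> \<gamma>"
    and zero: "\<And>i. s1 + s2 \<le> i \<Longrightarrow> i < n \<Longrightarrow> \<mu> i = 0"
    and c: "0 < c" "\<And>v. c * (\<Sum>j<p. (v j)\<^sup>2) \<le> bilinear_form {..<p} S v v"
    and F: "frobenius_norm {..<p} {..<p} (\<lambda>j k. (\<Sum>i<n. x i j * x i k) / n - S j k) \<le> F"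
      "n * F + s1 * \<kappa>\<^sup>2 \<le> n * c / 2"
    and w: "\<And>k. k < p \<Longrightarrow> (\<Sum>j<p. w j * S j k) = a k"
    and b: "b = \<kappa> * (2 * s1 * l + s2 * \<gamma>)"
    and u: "L2_set (\<lambda>j. \<Sum>i<n. e i * x i j) {..<p} \<le> u"
    and R: "u + b < n * c / 2 * ((1 - 2 / \<alpha>) * l / \<kappa>)"
  shows "\<bar>n * (\<Sum>j<p. a j * \<delta> j) - (\<Sum>i<n. e i * (\<Sum>j<p. w j * x i j))\<bar> \<le>
    L2_set w {..<p} * (b + (n * F + s1 * \<kappa>\<^sup>2) * (2 / (n * c)) * (u + b))"
proof -
  define N where "N v = L2_set v {..<p}" for v :: "nat \<Rightarrow> real"
  define dot where "dot v i = (\<Sum>k<p. x i k * v k)" for v i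
  define D where "D j k = (\<Sum>i<n. x i j * x i k) / n - S j k" for j k
  define W where "W j = (\<Sum>i<s1. l * sgn (\<mu> i) * x i j) + (\<Sum>i\<in>{s1..<n}. (\<mu> i + e i) * x i j)" for j
  define B where "B i = (if i < s1 then l * sgn (\<mu> i) - e i else \<mu> i)" for i
  have N0: "0 \<le> N v" for v by (simp add: N_def L2_set_nonneg)
  have s1n: "s1 \<le> n" using s by simp
  note split = sum_lessThan_split[OF s1n, where 'b=real]
  have dot_le: "\<bar>dot v i\<bar> \<le> \<kappa> * N v" if "i < n" for v i
    using L2_Cauchy_Schwarz[of "x i" v "{..<p}"] mult_right_mono[OF x[OF that] N0[of v]]
    unfolding dot_def N_def by linarith
  have dot_sum: "(\<Sum>j<p. v j * (\<Sum>i\<in>I. f i * x i j)) = (\<Sum>i\<in>I. f i * dot v i)" for v f and I :: "nat set"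
    unfolding dot_def sum_distrib_left by (subst sum.swap) (simp add: ac_simps)
  have gram: "(\<Sum>i<n. dot v i * dot v' i) = n * bilinear_form {..<p} S v v' + n * bilinear_form {..<p} D v v'"
    for v v'
  proof -
    have "(\<Sum>i<n. dot v i * dot v' i) = (\<Sum>i<n. \<Sum>j<p. \<Sum>k<p. v j * (x i j * x i k) * v' k)"
      unfolding dot_def sum_product by (intro sum.cong refl) (simp add: ac_simps)
    also have "\<dots> = (\<Sum>j<p. \<Sum>i<n. \<Sum>k<p. v j * (x i j * x i k) * v' k)"
      by (rule sum.swap)
    also have "\<dots> = (\<Sum>j<p. \<Sum>k<p. \<Sum>i<n. v j * (x i j * x i k) * v' k)"
      by (intro sum.cong refl sum.swap)
    also have "\<dots> = (\<Sum>j<p. \<Sum>k<p. n * (v j * S j k * v' k) + n * (v j * D j k * v' k))"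
    proof (intro sum.cong refl)
      fix j k
      have "(\<Sum>i<n. v j * (x i j * x i k) * v' k) = v j * (\<Sum>i<n. x i j * x i k) * v' k"
        by (simp only: sum_distrib_left sum_distrib_right)
      moreover have "(\<Sum>i<n. x i j * x i k) = n * S j k + n * D j k"
        using n by (simp add: D_def field_simps)
      ultimately show "(\<Sum>i<n. v j * (x i j * x i k) * v' k) = n * (v j * S j k * v' k) + n * (v j * D j k * v' k)"
        by (simp add: algebra_simps)
    qed
    finally show ?thesis by (simp add: sum.distrib sum_distrib_left)
  qed
  have D_le: "\<bar>\<Sum>j<p. \<Sum>k<p. v j * D j k * v' k\<bar> \<le> F * (N v * N v')" for v v'
  proof -
    have "frobenius_norm {..<p} {..<p} D * (N v * N v') \<le> F * (N v * N v')"
      using F(1) N0 by (intro mult_right_mono) (auto simp: D_def[abs_def])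
    then show ?thesis
      using frobenius_bilinear_bound[of v D v' "{..<p}" "{..<p}"] by (simp add: N_def mult.assoc)
  qed
  have head_le: "\<bar>\<Sum>i<s1. dot v i * dot v' i\<bar> \<le> s1 * \<kappa>\<^sup>2 * (N v * N v')" for v v'
  proof -
    have "\<bar>\<Sum>i<s1. dot v i * dot v' i\<bar> \<le> (\<Sum>i<s1. (\<kappa> * N v) * (\<kappa> * N v'))"
      using dot_le s N0 pos
      by (intro order_trans[OF sum_abs] sum_mono) (auto simp: abs_mult intro!: mult_mono)
    then show ?thesis by (simp add: power2_eq_square ac_simps)
  qed
  have lower: "n * c / 2 * (\<Sum>j<p. (v j)\<^sup>2) \<le> (\<Sum>i\<in>{s1..<n}. (\<Sum>j<p. x i j * v j)\<^sup>2)" for v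
  proof -
    have "(\<Sum>i\<in>{s1..<n}. (dot v i)\<^sup>2) = (\<Sum>i<n. dot v i * dot v i) - (\<Sum>i<s1. dot v i * dot v i)"
      unfolding split by (simp add: power2_eq_square)
    moreover have "n * (c * (N v)\<^sup>2) \<le> n * bilinear_form {..<p} S v v"
      unfolding N_def L2_set_power2 by (intro mult_left_mono c) auto
    moreover have "- (n * (F * (N v)\<^sup>2)) \<le> n * bilinear_form {..<p} D v v"
    proof -
      have "- (F * (N v)\<^sup>2) \<le> bilinear_form {..<p} D v v"
        using D_le[of v v] by (simp add: power2_eq_square)
      then have "n * - (F * (N v)\<^sup>2) \<le> n * bilinear_form {..<p} D v v"
        by (rule mult_left_mono) simp
      then show ?thesis by simp
    qed
    moreover have "(\<Sum>i<s1. dot v i * dot v i) \<le> s1 * \<kappa>\<^sup>2 * (N v)\<^sup>2"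
      using head_le[of v v] by (simp add: power2_eq_square)
    moreover have "(n * F + s1 * \<kappa>\<^sup>2) * (N v)\<^sup>2 \<le> n * c / 2 * (N v)\<^sup>2"
      by (rule mult_right_mono[OF F(2)]) simp
    ultimately have "n * c / 2 * (N v)\<^sup>2 \<le> (\<Sum>i\<in>{s1..<n}. (dot v i)\<^sup>2)"
      unfolding gram by (simp add: algebra_simps)
    then show ?thesis by (simp add: N_def L2_set_power2 dot_def)
  qed
  have W_eq: "W j = (\<Sum>i<n. e i * x i j) + (\<Sum>i<s1 + s2. B i * x i j)" for j
  proof -
    have "(\<Sum>i<s1 + s2. B i * x i j) = (\<Sum>i<n. B i * x i j)"
      using s zero by (intro sum.mono_neutral_left) (auto simp: B_def not_less)
    moreover have "(\<Sum>i<s1. (e i + B i) * x i j) = (\<Sum>i<s1. l * sgn (\<mu> i) * x i j)"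
      by (intro sum.cong) (auto simp: B_def)
    moreover have "(\<Sum>i\<in>{s1..<n}. (e i + B i) * x i j) = (\<Sum>i\<in>{s1..<n}. (\<mu> i + e i) * x i j)"
      by (intro sum.cong) (auto simp: B_def)
    ultimately show ?thesis
      unfolding W_def using split[of "\<lambda>i. (e i + B i) * x i j"]
      by (simp add: distrib_right sum.distrib)
  qed
  have \<gamma>l: "\<gamma> \<le> l"
  proof -
    have "1 * \<gamma> \<le> \<alpha> * \<gamma>" using pos \<gamma> by (intro mult_right_mono) auto
    then show ?thesis using \<gamma> by linarith
  qed
  have bias: "\<bar>\<Sum>i<s1 + s2. B i * dot v i\<bar> \<le> b * N v" for v
  proof -
    have B: "\<bar>B i\<bar> \<le> (if i < s1 then 2 * l else \<gamma>)" if "i < s1 + s2" for i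
    proof (cases "i < s1")
      case True
      have "\<bar>l * sgn (\<mu> i)\<bar> \<le> l" using pos by (simp add: abs_mult sgn_if)
      then show ?thesis using True e[of i] s \<gamma>l by (simp add: B_def)
    qed (use moderate[of i] that in \<open>simp add: B_def\<close>)
    have "\<bar>\<Sum>i<s1 + s2. B i * dot v i\<bar> \<le> (\<Sum>i<s1 + s2. (if i < s1 then 2 * l else \<gamma>) * (\<kappa> * N v))"
    proof (intro order_trans[OF sum_abs] sum_mono)
      fix i assume "i \<in> {..<s1 + s2}"
      then have i: "i < s1 + s2" "i < n" using s by auto
      show "\<bar>B i * dot v i\<bar> \<le> (if i < s1 then 2 * l else \<gamma>) * (\<kappa> * N v)"
        unfolding abs_mult using pos \<gamma>
        by (intro mult_mono B[OF i(1)] dot_le[OF i(2)]) auto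
    qed
    also have "\<dots> = (\<Sum>i<s1 + s2. if i < s1 then 2 * l else \<gamma>) * (\<kappa> * N v)"
      by (simp add: sum_distrib_right)
    also have "(\<Sum>i<s1 + s2. if i < s1 then 2 * l else \<gamma>) = (\<Sum>i<s1. 2 * l) + (\<Sum>i\<in>{s1..<s1 + s2}. \<gamma>)"
      using sum_lessThan_split[of s1 "s1 + s2" "\<lambda>i. if i < s1 then 2 * l else \<gamma>"] by simp
    finally show ?thesis by (simp add: b algebra_simps)
  qed
  have W_dot: "(\<Sum>j<p. v j * W j) = (\<Sum>i<n. e i * dot v i) + (\<Sum>i<s1 + s2. B i * dot v i)" for v
    unfolding W_eq distrib_left sum.distrib dot_sum ..
  have b0: "0 \<le> b" using pos \<gamma> by (simp add: b)
  have u0: "0 \<le> u" using u L2_set_nonneg order_trans by blast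
  have NW: "N W \<le> u + b"
  proof -
    have "(N W)\<^sup>2 = (\<Sum>j<p. W j * W j)"
      by (simp add: N_def L2_set_power2 power2_eq_square[of "W _"])
    also have "\<dots> = (\<Sum>j<p. W j * (\<Sum>i<n. e i * x i j)) + (\<Sum>i<s1 + s2. B i * dot W i)"
      by (simp add: W_dot dot_sum)
    also have "\<dots> \<le> N W * u + b * N W"
    proof (rule add_mono)
      have "(\<Sum>j<p. W j * (\<Sum>i<n. e i * x i j)) \<le> N W * L2_set (\<lambda>j. \<Sum>i<n. e i * x i j) {..<p}"
        using L2_Cauchy_Schwarz[of W "\<lambda>j. \<Sum>i<n. e i * x i j" "{..<p}"] unfolding N_def by linarith
      also have "\<dots> \<le> N W * u" by (rule mult_left_mono[OF u N0])
      finally show "(\<Sum>j<p. W j * (\<Sum>i<n. e i * x i j)) \<le> N W * u" .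
      show "(\<Sum>i<s1 + s2. B i * dot W i) \<le> b * N W" using bias[of W] by linarith
    qed
    finally have "N W * N W \<le> N W * (u + b)" by (simp add: power2_eq_square algebra_simps)
    then show ?thesis using N0[of W] u0 b0 by (cases "N W = 0") auto
  qed
  have small: "\<bar>\<mu> i\<bar> \<le> \<gamma>" if "s1 \<le> i" "i < n" for i
    using moderate[of i] zero[of i] that \<gamma> by (cases "i < s1 + s2") auto
  have NWR: "L2_set W {..<p} < n * c / 2 * ((1 - 2 / \<alpha>) * l / \<kappa>)"
    using NW R unfolding N_def by linarith
  have nc: "0 < n * c / 2" using n c by simp
  note lin = clipped_regression_linear[OF pos \<gamma> s1n eq e x large small nc lower W_def NWR]
  have N\<delta>: "N \<delta> \<le> 2 / (n * c) * (u + b)"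
  proof -
    have "n * c / 2 * N \<delta> \<le> u + b" using lin(2) NW unfolding N_def by linarith
    then show ?thesis using nc n c by (simp add: field_simps)
  qed
  have "(\<Sum>j<p. w j * W j) = (\<Sum>j<p. w j * (\<Sum>i\<in>{s1..<n}. dot \<delta> i * x i j))"
    using lin(1) by (simp add: dot_def mult.commute)
  also have "\<dots> = (\<Sum>i\<in>{s1..<n}. dot \<delta> i * dot w i)" by (rule dot_sum)
  also have "\<dots> = (\<Sum>i<n. dot w i * dot \<delta> i) - (\<Sum>i<s1. dot w i * dot \<delta> i)"
    unfolding split by (simp add: mult.commute)
  finally have wW: "(\<Sum>j<p. w j * W j) = n * bilinear_form {..<p} S w \<delta> +
      n * bilinear_form {..<p} D w \<delta> - (\<Sum>i<s1. dot w i * dot \<delta> i)"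
    unfolding gram .
  have "bilinear_form {..<p} S w \<delta> = (\<Sum>k<p. (\<Sum>j<p. w j * S j k) * \<delta> k)"
    unfolding sum_distrib_right by (rule sum.swap)
  then have wS: "bilinear_form {..<p} S w \<delta> = (\<Sum>k<p. a k * \<delta> k)"
    using w by simp
  have nD: "\<bar>n * bilinear_form {..<p} D w \<delta>\<bar> \<le> n * F * (N w * N \<delta>)"
  proof -
    have "n * \<bar>\<Sum>j<p. \<Sum>k<p. w j * D j k * \<delta> k\<bar> \<le> n * (F * (N w * N \<delta>))"
      by (rule mult_left_mono[OF D_le]) simp
    then show ?thesis by (simp add: abs_mult)
  qed
  have "\<bar>n * (\<Sum>j<p. a j * \<delta> j) - (\<Sum>i<n. e i * dot w i)\<bar> \<le>
      b * N w + n * F * (N w * N \<delta>) + s1 * \<kappa>\<^sup>2 * (N w * N \<delta>)"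
    using wW[unfolded wS W_dot] bias[of w] nD head_le[of w \<delta>] by linarith
  also have "\<dots> = N w * (b + (n * F + s1 * \<kappa>\<^sup>2) * N \<delta>)"
    by (simp add: algebra_simps)
  also have "\<dots> \<le> N w * (b + (n * F + s1 * \<kappa>\<^sup>2) * (2 / (n * c) * (u + b)))"
  proof -
    have "0 \<le> frobenius_norm {..<p} {..<p} (\<lambda>j k. (\<Sum>i<n. x i j * x i k) / n - S j k)"
      by (simp add: frobenius_norm_def sum_nonneg)
    then have "0 \<le> F" using F(1) by linarith
    then show ?thesis using N\<delta> N0 by (intro mult_left_mono add_left_mono) auto
  qed
  also have "(\<Sum>i<n. e i * dot w i) = (\<Sum>i<n. e i * (\<Sum>j<p. w j * x i j))"
    by (simp only: dot_def mult.commute)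
  finally show ?thesis by (simp only: N_def mult.assoc)
qed

section \<open>Independence and moments\<close>

lemma (in prob_space) indep_vars_Pair:
  assumes I: "finite I" and X: "indep_vars (\<lambda>_. S) X I" and Y: "indep_vars (\<lambda>_. T) Y I"
    and ind: "independent_elements M (PiM I (\<lambda>_. S)) (\<lambda>\<omega>. \<lambda>i\<in>I. X i \<omega>) (PiM I (\<lambda>_. T)) (\<lambda>\<omega>. \<lambda>i\<in>I. Y i \<omega>)"
  shows "indep_vars (\<lambda>_. S \<Otimes>\<^sub>M T) (\<lambda>i \<omega>. (X i \<omega>, Y i \<omega>)) I"
    and "\<And>i. i \<in> I \<Longrightarrow> distr M (S \<Otimes>\<^sub>M T) (\<lambda>\<omega>. (X i \<omega>, Y i \<omega>)) = distr M S (X i) \<Otimes>\<^sub>M distr M T (Y i)"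
proof -
  have Xm: "X i \<in> measurable M S" and Ym: "Y i \<in> measurable M T" if "i \<in> I" for i
    using X Y that by (auto simp: indep_vars_def2)
  have prod: "prob ((\<lambda>\<omega>. \<lambda>i\<in>I. X i \<omega>) -` C \<inter> space M \<inter> ((\<lambda>\<omega>. \<lambda>i\<in>I. Y i \<omega>) -` D \<inter> space M)) =
      prob ((\<lambda>\<omega>. \<lambda>i\<in>I. X i \<omega>) -` C \<inter> space M) * prob ((\<lambda>\<omega>. \<lambda>i\<in>I. Y i \<omega>) -` D \<inter> space M)"
    if "C \<in> sets (PiM I (\<lambda>_. S))" "D \<in> sets (PiM I (\<lambda>_. T))" for C D
    using ind that unfolding independent_elements_def by (intro indep_setD) auto
  have single: "prob ((\<lambda>\<omega>. (X i \<omega>, Y i \<omega>)) -` (A \<times> B) \<inter> space M) =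
      prob (X i -` A \<inter> space M) * prob (Y i -` B \<inter> space M)"
    if i: "i \<in> I" and A: "A \<in> sets S" and B: "B \<in> sets T" for i A B
  proof -
    define C where "C = (\<lambda>f. f i) -` A \<inter> space (PiM I (\<lambda>_. S))"
    define D where "D = (\<lambda>f. f i) -` B \<inter> space (PiM I (\<lambda>_. T))"
    have CD: "C \<in> sets (PiM I (\<lambda>_. S))" "D \<in> sets (PiM I (\<lambda>_. T))"
      unfolding C_def D_def using A B i by (auto intro!: measurable_sets[OF measurable_component_singleton])
    have C: "(\<lambda>\<omega>. \<lambda>i\<in>I. X i \<omega>) -` C \<inter> space M = X i -` A \<inter> space M"
      using i measurable_space[OF Xm] by (auto simp: C_def space_PiM)
    have D: "(\<lambda>\<omega>. \<lambda>i\<in>I. Y i \<omega>) -` D \<inter> space M = Y i -` B \<inter> space M"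
      using i measurable_space[OF Ym] by (auto simp: D_def space_PiM)
    have "(\<lambda>\<omega>. (X i \<omega>, Y i \<omega>)) -` (A \<times> B) \<inter> space M = X i -` A \<inter> space M \<inter> (Y i -` B \<inter> space M)"
      by auto
    then show ?thesis using prod[OF CD] unfolding C D by simp
  qed
  show "distr M (S \<Otimes>\<^sub>M T) (\<lambda>\<omega>. (X i \<omega>, Y i \<omega>)) = distr M S (X i) \<Otimes>\<^sub>M distr M T (Y i)" if i: "i \<in> I" for i
  proof (rule sym, rule pair_measure_eqI)
    interpret SX: prob_space "distr M S (X i)" by (rule prob_space_distr[OF Xm[OF i]])
    interpret TY: prob_space "distr M T (Y i)" by (rule prob_space_distr[OF Ym[OF i]])
    show "sigma_finite_measure (distr M S (X i))" "sigma_finite_measure (distr M T (Y i))" by unfold_locales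
    show "sets (distr M S (X i) \<Otimes>\<^sub>M distr M T (Y i)) = sets (distr M (S \<Otimes>\<^sub>M T) (\<lambda>\<omega>. (X i \<omega>, Y i \<omega>)))"
      by (simp cong: sets_pair_measure_cong)
    fix A B assume A: "A \<in> sets (distr M S (X i))" and B: "B \<in> sets (distr M T (Y i))"
    show "emeasure (distr M S (X i)) A * emeasure (distr M T (Y i)) B =
        emeasure (distr M (S \<Otimes>\<^sub>M T) (\<lambda>\<omega>. (X i \<omega>, Y i \<omega>))) (A \<times> B)"
      using A B single[OF i, of A B] Xm[OF i] Ym[OF i]
      by (simp add: emeasure_distr emeasure_eq_measure ennreal_mult measurable_Pair)
  qed
  show "indep_vars (\<lambda>_. S \<Otimes>\<^sub>M T) (\<lambda>i \<omega>. (X i \<omega>, Y i \<omega>)) I"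
  proof (cases "I = {}")
    case True
    then show ?thesis by (simp add: indep_vars_def2 indep_sets_def)
  next
    case False
    define E where "E = {A \<times> B |A B. A \<in> sets S \<and> B \<in> sets T}"
    show ?thesis
    proof (subst indep_vars_finite[where E="\<lambda>_. E"])
      show "sets (S \<Otimes>\<^sub>M T) = sigma_sets (space (S \<Otimes>\<^sub>M T)) E"
        by (simp add: sets_pair_measure space_pair_measure E_def)
      show "Int_stable E" unfolding E_def by (rule Int_stable_pair_measure_generator)
      show "space (S \<Otimes>\<^sub>M T) \<in> E" by (auto simp: E_def space_pair_measure)
      show "E \<subseteq> Pow (space (S \<Otimes>\<^sub>M T))"
        unfolding E_def space_pair_measure by (rule pair_measure_closed)
      show "(\<lambda>\<omega>. (X i \<omega>, Y i \<omega>)) \<in> measurable M (S \<Otimes>\<^sub>M T)" if "i \<in> I" for i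
        using Xm[OF that] Ym[OF that] by (rule measurable_Pair)
      show "\<forall>G\<in>I \<rightarrow> E. prob (\<Inter>j\<in>I. (\<lambda>\<omega>. (X j \<omega>, Y j \<omega>)) -` G j \<inter> space M) =
          (\<Prod>j\<in>I. prob ((\<lambda>\<omega>. (X j \<omega>, Y j \<omega>)) -` G j \<inter> space M))"
      proof
        fix G assume "G \<in> I \<rightarrow> E"
        then have "\<forall>j\<in>I. \<exists>A B. G j = A \<times> B \<and> A \<in> sets S \<and> B \<in> sets T" by (auto simp: E_def Pi_iff)
        then obtain A B where AB: "\<And>j. j \<in> I \<Longrightarrow> G j = A j \<times> B j"
            "\<And>j. j \<in> I \<Longrightarrow> A j \<in> sets S" "\<And>j. j \<in> I \<Longrightarrow> B j \<in> sets T"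
          by metis
        define C where "C = Pi\<^sub>E I A"
        define D where "D = Pi\<^sub>E I B"
        have CD: "C \<in> sets (PiM I (\<lambda>_. S))" "D \<in> sets (PiM I (\<lambda>_. T))"
          unfolding C_def D_def using AB I by (auto intro!: sets_PiM_I_finite)
        have C: "(\<lambda>\<omega>. \<lambda>i\<in>I. X i \<omega>) -` C \<inter> space M = (\<Inter>i\<in>I. X i -` A i \<inter> space M)"
          using False by (auto simp: C_def PiE_iff)
        have D: "(\<lambda>\<omega>. \<lambda>i\<in>I. Y i \<omega>) -` D \<inter> space M = (\<Inter>i\<in>I. Y i -` B i \<inter> space M)"
          using False by (auto simp: D_def PiE_iff)
        have "(\<Inter>j\<in>I. (\<lambda>\<omega>. (X j \<omega>, Y j \<omega>)) -` G j \<inter> space M) =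
            (\<Inter>i\<in>I. X i -` A i \<inter> space M) \<inter> (\<Inter>i\<in>I. Y i -` B i \<inter> space M)"
          using AB(1) False by auto
        then have "prob (\<Inter>j\<in>I. (\<lambda>\<omega>. (X j \<omega>, Y j \<omega>)) -` G j \<inter> space M) =
            prob (\<Inter>i\<in>I. X i -` A i \<inter> space M) * prob (\<Inter>i\<in>I. Y i -` B i \<inter> space M)"
          using prod[OF CD] unfolding C D by simp
        also have "\<dots> = (\<Prod>j\<in>I. prob (X j -` A j \<inter> space M)) * (\<Prod>j\<in>I. prob (Y j -` B j \<inter> space M))"
          using indep_varsD_finite[OF X False I] indep_varsD_finite[OF Y False I] AB by simp
        also have "\<dots> = (\<Prod>j\<in>I. prob ((\<lambda>\<omega>. (X j \<omega>, Y j \<omega>)) -` G j \<inter> space M))"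
          unfolding prod.distrib[symmetric] by (rule prod.cong) (auto simp: single AB)
        finally show "prob (\<Inter>j\<in>I. (\<lambda>\<omega>. (X j \<omega>, Y j \<omega>)) -` G j \<inter> space M) =
          (\<Prod>j\<in>I. prob ((\<lambda>\<omega>. (X j \<omega>, Y j \<omega>)) -` G j \<inter> space M))" .
      qed
    qed (use False I in auto)
  qed
qed

lemma pair_measure_integral_mult:
  fixes f :: "'a \<Rightarrow> real" and g :: "'b \<Rightarrow> real"
  assumes P: "prob_space P" "prob_space Q" and f: "integrable P f" and g: "integrable Q g"
  shows "integrable (P \<Otimes>\<^sub>M Q) (\<lambda>z. f (fst z) * g (snd z))" (is ?A)
    and "(LINT z|(P \<Otimes>\<^sub>M Q). f (fst z) * g (snd z)) = (LINT x|P. f x) * (LINT y|Q. g y)" (is ?B)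
proof -
  interpret P1: prob_space P by fact
  interpret Q1: prob_space Q by fact
  interpret pair_prob_space P Q ..
  have [measurable]: "f \<in> borel_measurable P" "g \<in> borel_measurable Q" using f g by auto
  show int: ?A
  proof (rule Fubini_integrable)
    show "(\<lambda>z. f (fst z) * g (snd z)) \<in> borel_measurable (P \<Otimes>\<^sub>M Q)" by measurable
    show "integrable P (\<lambda>x. LINT y|Q. norm (f (fst (x, y)) * g (snd (x, y))))"
      using f by (simp add: abs_mult)
    show "AE x in P. integrable Q (\<lambda>y. f (fst (x, y)) * g (snd (x, y)))"
      using g by simp
  qed
  from integral_fst'[OF int]
  show ?B
    by simp
qed

lemma (in prob_space) iid_sum_second_moment:
  fixes h :: "'b \<Rightarrow> real"
  assumes I: "finite I" and V: "indep_vars (\<lambda>_. S) V I" and law: "\<And>i. i \<in> I \<Longrightarrow> distr M S (V i) = L"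
    and S: "sets L = sets S" and h: "h \<in> borel_measurable S"
    and sq: "integrable L (\<lambda>v. (h v)\<^sup>2)" and mean: "(LINT v|L. h v) = 0"
  shows "integrable M (\<lambda>\<omega>. (\<Sum>i\<in>I. h (V i \<omega>))\<^sup>2)" (is ?A)
    and "expectation (\<lambda>\<omega>. (\<Sum>i\<in>I. h (V i \<omega>))\<^sup>2) = card I * (LINT v|L. (h v)\<^sup>2)" (is ?B)
proof -
  define U where "U i \<omega> = h (V i \<omega>)" for i \<omega>
  have Vm: "V i \<in> measurable M S" if "i \<in> I" for i
    using V that by (auto simp: indep_vars_def2)
  have U: "indep_vars (\<lambda>_. borel) U I"
    unfolding U_def by (rule indep_vars_compose2[OF V]) (use h in auto)
  have Um: "U i \<in> borel_measurable M" if "i \<in> I" for i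
    using U that by (auto simp: indep_vars_def2)
  have sqU: "integrable M (\<lambda>\<omega>. (U i \<omega>)\<^sup>2)" "expectation (\<lambda>\<omega>. (U i \<omega>)\<^sup>2) = (LINT v|L. (h v)\<^sup>2)"
    and meanU: "expectation (U i) = 0" if i: "i \<in> I" for i
  proof -
    have hm: "(\<lambda>v. (h v)\<^sup>2) \<in> borel_measurable S" using h by measurable
    show "integrable M (\<lambda>\<omega>. (U i \<omega>)\<^sup>2)"
      using sq unfolding law[OF i, symmetric] integrable_distr_eq[OF Vm[OF i] hm] U_def .
    show "expectation (\<lambda>\<omega>. (U i \<omega>)\<^sup>2) = (LINT v|L. (h v)\<^sup>2)"
      unfolding law[OF i, symmetric] integral_distr[OF Vm[OF i] hm] U_def ..
    show "expectation (U i) = 0"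
      using mean unfolding law[OF i, symmetric] integral_distr[OF Vm[OF i] h] U_def by simp
  qed
  have intU: "integrable M (U i)" if "i \<in> I" for i
    by (rule square_integrable_imp_integrable[OF Um[OF that] sqU(1)[OF that]])
  have cross: "integrable M (\<lambda>\<omega>. U i \<omega> * U j \<omega>)"
      "expectation (\<lambda>\<omega>. U i \<omega> * U j \<omega>) = (if i = j then LINT v|L. (h v)\<^sup>2 else 0)"
    if ij: "i \<in> I" "j \<in> I" for i j
  proof -
    have "integrable M (\<lambda>\<omega>. U i \<omega> * U j \<omega>) \<and>
        expectation (\<lambda>\<omega>. U i \<omega> * U j \<omega>) = (if i = j then LINT v|L. (h v)\<^sup>2 else 0)"
    proof (cases "i = j")
      case True
      then show ?thesis using sqU[OF ij(1)] by (simp add: power2_eq_square)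
    next
      case False
      have sub: "indep_vars (\<lambda>_. borel) U {i, j}"
        by (rule indep_vars_subset[OF U]) (use ij in auto)
      have "integrable M (\<lambda>\<omega>. \<Prod>k\<in>{i, j}. U k \<omega>)"
        by (rule indep_vars_integrable[OF _ sub]) (use ij intU in auto)
      moreover have "expectation (\<lambda>\<omega>. \<Prod>k\<in>{i, j}. U k \<omega>) = (\<Prod>k\<in>{i, j}. expectation (U k))"
        by (rule indep_vars_lebesgue_integral[OF _ sub]) (use ij intU in auto)
      ultimately show ?thesis using False meanU[OF ij(1)] by simp
    qed
    then show "integrable M (\<lambda>\<omega>. U i \<omega> * U j \<omega>)"
      "expectation (\<lambda>\<omega>. U i \<omega> * U j \<omega>) = (if i = j then LINT v|L. (h v)\<^sup>2 else 0)" by auto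
  qed
  have eq: "(\<Sum>i\<in>I. h (V i \<omega>))\<^sup>2 = (\<Sum>i\<in>I. \<Sum>j\<in>I. U i \<omega> * U j \<omega>)" for \<omega>
    by (simp add: U_def power2_eq_square sum_product)
  show ?A
    unfolding eq using cross by (intro Bochner_Integration.integrable_sum) auto
  have "expectation (\<lambda>\<omega>. (\<Sum>i\<in>I. h (V i \<omega>))\<^sup>2) = (\<Sum>i\<in>I. \<Sum>j\<in>I. expectation (\<lambda>\<omega>. U i \<omega> * U j \<omega>))"
    unfolding eq using cross by (simp add: Bochner_Integration.integral_sum)
  also have "\<dots> = card I * (LINT v|L. (h v)\<^sup>2)"
    using I cross by simp
  finally show ?B .
qed

lemma integral_Cauchy_Schwarz_sqrt:
  fixes f g :: "'a \<Rightarrow> real"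
  assumes f: "f \<in> borel_measurable P" "\<And>x. 0 \<le> f x" "integrable P (\<lambda>x. (f x)\<^sup>2)"
    and g: "g \<in> borel_measurable P" "\<And>x. 0 \<le> g x" "integrable P (\<lambda>x. (g x)\<^sup>2)"
  shows "integrable P (\<lambda>x. f x * g x)" (is ?A)
    and "(LINT x|P. f x * g x) \<le> sqrt (LINT x|P. (f x)\<^sup>2) * sqrt (LINT x|P. (g x)\<^sup>2)" (is ?B)
proof -
  have "\<bar>f x * g x\<bar> \<le> (f x)\<^sup>2 + (g x)\<^sup>2" for x
    using f(2)[of x] g(2)[of x] sum_squares_bound[of "f x" "g x"] using mult_nonneg_nonneg[OF f(2)[of x] g(2)[of x]] by linarith
  then show int: ?A
    using f(1) g(1) by (intro integrable_abs_le[OF Bochner_Integration.integrable_add[OF f(3) g(3)]]) auto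
  have "(\<integral>\<^sup>+x. ennreal (f x) * ennreal (g x) \<partial>P)\<^sup>2 \<le> (\<integral>\<^sup>+x. (ennreal (f x))\<^sup>2 \<partial>P) * (\<integral>\<^sup>+x. (ennreal (g x))\<^sup>2 \<partial>P)"
    using f(1) g(1) by (intro Cauchy_Schwarz_nn_integral) auto
  also have "(\<integral>\<^sup>+x. (ennreal (f x))\<^sup>2 \<partial>P) = ennreal (LINT x|P. (f x)\<^sup>2)"
    using f by (simp add: ennreal_power nn_integral_eq_integral)
  also have "(\<integral>\<^sup>+x. (ennreal (g x))\<^sup>2 \<partial>P) = ennreal (LINT x|P. (g x)\<^sup>2)"
    using g by (simp add: ennreal_power nn_integral_eq_integral)
  also have "(\<integral>\<^sup>+x. ennreal (f x) * ennreal (g x) \<partial>P) = ennreal (LINT x|P. f x * g x)"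
    using f g int by (simp add: ennreal_mult[symmetric] nn_integral_eq_integral)
  finally have "(LINT x|P. f x * g x)\<^sup>2 \<le> (LINT x|P. (f x)\<^sup>2) * (LINT x|P. (g x)\<^sup>2)"
    using f g by (simp add: ennreal_power ennreal_mult[symmetric])
  then show ?B
    using real_le_rsqrt by (simp add: real_sqrt_mult[symmetric])
qed

lemma lindeberg_product_bound:
  fixes f :: "'a \<Rightarrow> real" and g :: "'b \<Rightarrow> real"
  assumes P: "prob_space P" "prob_space Q"
    and f: "f \<in> borel_measurable P" "integrable P (\<lambda>x. (f x)\<^sup>2)" "integrable P (\<lambda>x. (f x) ^ 4)"
    and g: "g \<in> borel_measurable Q" "integrable Q (\<lambda>y. (g y)\<^sup>2)" and r: "0 < r"
  shows "(LINT z|(P \<Otimes>\<^sub>M Q). (f (fst z) * g (snd z))\<^sup>2 * indicator {x. r < \<bar>x\<bar>} (f (fst z) * g (snd z))) \<le>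
    (LINT x|P. (f x)\<^sup>2) * (LINT y|Q. (g y)\<^sup>2 * indicator {y. K < \<bar>y\<bar>} (g y)) +
    (LINT x|P. (f x) ^ 4) * (K\<^sup>2 / r\<^sup>2 * (LINT y|Q. (g y)\<^sup>2))"
proof -
  have [measurable]: "f \<in> borel_measurable P" "g \<in> borel_measurable Q" by fact+
  have gK: "integrable Q (\<lambda>y. (g y)\<^sup>2 * indicator {y. K < \<bar>y\<bar>} (g y))"
    by (rule integrable_abs_le[OF g(2)]) (auto simp: indicator_def)
  have gr: "integrable Q (\<lambda>y. K\<^sup>2 / r\<^sup>2 * (g y)\<^sup>2)" using g by simp
  note 1 = pair_measure_integral_mult[OF P f(2) gK] and 2 = pair_measure_integral_mult[OF P f(3) gr]
  note 0 = pair_measure_integral_mult[OF P f(2) g(2)]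
  have pointwise: "(a * b)\<^sup>2 * indicator {x. r < \<bar>x\<bar>} (a * b) \<le>
      a\<^sup>2 * (b\<^sup>2 * indicator {y. K < \<bar>y\<bar>} b) + a ^ 4 * (K\<^sup>2 / r\<^sup>2 * b\<^sup>2)" for a b :: real
  proof (cases "r < \<bar>a * b\<bar> \<and> \<bar>b\<bar> \<le> K")
    case True
    have "r\<^sup>2 \<le> (a * b)\<^sup>2" using True r by (simp add: abs_le_square_iff[symmetric])
    also have "\<dots> \<le> a\<^sup>2 * K\<^sup>2"
      using True unfolding power_mult_distrib by (intro mult_left_mono) (auto simp: abs_le_square_iff[symmetric])
    finally have "1 \<le> a\<^sup>2 * K\<^sup>2 / r\<^sup>2" using r by simp
    then have "(a * b)\<^sup>2 * 1 \<le> (a * b)\<^sup>2 * (a\<^sup>2 * K\<^sup>2 / r\<^sup>2)" by (rule mult_left_mono) simp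
    also have "\<dots> = a ^ 4 * (K\<^sup>2 / r\<^sup>2 * b\<^sup>2)"
      by (simp add: power_mult_distrib power2_eq_square power4_eq_xxxx)
    finally show ?thesis using True by (simp add: indicator_def)
  next
    case False
    have "0 \<le> a ^ 4 * (K\<^sup>2 / r\<^sup>2 * b\<^sup>2)" by simp
    then show ?thesis using False by (auto simp: indicator_def power_mult_distrib not_less)
  qed
  have "(LINT z|(P \<Otimes>\<^sub>M Q). (f (fst z) * g (snd z))\<^sup>2 * indicator {x. r < \<bar>x\<bar>} (f (fst z) * g (snd z))) \<le>
      (LINT z|(P \<Otimes>\<^sub>M Q). (f (fst z))\<^sup>2 * ((g (snd z))\<^sup>2 * indicator {y. K < \<bar>y\<bar>} (g (snd z))) +
        (f (fst z)) ^ 4 * (K\<^sup>2 / r\<^sup>2 * (g (snd z))\<^sup>2))"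
  proof (rule integral_mono)
    show "integrable (P \<Otimes>\<^sub>M Q) (\<lambda>z. (f (fst z) * g (snd z))\<^sup>2 * indicator {x. r < \<bar>x\<bar>} (f (fst z) * g (snd z)))"
      by (rule integrable_abs_le[OF 0(1)]) (auto simp: indicator_def power_mult_distrib)
    show "integrable (P \<Otimes>\<^sub>M Q) (\<lambda>z. (f (fst z))\<^sup>2 * ((g (snd z))\<^sup>2 * indicator {y. K < \<bar>y\<bar>} (g (snd z))) +
        (f (fst z)) ^ 4 * (K\<^sup>2 / r\<^sup>2 * (g (snd z))\<^sup>2))"
      by (rule Bochner_Integration.integrable_add[OF 1(1) 2(1)])
  qed (rule pointwise)
  also have "\<dots> = (LINT x|P. (f x)\<^sup>2) * (LINT y|Q. (g y)\<^sup>2 * indicator {y. K < \<bar>y\<bar>} (g y)) +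
    (LINT x|P. (f x) ^ 4) * (LINT y|Q. K\<^sup>2 / r\<^sup>2 * (g y)\<^sup>2)"
    unfolding Bochner_Integration.integral_add[OF 1(1) 2(1)] 1(2) 2(2) ..
  finally show ?thesis by simp
qed

lemma square_tail_integral_tendsto_0:
  fixes g :: "'b \<Rightarrow> real"
  assumes g: "g \<in> borel_measurable Q" "integrable Q (\<lambda>y. (g y)\<^sup>2)"
  shows "(\<lambda>K. LINT y|Q. (g y)\<^sup>2 * indicator {y. real K < \<bar>y\<bar>} (g y)) \<longlonglongrightarrow> 0"
proof -
  have [measurable]: "g \<in> borel_measurable Q" by fact
  have "(\<lambda>K. LINT y|Q. (g y)\<^sup>2 * indicator {y. real K < \<bar>y\<bar>} (g y)) \<longlonglongrightarrow> (LINT y|Q. 0)"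
  proof (rule integral_dominated_convergence[where w="\<lambda>y. (g y)\<^sup>2"])
    show "AE y in Q. (\<lambda>K. (g y)\<^sup>2 * indicator {y. real K < \<bar>y\<bar>} (g y)) \<longlonglongrightarrow> 0"
    proof (rule AE_I2)
      fix y
      have "\<forall>\<^sub>F K in sequentially. (g y)\<^sup>2 * indicator {y. real K < \<bar>y\<bar>} (g y) = 0"
        by (rule eventually_sequentiallyI[of "nat \<lceil>\<bar>g y\<bar>\<rceil>"]) (auto simp: indicator_def nat_ceiling_le_eq)
      then show "(\<lambda>K. (g y)\<^sup>2 * indicator {y. real K < \<bar>y\<bar>} (g y)) \<longlonglongrightarrow> 0"
        by (rule tendsto_eventually)
    qed
  qed (use g in \<open>auto simp: indicator_def\<close>)
  then show ?thesis by simp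
qed

section \<open>Moments of the regression sample\<close>

lemma integral_double_sum:
  fixes f :: "nat \<Rightarrow> nat \<Rightarrow> 'a \<Rightarrow> real"
  assumes "\<And>j k. j < p \<Longrightarrow> k < p \<Longrightarrow> integrable P (f j k)"
  shows "(LINT x|P. (\<Sum>j<p. \<Sum>k<p. f j k x)) = (\<Sum>j<p. \<Sum>k<p. LINT x|P. f j k x)"
proof -
  have "(LINT x|P. (\<Sum>j<p. \<Sum>k<p. f j k x)) = (\<Sum>j<p. LINT x|P. (\<Sum>k<p. f j k x))"
    using assms by (intro Bochner_Integration.integral_sum Bochner_Integration.integrable_sum) auto
  also have "\<dots> = (\<Sum>j<p. \<Sum>k<p. LINT x|P. f j k x)"
    using assms by (intro sum.cong refl Bochner_Integration.integral_sum) auto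
  finally show ?thesis .
qed

locale regression_sample = prob_space M for M :: "'a measure" +
  fixes n p :: nat and X :: "nat \<Rightarrow> 'a \<Rightarrow> nat \<Rightarrow> real" and e :: "nat \<Rightarrow> 'a \<Rightarrow> real"
    and LX :: "(nat \<Rightarrow> real) measure" and Le :: "real measure" and \<sigma> :: real
  assumes LX: "prob_space LX" "sets LX = sets (Rvec p)"
    and LX_mean: "\<And>j. j < p \<Longrightarrow> (LINT x|LX. x j) = 0"
    and LX_fourth: "\<And>j. j < p \<Longrightarrow> integrable LX (\<lambda>x. (x j) ^ 4)"
    and Le: "prob_space Le" "sets Le = sets borel"
    and Le_mean: "(LINT x|Le. x) = 0"
    and Le_square: "integrable Le (\<lambda>x. x\<^sup>2)" "(LINT x|Le. x\<^sup>2) = \<sigma>\<^sup>2"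
    and X_indep: "indep_vars (\<lambda>_. Rvec p) X {..<n}"
    and X_law: "\<And>i. i < n \<Longrightarrow> distr M (Rvec p) (X i) = LX"
    and e_indep: "indep_vars (\<lambda>_. borel) e {..<n}"
    and e_law: "\<And>i. i < n \<Longrightarrow> distr M borel (e i) = Le"
    and X_e_indep: "independent_elements M
      (PiM {..<n} (\<lambda>_. Rvec p)) (\<lambda>\<omega>. \<lambda>i\<in>{..<n}. X i \<omega>) (PiM {..<n} (\<lambda>_. borel)) (\<lambda>\<omega>. \<lambda>i\<in>{..<n}. e i \<omega>)"
begin

sublocale LX: prob_space LX by (rule LX(1))
sublocale Le: prob_space Le by (rule Le(1))

declare LX(2) [measurable_cong] Le(2) [measurable_cong]

definition cov :: "nat \<Rightarrow> nat \<Rightarrow> real" where "cov j k = (LINT x|LX. x j * x k)"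

definition fourth_moment_sum :: real where "fourth_moment_sum = (\<Sum>j<p. sqrt (LINT x|LX. (x j) ^ 4))"

definition lin :: "(nat \<Rightarrow> real) \<Rightarrow> (nat \<Rightarrow> real) \<Rightarrow> real" where "lin w x = (\<Sum>j<p. w j * x j)"

abbreviation cov_form :: "(nat \<Rightarrow> real) \<Rightarrow> real" where
  "cov_form w \<equiv> bilinear_form {..<p} cov w w"

abbreviation score_square :: "'a \<Rightarrow> real" where
  "score_square \<equiv> \<lambda>\<omega>. \<Sum>j<p. (\<Sum>i<n. e i \<omega> * X i \<omega> j)\<^sup>2"

abbreviation gram_error :: "'a \<Rightarrow> real" where
  "gram_error \<equiv> \<lambda>\<omega>. frobenius_norm {..<p} {..<p} (\<lambda>j k. (\<Sum>i<n. X i \<omega> j * X i \<omega> k) / n - cov j k)"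

lemma coord_measurable [measurable]: "j < p \<Longrightarrow> (\<lambda>x. x j) \<in> borel_measurable (Rvec p)"
  by (rule measurable_component_singleton) simp

lemma lin_measurable [measurable]: "lin w \<in> borel_measurable (Rvec p)"
  unfolding lin_def by (intro borel_measurable_sum borel_measurable_times coord_measurable) auto

lemma X_measurable [measurable]: "i < n \<Longrightarrow> X i \<in> measurable M (Rvec p)"
  using X_indep by (auto simp: indep_vars_def2)

lemma X_coord_measurable [measurable]: "i < n \<Longrightarrow> j < p \<Longrightarrow> (\<lambda>\<omega>. X i \<omega> j) \<in> borel_measurable M"
  using measurable_compose[OF X_measurable coord_measurable] by simp

lemma e_measurable [measurable]: "i < n \<Longrightarrow> e i \<in> borel_measurable M"
  using e_indep by (auto simp: indep_vars_def2)

lemma coord_borel_LX: "j < p \<Longrightarrow> (\<lambda>x. x j) \<in> borel_measurable LX"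
  by measurable

lemma coord_fourth: "(\<lambda>x::nat \<Rightarrow> real. ((x i)\<^sup>2)\<^sup>2) = (\<lambda>x. (x i) ^ 4)"
  by (auto simp: fun_eq_iff)

lemma coord_product:
  assumes "j < p" "k < p"
  shows "integrable LX (\<lambda>x. (x j * x k)\<^sup>2)" (is ?A)
    and "(LINT x|LX. (x j * x k)\<^sup>2) \<le> sqrt (LINT x|LX. (x j) ^ 4) * sqrt (LINT x|LX. (x k) ^ 4)" (is ?B)
    and "integrable LX (\<lambda>x. x j * x k)" (is ?C)
proof -
  have m: "(\<lambda>x. x j) \<in> borel_measurable LX" "(\<lambda>x. x k) \<in> borel_measurable LX"
    using assms by (auto intro: coord_borel_LX)
  note cs = integral_Cauchy_Schwarz_sqrt[of "\<lambda>x. (x j)\<^sup>2" LX "\<lambda>x. (x k)\<^sup>2", unfolded coord_fourth]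
  show 1: ?A
    unfolding power_mult_distrib by (rule cs(1)) (use m assms LX_fourth in auto)
  show ?B
    unfolding power_mult_distrib by (rule cs(2)) (use m assms LX_fourth in auto)
  show ?C
    by (rule LX.square_integrable_imp_integrable[OF _ 1]) (use m in measurable)
qed

lemma coord_square:
  assumes "j < p"
  shows "(LINT x|LX. (x j)\<^sup>2) \<le> sqrt (LINT x|LX. (x j) ^ 4)"
proof -
  have m: "(\<lambda>x. x j) \<in> borel_measurable LX" using assms by (rule coord_borel_LX)
  show ?thesis
    using integral_Cauchy_Schwarz_sqrt(2)[of "\<lambda>x. (x j)\<^sup>2" LX "\<lambda>_. 1", unfolded coord_fourth] m LX_fourth[OF assms]
    by (simp add: LX.prob_space)
qed

lemma coord_integrable: "j < p \<Longrightarrow> integrable LX (\<lambda>x. x j)"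
  using LX.square_integrable_imp_integrable[OF coord_borel_LX] coord_product(3)[of j j]
  by (simp add: power2_eq_square)

lemma lin_mean: "integrable LX (lin w)" "(LINT x|LX. lin w x) = 0"
  unfolding lin_def using coord_integrable LX_mean
  by (auto intro!: Bochner_Integration.integrable_sum simp: Bochner_Integration.integral_sum)

lemma lin_square:
  "integrable LX (\<lambda>x. (lin w x)\<^sup>2)" (is ?A)
  "(LINT x|LX. (lin w x)\<^sup>2) = cov_form w" (is ?B)
proof -
  have eq: "(lin w x)\<^sup>2 = (\<Sum>j<p. \<Sum>k<p. w j * w k * (x j * x k))" for x
    unfolding lin_def power2_eq_square sum_product by (intro sum.cong refl) (simp add: ac_simps)
  have int: "integrable LX (\<lambda>x. w j * w k * (x j * x k))" if "j < p" "k < p" for j k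
    using coord_product(3)[OF that] by simp
  show ?A
    unfolding eq using int by (intro Bochner_Integration.integrable_sum) auto
  have "(LINT x|LX. (lin w x)\<^sup>2) = (\<Sum>j<p. \<Sum>k<p. LINT x|LX. w j * w k * (x j * x k))"
    unfolding eq by (rule integral_double_sum[OF int])
  also have "\<dots> = cov_form w"
    by (intro sum.cong refl) (simp add: cov_def)
  finally show ?B .
qed

lemma lin_fourth:
  "integrable LX (\<lambda>x. (lin w x) ^ 4)" (is ?A)
  "(LINT x|LX. (lin w x) ^ 4) \<le> (L2_set w {..<p}) ^ 4 * fourth_moment_sum\<^sup>2" (is ?B)
proof -
  define g where "g x = (L2_set w {..<p}) ^ 4 * (\<Sum>j<p. \<Sum>k<p. (x j * x k)\<^sup>2)" for x :: "nat \<Rightarrow> real"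
  have le: "(lin w x) ^ 4 \<le> g x" for x
  proof -
    have "(lin w x)\<^sup>2 \<le> (L2_set w {..<p})\<^sup>2 * (\<Sum>j<p. (x j)\<^sup>2)"
      unfolding lin_def L2_set_power2 by (rule Cauchy_Schwarz_ineq_sum)
    then have "((lin w x)\<^sup>2)\<^sup>2 \<le> ((L2_set w {..<p})\<^sup>2 * (\<Sum>j<p. (x j)\<^sup>2))\<^sup>2"
      by (rule power_mono) simp
    also have "\<dots> = (L2_set w {..<p}) ^ 4 * ((\<Sum>j<p. (x j)\<^sup>2) * (\<Sum>j<p. (x j)\<^sup>2))"
      by (simp add: power_mult_distrib flip: power2_eq_square)
    also have "\<dots> = g x"
      unfolding g_def sum_product by (simp only: power_mult_distrib)
    finally show ?thesis by simp
  qed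
  have gi: "integrable LX g"
    unfolding g_def using coord_product(1)
    by (intro integrable_mult_right Bochner_Integration.integrable_sum) auto
  show int: ?A
    by (rule integrable_abs_le[OF gi]) (use le in auto)
  have "(LINT x|LX. (lin w x) ^ 4) \<le> (LINT x|LX. g x)"
    by (rule integral_mono[OF int gi le])
  also have "\<dots> = (L2_set w {..<p}) ^ 4 * (\<Sum>j<p. \<Sum>k<p. LINT x|LX. (x j * x k)\<^sup>2)"
    unfolding g_def by (simp add: integral_double_sum[OF coord_product(1)])
  also have "\<dots> \<le> (L2_set w {..<p}) ^ 4 * (\<Sum>j<p. \<Sum>k<p. sqrt (LINT x|LX. (x j) ^ 4) * sqrt (LINT x|LX. (x k) ^ 4))"
    by (intro mult_left_mono sum_mono coord_product) auto
  also have "\<dots> = (L2_set w {..<p}) ^ 4 * fourth_moment_sum\<^sup>2"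
    unfolding fourth_moment_sum_def power2_eq_square sum_product ..
  finally show ?B .
qed

lemma e_integrable: "integrable Le (\<lambda>x. x)"
  by (rule Le.square_integrable_imp_integrable[OF measurable_ident_sets[OF Le(2)] Le_square(1)])

definition noise :: "(nat \<Rightarrow> real) \<Rightarrow> (nat \<Rightarrow> real) \<times> real \<Rightarrow> real" where
  "noise w z = lin w (fst z) * snd z"

abbreviation noise_dist :: "(nat \<Rightarrow> real) \<Rightarrow> real measure" where
  "noise_dist w \<equiv> distr (LX \<Otimes>\<^sub>M Le) borel (noise w)"

lemma noise_measurable [measurable]: "noise w \<in> borel_measurable (Rvec p \<Otimes>\<^sub>M borel)"
  unfolding noise_def by measurable

lemma noise_moments:
  "integrable (LX \<Otimes>\<^sub>M Le) (noise w)" "(LINT z|(LX \<Otimes>\<^sub>M Le). noise w z) = 0"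
  "integrable (LX \<Otimes>\<^sub>M Le) (\<lambda>z. (noise w z)\<^sup>2)"
  "(LINT z|(LX \<Otimes>\<^sub>M Le). (noise w z)\<^sup>2) = \<sigma>\<^sup>2 * cov_form w"
  using pair_measure_integral_mult[OF LX(1) Le(1) lin_mean(1) e_integrable, of w]
    pair_measure_integral_mult[OF LX(1) Le(1) lin_square(1) Le_square(1), of w]
  by (simp_all add: noise_def[abs_def] power_mult_distrib Le_mean Le_square lin_square)

lemma pair_indep: "indep_vars (\<lambda>_. Rvec p \<Otimes>\<^sub>M borel) (\<lambda>i \<omega>. (X i \<omega>, e i \<omega>)) {..<n}"
  by (rule indep_vars_Pair(1)[OF _ X_indep e_indep X_e_indep]) simp

lemma pair_law: "i < n \<Longrightarrow> distr M (Rvec p \<Otimes>\<^sub>M borel) (\<lambda>\<omega>. (X i \<omega>, e i \<omega>)) = LX \<Otimes>\<^sub>M Le"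
  using indep_vars_Pair(2)[OF _ X_indep e_indep X_e_indep] by (simp add: X_law e_law)

lemma noise_indep: "indep_vars (\<lambda>_. borel) (\<lambda>i \<omega>. noise w (X i \<omega>, e i \<omega>)) {..<n}"
  by (rule indep_vars_compose2[OF pair_indep]) (rule noise_measurable)

lemma noise_law: "i < n \<Longrightarrow> distr M borel (\<lambda>\<omega>. noise w (X i \<omega>, e i \<omega>)) = noise_dist w"
  unfolding pair_law[symmetric]
  by (subst distr_distr) (auto simp: comp_def intro!: measurable_Pair)

lemma sets_pair_law: "sets (LX \<Otimes>\<^sub>M Le) = sets (Rvec p \<Otimes>\<^sub>M borel)"
  by (rule sets_pair_measure_cong[OF LX(2) Le(2)])

lemma noise_sum_second_moment:
  "integrable M (\<lambda>\<omega>. (\<Sum>i<n. e i \<omega> * (\<Sum>j<p. w j * X i \<omega> j))\<^sup>2)" (is ?A)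
  "expectation (\<lambda>\<omega>. (\<Sum>i<n. e i \<omega> * (\<Sum>j<p. w j * X i \<omega> j))\<^sup>2) = n * (\<sigma>\<^sup>2 * cov_form w)" (is ?B)
proof -
  have eq: "(\<Sum>i<n. e i \<omega> * (\<Sum>j<p. w j * X i \<omega> j)) = (\<Sum>i<n. noise w (X i \<omega>, e i \<omega>))" for \<omega>
    by (simp add: noise_def lin_def mult.commute)
  note m = iid_sum_second_moment[OF finite_lessThan pair_indep pair_law sets_pair_law noise_measurable
      noise_moments(3,2), of w]
  show ?A
    unfolding eq using m(1) by simp
  show ?B
    unfolding eq using m(2) by (simp add: noise_moments)
qed

lemma noise_tail:
  fixes t :: real
  assumes "0 < t"
  shows "\<P>(\<omega> in M. t \<le> (\<Sum>i<n. e i \<omega> * (\<Sum>j<p. w j * X i \<omega> j))\<^sup>2) \<le>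
    n * (\<sigma>\<^sup>2 * cov_form w) / t"
  using integral_Markov_inequality_measure[OF noise_sum_second_moment(1) sets.empty_sets _ assms, of w]
  by (simp add: noise_sum_second_moment)

lemma score_tail:
  fixes t :: real
  assumes "0 < t"
  shows "\<P>(\<omega> in M. t \<le> score_square \<omega>) \<le> n * \<sigma>\<^sup>2 * fourth_moment_sum / t"
proof -
  have coord: "integrable M (\<lambda>\<omega>. (\<Sum>i<n. e i \<omega> * X i \<omega> j)\<^sup>2)"
    "expectation (\<lambda>\<omega>. (\<Sum>i<n. e i \<omega> * X i \<omega> j)\<^sup>2) = n * (\<sigma>\<^sup>2 * cov j j)" if j: "j < p" for j
  proof -
    have delta: "(\<Sum>k<p. of_bool (k = j) * F k) = F j" for F :: "nat \<Rightarrow> real"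
      using j by (simp add: of_bool_def if_distrib[of "\<lambda>z. z * _"] cong: if_cong)
    have delta': "(\<Sum>k<p. F k * of_bool (k = j)) = F j" for F :: "nat \<Rightarrow> real"
      using delta[of F] by (simp only: mult.commute)
    have "(\<Sum>l<p. \<Sum>k<p. of_bool (l = j) * cov l k * of_bool (k = j)) = cov j j"
      unfolding delta' by (rule delta)
    then show "integrable M (\<lambda>\<omega>. (\<Sum>i<n. e i \<omega> * X i \<omega> j)\<^sup>2)"
      "expectation (\<lambda>\<omega>. (\<Sum>i<n. e i \<omega> * X i \<omega> j)\<^sup>2) = n * (\<sigma>\<^sup>2 * cov j j)"
      using noise_sum_second_moment[of "\<lambda>k. of_bool (k = j)"] unfolding delta by simp_all
  qed
  have int: "integrable M score_square"
    using coord by (intro Bochner_Integration.integrable_sum) auto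
  have "expectation score_square = (\<Sum>j<p. n * (\<sigma>\<^sup>2 * cov j j))"
    using coord by (simp add: Bochner_Integration.integral_sum)
  also have "\<dots> \<le> (\<Sum>j<p. n * (\<sigma>\<^sup>2 * sqrt (LINT x|LX. (x j) ^ 4)))"
    using coord_square by (intro sum_mono mult_left_mono) (auto simp: cov_def power2_eq_square)
  also have "\<dots> = n * \<sigma>\<^sup>2 * fourth_moment_sum"
    by (simp add: fourth_moment_sum_def sum_distrib_left mult.assoc)
  finally have "expectation score_square / t \<le> n * \<sigma>\<^sup>2 * fourth_moment_sum / t"
    using assms by (simp add: divide_right_mono)
  moreover have "\<P>(\<omega> in M. t \<le> score_square \<omega>) \<le>
      expectation score_square / t"
    by (rule integral_Markov_inequality_measure[OF int sets.empty_sets _ assms]) (simp add: sum_nonneg)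
  ultimately show ?thesis by linarith
qed

lemma frobenius_tail:
  fixes t :: real
  assumes "0 < t" and n: "0 < n"
  shows "\<P>(\<omega> in M. t \<le> (gram_error \<omega>)\<^sup>2) \<le> fourth_moment_sum\<^sup>2 / (n * t)"
proof -
  define D where "D j k \<omega> = (\<Sum>i<n. X i \<omega> j * X i \<omega> k) / n - cov j k" for j k \<omega>
  have entry: "integrable M (\<lambda>\<omega>. (D j k \<omega>)\<^sup>2)"
    "expectation (\<lambda>\<omega>. (D j k \<omega>)\<^sup>2) \<le> (sqrt (LINT x|LX. (x j) ^ 4) * sqrt (LINT x|LX. (x k) ^ 4)) / n"
    if jk: "j < p" "k < p" for j k
  proof -
    define h where "h x = x j * x k - cov j k" for x :: "nat \<Rightarrow> real"
    have hm: "h \<in> borel_measurable (Rvec p)"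
      unfolding h_def using jk by measurable
    have i1: "integrable LX (\<lambda>x. x j * x k)" and i2: "integrable LX (\<lambda>x. (x j * x k)\<^sup>2)"
      using coord_product[OF jk] by auto
    have h2: "(h x)\<^sup>2 = (x j * x k)\<^sup>2 - 2 * cov j k * (x j * x k) + (cov j k)\<^sup>2" for x
      by (simp add: h_def power2_eq_square algebra_simps)
    have hi: "integrable LX (\<lambda>x. (h x)\<^sup>2)" unfolding h2 using i1 i2 by simp
    have h0: "(LINT x|LX. h x) = 0"
      unfolding h_def using i1 by (simp add: cov_def LX.prob_space)
    have "(LINT x|LX. (h x)\<^sup>2) = (LINT x|LX. (x j * x k)\<^sup>2) - (cov j k)\<^sup>2"
      unfolding h2 using i1 i2 by (simp add: LX.prob_space power2_eq_square flip: cov_def)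
    then have hle: "(LINT x|LX. (h x)\<^sup>2) \<le> sqrt (LINT x|LX. (x j) ^ 4) * sqrt (LINT x|LX. (x k) ^ 4)"
      using coord_product(2)[OF jk] zero_le_power2[of "cov j k"] by linarith
    note m = iid_sum_second_moment[OF finite_lessThan X_indep X_law LX(2) hm hi h0]
    have eq: "(D j k \<omega>)\<^sup>2 = (\<Sum>i<n. h (X i \<omega>))\<^sup>2 / n\<^sup>2" for \<omega>
    proof -
      have "D j k \<omega> = (\<Sum>i<n. h (X i \<omega>)) / n"
        using n by (simp add: D_def h_def sum_subtractf field_simps)
      then show ?thesis by (simp add: power_divide)
    qed
    show "integrable M (\<lambda>\<omega>. (D j k \<omega>)\<^sup>2)"
      unfolding eq using m(1) by simp
    have "expectation (\<lambda>\<omega>. (D j k \<omega>)\<^sup>2) = (LINT x|LX. (h x)\<^sup>2) / n"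
      unfolding eq using m(2) n by (simp add: power2_eq_square)
    then show "expectation (\<lambda>\<omega>. (D j k \<omega>)\<^sup>2) \<le> (sqrt (LINT x|LX. (x j) ^ 4) * sqrt (LINT x|LX. (x k) ^ 4)) / n"
      using hle by (simp add: divide_right_mono)
  qed
  have F: "(frobenius_norm {..<p} {..<p} (\<lambda>j k. D j k \<omega>))\<^sup>2 = (\<Sum>j<p. \<Sum>k<p. (D j k \<omega>)\<^sup>2)" for \<omega>
    by (simp add: frobenius_norm_def sum_nonneg)
  have int: "integrable M (\<lambda>\<omega>. \<Sum>j<p. \<Sum>k<p. (D j k \<omega>)\<^sup>2)"
    using entry(1) by (intro Bochner_Integration.integrable_sum) auto
  have "expectation (\<lambda>\<omega>. \<Sum>j<p. \<Sum>k<p. (D j k \<omega>)\<^sup>2) = (\<Sum>j<p. \<Sum>k<p. expectation (\<lambda>\<omega>. (D j k \<omega>)\<^sup>2))"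
    by (rule integral_double_sum[OF entry(1)])
  also have "\<dots> \<le> (\<Sum>j<p. \<Sum>k<p. (sqrt (LINT x|LX. (x j) ^ 4) * sqrt (LINT x|LX. (x k) ^ 4)) / n)"
    using entry(2) by (intro sum_mono) auto
  also have "\<dots> = fourth_moment_sum\<^sup>2 / n"
    unfolding fourth_moment_sum_def power2_eq_square sum_product sum_divide_distrib ..
  finally have "expectation (\<lambda>\<omega>. \<Sum>j<p. \<Sum>k<p. (D j k \<omega>)\<^sup>2) \<le> fourth_moment_sum\<^sup>2 / n" .
  from divide_right_mono[OF this, of t]
  have "expectation (\<lambda>\<omega>. \<Sum>j<p. \<Sum>k<p. (D j k \<omega>)\<^sup>2) / t \<le> fourth_moment_sum\<^sup>2 / (n * t)"
    using assms(1) by simp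
  moreover have "\<P>(\<omega> in M. t \<le> (\<Sum>j<p. \<Sum>k<p. (D j k \<omega>)\<^sup>2)) \<le>
      expectation (\<lambda>\<omega>. \<Sum>j<p. \<Sum>k<p. (D j k \<omega>)\<^sup>2) / t"
    by (rule integral_Markov_inequality_measure[OF int sets.empty_sets _ assms(1)]) (simp add: sum_nonneg)
  ultimately show ?thesis unfolding F[symmetric] by (simp add: D_def[abs_def])
qed

lemma noise_law_moments:
  "real_distribution (noise_dist w)"
  "integrable (noise_dist w) (\<lambda>x. x)"
  "(LINT x|noise_dist w. x) = 0"
  "integrable (noise_dist w) (\<lambda>x. x\<^sup>2)"
  "(LINT x|noise_dist w. x\<^sup>2) = \<sigma>\<^sup>2 * cov_form w"
proof -
  interpret pair_prob_space LX Le ..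
  have m: "noise w \<in> borel_measurable (LX \<Otimes>\<^sub>M Le)"
    using noise_measurable measurable_cong_sets[OF sets_pair_law refl] by blast
  show "real_distribution (noise_dist w)"
    by (rule real_distribution_distr[OF m])
  show "integrable (noise_dist w) (\<lambda>x. x)"
    "integrable (noise_dist w) (\<lambda>x. x\<^sup>2)"
    using m noise_moments by (simp_all add: integrable_distr_eq)
  show "(LINT x|noise_dist w. x) = 0"
    "(LINT x|noise_dist w. x\<^sup>2) = \<sigma>\<^sup>2 * cov_form w"
    using m noise_moments by (simp_all add: integral_distr)
qed

lemma noise_lindeberg:
  assumes r: "0 < r"
  shows "(LINT x|noise_dist w. x\<^sup>2 * indicator {x. r < \<bar>x\<bar>} x) \<le>
    cov_form w * (LINT y|Le. y\<^sup>2 * indicator {y. K < \<bar>y\<bar>} y) +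
    (L2_set w {..<p}) ^ 4 * fourth_moment_sum\<^sup>2 * (K\<^sup>2 / r\<^sup>2 * \<sigma>\<^sup>2)"
proof -
  have m: "noise w \<in> borel_measurable (LX \<Otimes>\<^sub>M Le)"
    using noise_measurable measurable_cong_sets[OF sets_pair_law refl] by blast
  have lm: "lin w \<in> borel_measurable LX" by measurable
  have "(LINT x|noise_dist w. x\<^sup>2 * indicator {x. r < \<bar>x\<bar>} x) =
      (LINT z|(LX \<Otimes>\<^sub>M Le). (lin w (fst z) * snd z)\<^sup>2 * indicator {x. r < \<bar>x\<bar>} (lin w (fst z) * snd z))"
    using m by (subst integral_distr) (auto simp: noise_def)
  also have "\<dots> \<le> (LINT x|LX. (lin w x)\<^sup>2) * (LINT y|Le. y\<^sup>2 * indicator {y. K < \<bar>y\<bar>} y) +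
      (LINT x|LX. (lin w x) ^ 4) * (K\<^sup>2 / r\<^sup>2 * (LINT y|Le. y\<^sup>2))"
    by (rule lindeberg_product_bound[OF LX(1) Le(1) lm lin_square(1) lin_fourth(1)
          measurable_ident_sets[OF Le(2)] Le_square(1) r])
  also have "\<dots> \<le> (LINT x|LX. (lin w x)\<^sup>2) * (LINT y|Le. y\<^sup>2 * indicator {y. K < \<bar>y\<bar>} y) +
      (L2_set w {..<p}) ^ 4 * fourth_moment_sum\<^sup>2 * (K\<^sup>2 / r\<^sup>2 * (LINT y|Le. y\<^sup>2))"
    unfolding Le_square by (intro add_left_mono mult_right_mono lin_fourth) auto
  finally show ?thesis unfolding lin_square Le_square .
qed

end

section \<open>Asymptotic normality of the noise term\<close>

lemma noise_sum_central_limit: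
  fixes C :: real
  assumes rs: "\<And>n. regression_sample (M n) n (d n) (X n) (e n) (LX n) Le \<sigma>"
    and w: "\<And>n. L2_set (w n) {..<d n} \<le> Cw"
    and m4: "\<And>n. regression_sample.fourth_moment_sum (d n) (LX n) \<le> C * d n"
    and var: "(\<lambda>n. \<Sum>j<d n. \<Sum>k<d n. w n j * regression_sample.cov (LX n) j k * w n k) \<longlonglongrightarrow> v"
    and d: "(\<lambda>n. (real (d n))\<^sup>2 / n) \<longlonglongrightarrow> 0"
  shows "(\<lambda>n. LINT \<omega>|M n. iexp ((\<Sum>i<n. e n i \<omega> * (\<Sum>j<d n. w n j * X n i \<omega> j)) / sqrt (real n)))
    \<longlonglongrightarrow> complex_of_real (exp (- (\<sigma>\<^sup>2 * v) / 2))"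
proof -
  define N where "N n = regression_sample.noise (d n) (w n)" for n
  define L where "L n = distr (LX n \<Otimes>\<^sub>M Le) borel (N n)" for n
  define Q where "Q n = (\<Sum>j<d n. \<Sum>k<d n. w n j * regression_sample.cov (LX n) j k * w n k)" for n
  have mom: "real_distribution (L n)" "integrable (L n) (\<lambda>x. x)" "(LINT x|L n. x) = 0"
    "integrable (L n) (\<lambda>x. x\<^sup>2)" "(LINT x|L n. x\<^sup>2) = \<sigma>\<^sup>2 * Q n" for n
    unfolding N_def L_def Q_def by (rule regression_sample.noise_law_moments[OF rs])+
  have eq: "(\<Sum>i<n. e n i \<omega> * (\<Sum>j<d n. w n j * X n i \<omega> j)) = (\<Sum>i<n. N n (X n i \<omega>, e n i \<omega>))" for n \<omega>
    by (simp add: N_def regression_sample.noise_def[OF rs] regression_sample.lin_def[OF rs] mult.commute)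
  have Q0: "0 \<le> Q n" for n
    unfolding Q_def regression_sample.lin_square(2)[OF rs, symmetric] by simp
  obtain CQ where CQ: "0 < CQ" "\<And>n. Q n \<le> CQ"
  proof -
    have "Bseq Q" using var unfolding Q_def[symmetric] by (intro convergent_imp_Bseq convergentI)
    then obtain K where "0 < K" "\<And>n. norm (Q n) \<le> K" by (auto simp: Bseq_def)
    then show ?thesis using that by (auto simp: abs_le_iff)
  qed
  have Cw: "0 \<le> Cw" using w[of 0] L2_set_nonneg order_trans by blast
  define tail where "tail \<eta> n = (LINT x|L n. x\<^sup>2 * indicator {x. \<eta> * sqrt (real n) < \<bar>x\<bar>} x)" for \<eta> n
  have lindeberg: "tail \<eta> \<longlonglongrightarrow> 0" if \<eta>: "0 < \<eta>" for \<eta>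
  proof (rule LIMSEQ_I)
    fix r :: real assume r: "0 < r"
    have Le2: "sets Le = sets borel" "integrable Le (\<lambda>x. x\<^sup>2)"
      using regression_sample.Le(2)[OF rs] regression_sample.Le_square(1)[OF rs] by auto
    define \<tau> where "\<tau> K = (LINT y|Le. y\<^sup>2 * indicator {y. real K < \<bar>y\<bar>} y)" for K
    have "\<tau> \<longlonglongrightarrow> 0"
      unfolding \<tau>_def using square_tail_integral_tendsto_0[OF measurable_ident_sets[OF Le2(1)] Le2(2)] .
    then have "(\<lambda>K. CQ * \<tau> K) \<longlonglongrightarrow> CQ * 0" by (intro tendsto_intros)
    then have "\<forall>\<^sub>F K in sequentially. CQ * \<tau> K < r / 2"
      by (rule order_tendstoD) (use r in simp)
    then obtain K where K: "CQ * \<tau> K < r / 2" by (auto simp: eventually_sequentially)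
    define c where "c = Cw ^ 4 * C\<^sup>2 * ((real K)\<^sup>2 / \<eta>\<^sup>2 * \<sigma>\<^sup>2)"
    have "(\<lambda>n. CQ * \<tau> K + c * ((real (d n))\<^sup>2 / n)) \<longlonglongrightarrow> CQ * \<tau> K + c * 0"
      by (intro tendsto_intros d)
    then have "\<forall>\<^sub>F n in sequentially. CQ * \<tau> K + c * ((real (d n))\<^sup>2 / n) < r"
      by (rule order_tendstoD) (use K r in simp)
    then obtain n0 where n0: "\<And>n. n \<ge> n0 \<Longrightarrow> CQ * \<tau> K + c * ((real (d n))\<^sup>2 / n) < r"
      by (auto simp: eventually_sequentially)
    have "norm (tail \<eta> n - 0) < r"
      if n: "n \<ge> max 1 n0" for n
    proof -
      have pos: "0 < \<eta> * sqrt (real n)" using \<eta> n by simp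
      define m where "m = regression_sample.fourth_moment_sum (d n) (LX n)"
      have m: "0 \<le> m" unfolding m_def regression_sample.fourth_moment_sum_def[OF rs] by (simp add: sum_nonneg)
      have \<tau>0: "0 \<le> \<tau> K" unfolding \<tau>_def by (rule Bochner_Integration.integral_nonneg) (simp add: indicator_def)
      have "tail \<eta> n \<le>
          Q n * \<tau> K + (L2_set (w n) {..<d n}) ^ 4 * m\<^sup>2 * ((real K)\<^sup>2 / (\<eta> * sqrt (real n))\<^sup>2 * \<sigma>\<^sup>2)"
        using regression_sample.noise_lindeberg[OF rs pos, of n "w n" "real K"]
        unfolding N_def L_def Q_def \<tau>_def m_def tail_def .
      also have "\<dots> \<le> CQ * \<tau> K + Cw ^ 4 * (C * d n)\<^sup>2 * ((real K)\<^sup>2 / (\<eta> * sqrt (real n))\<^sup>2 * \<sigma>\<^sup>2)"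
      proof (intro add_mono mult_right_mono)
        show "L2_set (w n) {..<d n} ^ 4 * m\<^sup>2 \<le> Cw ^ 4 * (C * d n)\<^sup>2"
          using w[of n] m4[of n] m by (intro mult_mono power_mono) (auto simp: m_def L2_set_nonneg Cw)
      qed (use CQ(2)[of n] \<tau>0 in auto)
      also have "\<dots> = CQ * \<tau> K + c * ((real (d n))\<^sup>2 / n)"
        by (simp add: c_def power_mult_distrib)
      also have "\<dots> < r" using n0 n by simp
      finally have "tail \<eta> n < r" .
      moreover have "0 \<le> tail \<eta> n"
        unfolding tail_def by (rule Bochner_Integration.integral_nonneg) (simp add: indicator_def)
      ultimately show ?thesis by simp
    qed
    then show "\<exists>no. \<forall>n\<ge>no. norm (tail \<eta> n - 0) < r"
      by blast
  qed
  show ?thesis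
    unfolding eq
  proof (rule row_iid_central_limit[where L=L])
    show "prob_space (M n)" for n
      using rs[of n] by (simp add: regression_sample_def)
    show "prob_space.indep_vars (M n) (\<lambda>_. borel) (\<lambda>i \<omega>. N n (X n i \<omega>, e n i \<omega>)) {..<n}" for n
      unfolding N_def by (rule regression_sample.noise_indep[OF rs])
    show "distr (M n) borel (\<lambda>\<omega>. N n (X n i \<omega>, e n i \<omega>)) = L n" if "i < n" for n i
      unfolding N_def L_def by (rule regression_sample.noise_law[OF rs that])
    show "(\<lambda>n. LINT x|L n. x\<^sup>2) \<longlonglongrightarrow> \<sigma>\<^sup>2 * v"
      using tendsto_mult[OF tendsto_const var[folded Q_def], of "\<sigma>\<^sup>2"] by (simp add: mom(5))
  qed (use mom lindeberg in \<open>auto simp: tail_def[abs_def]\<close>)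
qed

lemma iexp_dist_le: "norm (iexp x - iexp y) \<le> \<bar>x - y\<bar>"
proof -
  have "iexp x - iexp y = iexp y * (iexp (x - y) - 1)"
    by (simp add: algebra_simps exp_add[symmetric])
  then have "norm (iexp x - iexp y) = norm (iexp (x - y) - 1)"
    by (simp only: norm_mult norm_exp_i_times mult_1)
  also have "\<dots> \<le> \<bar>x - y\<bar>"
    using iexp_approx1[of "x - y" 0] by simp
  finally show ?thesis .
qed

lemma converges_in_distribution_perturb:
  fixes Z Z' :: "nat \<Rightarrow> 'a \<Rightarrow> real ^ 'q" and N :: "(real ^ 'q) measure"
  assumes prob: "\<And>n. prob_space (M n)" "prob_space N" "sets N = sets borel"
    and Z: "\<And>n. Z n \<in> borel_measurable (M n)" and Z': "\<And>n. Z' n \<in> borel_measurable (M n)"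
    and tight: "\<And>e. 0 < e \<Longrightarrow> \<exists>R. \<forall>\<^sub>F n in sequentially. \<P>(\<omega> in M n. R < norm (Z' n \<omega>)) \<le> e"
    and char: "\<And>t. (\<lambda>n. LINT \<omega>|M n. iexp (inner t (Z' n \<omega>))) \<longlonglongrightarrow> (LINT x|N. iexp (inner t x))"
    and bad: "\<forall>\<^sub>F n in sequentially. bad n \<in> sets (M n)" "(\<lambda>n. measure (M n) (bad n)) \<longlonglongrightarrow> 0"
    and close: "\<forall>\<^sub>F n in sequentially. \<forall>\<omega> \<in> space (M n) - bad n. norm (Z n \<omega> - Z' n \<omega>) \<le> b n"
    and b: "b \<longlonglongrightarrow> 0" "\<And>n. 0 \<le> b n"
  shows "converges_in_distribution M Z N"
proof (rule converges_in_distribution_char[OF prob Z])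
  fix e :: real assume e: "0 < e"
  obtain R where R: "\<forall>\<^sub>F n in sequentially. \<P>(\<omega> in M n. R < norm (Z' n \<omega>)) \<le> e / 2"
    using tight[of "e / 2"] e by auto
  have "\<forall>\<^sub>F n in sequentially. measure (M n) (bad n) < e / 2"
    using e by (intro order_tendstoD(2)[OF bad(2)]) simp
  moreover have "\<forall>\<^sub>F n in sequentially. b n < 1"
    by (intro order_tendstoD(2)[OF b(1)]) simp
  ultimately have "\<forall>\<^sub>F n in sequentially. \<P>(\<omega> in M n. R + 1 < norm (Z n \<omega>)) \<le> e"
    using R bad(1) close
  proof eventually_elim
    case (elim n)
    interpret prob_space "M n" by (rule prob)
    have [measurable]: "Z n \<in> borel_measurable (M n)" "Z' n \<in> borel_measurable (M n)" by (rule Z Z')+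
    have "{\<omega> \<in> space (M n). R + 1 < norm (Z n \<omega>)} \<subseteq> {\<omega> \<in> space (M n). R < norm (Z' n \<omega>)} \<union> bad n"
    proof safe
      fix \<omega> assume \<omega>: "\<omega> \<in> space (M n)" "R + 1 < norm (Z n \<omega>)" "\<omega> \<notin> bad n"
      then have "norm (Z n \<omega> - Z' n \<omega>) \<le> b n" "b n < 1" using elim by blast+
      then show "R < norm (Z' n \<omega>)"
        using \<omega> norm_triangle_sub[of "Z n \<omega>" "Z' n \<omega>"] by linarith
    qed
    then have "\<P>(\<omega> in M n. R + 1 < norm (Z n \<omega>)) \<le> prob ({\<omega> \<in> space (M n). R < norm (Z' n \<omega>)} \<union> bad n)"
      using elim by (intro finite_measure_mono) auto
    also have "\<dots> \<le> \<P>(\<omega> in M n. R < norm (Z' n \<omega>)) + prob (bad n)"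
      using elim by (intro measure_Un_le) auto
    finally show ?case using elim by linarith
  qed
  then show "\<exists>R. \<forall>\<^sub>F n in sequentially. \<P>(\<omega> in M n. R < norm (Z n \<omega>)) \<le> e" by blast
next
  fix t :: "real ^ 'q"
  have "(\<lambda>n. (LINT \<omega>|M n. iexp (inner t (Z n \<omega>))) - (LINT \<omega>|M n. iexp (inner t (Z' n \<omega>)))) \<longlonglongrightarrow> 0"
  proof (rule Lim_null_comparison)
    have "(\<lambda>n. norm t * b n + 2 * measure (M n) (bad n)) \<longlonglongrightarrow> norm t * 0 + 2 * 0"
      by (intro tendsto_intros b(1) bad(2))
    then show "(\<lambda>n. norm t * b n + 2 * measure (M n) (bad n)) \<longlonglongrightarrow> 0" by simp
    show "\<forall>\<^sub>F n in sequentially. norm ((LINT \<omega>|M n. iexp (inner t (Z n \<omega>))) - (LINT \<omega>|M n. iexp (inner t (Z' n \<omega>)))) \<le>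
        norm t * b n + 2 * measure (M n) (bad n)"
      using bad(1) close
    proof eventually_elim
      case (elim n)
      interpret prob_space "M n" by (rule prob)
      have [measurable]: "Z n \<in> borel_measurable (M n)" "Z' n \<in> borel_measurable (M n)" "bad n \<in> sets (M n)"
        using Z Z' elim by auto
      have int: "integrable (M n) (\<lambda>\<omega>. iexp (inner t (Z n \<omega>)))" "integrable (M n) (\<lambda>\<omega>. iexp (inner t (Z' n \<omega>)))"
        by (auto intro!: integrable_iexp)
      show ?case
      proof -
        have "norm ((LINT \<omega>|M n. iexp (inner t (Z n \<omega>))) - (LINT \<omega>|M n. iexp (inner t (Z' n \<omega>)))) =
            norm (LINT \<omega>|M n. iexp (inner t (Z n \<omega>)) - iexp (inner t (Z' n \<omega>)))"
          using int by simp
        also have "\<dots> \<le> (LINT \<omega>|M n. norm (iexp (inner t (Z n \<omega>)) - iexp (inner t (Z' n \<omega>))))"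
          by (rule integral_norm_bound)
        also have "\<dots> \<le> (LINT \<omega>|M n. norm t * b n + 2 * indicator (bad n) \<omega>)"
        proof (rule integral_mono)
          show "integrable (M n) (\<lambda>\<omega>. norm (iexp (inner t (Z n \<omega>)) - iexp (inner t (Z' n \<omega>))))"
            using int by auto
          show "integrable (M n) (\<lambda>\<omega>. norm t * b n + 2 * indicator (bad n) \<omega>)"
            by (auto intro!: Bochner_Integration.integrable_add simp: emeasure_eq_measure)
          fix \<omega> assume \<omega>: "\<omega> \<in> space (M n)"
          show "norm (iexp (inner t (Z n \<omega>)) - iexp (inner t (Z' n \<omega>))) \<le> norm t * b n + 2 * indicator (bad n) \<omega>"
          proof (cases "\<omega> \<in> bad n")
            case True
            have "norm (iexp (inner t (Z n \<omega>)) - iexp (inner t (Z' n \<omega>))) \<le> 1 + 1"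
              by (rule order_trans[OF norm_triangle_ineq4]) simp
            then show ?thesis using True b(2)[of n] by (simp add: add_increasing)
          next
            case False
            have "norm (iexp (inner t (Z n \<omega>)) - iexp (inner t (Z' n \<omega>))) \<le> \<bar>inner t (Z n \<omega> - Z' n \<omega>)\<bar>"
              using iexp_dist_le[of "inner t (Z n \<omega>)" "inner t (Z' n \<omega>)"] by (simp add: inner_diff_right)
            also have "\<dots> \<le> norm t * norm (Z n \<omega> - Z' n \<omega>)" by (rule Cauchy_Schwarz_ineq2)
            also have "\<dots> \<le> norm t * b n" using elim \<omega> False by (intro mult_left_mono) auto
            finally show ?thesis using False by simp
          qed
        qed
        also have "\<dots> = norm t * b n + 2 * prob (bad n)"
          by (subst Bochner_Integration.integral_add) (auto simp: prob_space emeasure_eq_measure)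
        finally show ?thesis .
      qed
    qed
  qed
  from tendsto_add[OF this char[of t]]
  show "(\<lambda>n. LINT \<omega>|M n. iexp (inner t (Z n \<omega>))) \<longlonglongrightarrow> (LINT x|N. iexp (inner t x))" by simp
qed

section \<open>The exceptional event\<close>

lemma max_gt_iff:
  fixes f :: "nat \<Rightarrow> real"
  assumes "0 < n"
  shows "(MAX i\<in>{..<n}. f i) > t \<longleftrightarrow> (\<exists>i<n. f i > t)"
  by (subst Max_gr_iff) (use assms in auto)

context regression_sample
begin

text \<open>The last two thresholds exceed the expectations by a factor of order \<open>p\<close>, so that these events
  have probability \<open>O(1 / p)\<close>, whereas the product of their square roots, divided by \<open>sqrt n\<close>, is
  \<open>sqrt (p^5 / n)\<close>.\<close>

definition bad_event :: "real \<Rightarrow> real \<Rightarrow> 'a set" where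
  "bad_event \<kappa> \<gamma> =
    {\<omega> \<in> space M. (MAX i\<in>{..<n}. L2_set (X i \<omega>) {..<p}) > \<kappa>} \<union>
    {\<omega> \<in> space M. (MAX i\<in>{..<n}. \<bar>e i \<omega>\<bar>) > \<gamma>} \<union>
    {\<omega> \<in> space M. n * (real p)\<^sup>2 \<le> score_square \<omega>} \<union>
    {\<omega> \<in> space M. real p ^ 3 / n \<le> (gram_error \<omega>)\<^sup>2}"

lemma max_event_measurable:
  fixes f :: "nat \<Rightarrow> 'a \<Rightarrow> real"
  assumes "0 < n" "\<And>i. i < n \<Longrightarrow> f i \<in> borel_measurable M"
  shows "{\<omega> \<in> space M. (MAX i\<in>{..<n}. f i \<omega>) > t} \<in> events"
proof -
  have "{\<omega> \<in> space M. (MAX i\<in>{..<n}. f i \<omega>) > t} = (\<Union>i<n. {\<omega> \<in> space M. f i \<omega> > t})"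
    using assms(1) by (auto simp: max_gt_iff)
  also have "\<dots> \<in> events" using assms(2) by (intro sets.finite_UN) auto
  finally show ?thesis .
qed

lemma score_measurable: "score_square \<in> borel_measurable M"
  by (intro borel_measurable_sum borel_measurable_power borel_measurable_times
      e_measurable X_coord_measurable) auto

lemma frobenius_measurable:
  "gram_error \<in> borel_measurable M"
  unfolding frobenius_norm_def
  by (intro measurable_compose[OF _ borel_measurable_sqrt] borel_measurable_sum borel_measurable_power borel_measurable_times
      borel_measurable_diff borel_measurable_divide borel_measurable_const X_coord_measurable) auto

lemma bad_event_parts_measurable:
  assumes "0 < n"
  shows "{\<omega> \<in> space M. (MAX i\<in>{..<n}. L2_set (X i \<omega>) {..<p}) > \<kappa>} \<in> events" (is ?A)
    and "{\<omega> \<in> space M. (MAX i\<in>{..<n}. \<bar>e i \<omega>\<bar>) > \<gamma>} \<in> events" (is ?B)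
    and "{\<omega> \<in> space M. n * (real p)\<^sup>2 \<le> score_square \<omega>} \<in> events" (is ?C)
    and "{\<omega> \<in> space M. real p ^ 3 / n \<le> (gram_error \<omega>)\<^sup>2} \<in> events" (is ?D)
proof -
  show ?A
    unfolding L2_set_def
    by (intro max_event_measurable assms measurable_compose[OF _ borel_measurable_sqrt] borel_measurable_sum
        borel_measurable_power X_coord_measurable) auto
  show ?B
    by (intro max_event_measurable assms borel_measurable_abs e_measurable)
  show ?C
    using score_measurable by measurable
  show ?D
    using frobenius_measurable by measurable
qed

lemma bad_event_measurable: "0 < n \<Longrightarrow> bad_event \<kappa> \<gamma> \<in> events"
  unfolding bad_event_def by (intro sets.Un bad_event_parts_measurable)

lemma bad_event_prob:
  assumes n: "0 < n" and p: "0 < p"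
  shows "prob (bad_event \<kappa> \<gamma>) \<le>
    \<P>(\<omega> in M. (MAX i\<in>{..<n}. L2_set (X i \<omega>) {..<p}) > \<kappa>) +
    \<P>(\<omega> in M. (MAX i\<in>{..<n}. \<bar>e i \<omega>\<bar>) > \<gamma>) +
    \<sigma>\<^sup>2 * fourth_moment_sum / (real p)\<^sup>2 + fourth_moment_sum\<^sup>2 / real p ^ 3"
proof -
  let ?E1 = "{\<omega> \<in> space M. (MAX i\<in>{..<n}. L2_set (X i \<omega>) {..<p}) > \<kappa>}"
  let ?E2 = "{\<omega> \<in> space M. (MAX i\<in>{..<n}. \<bar>e i \<omega>\<bar>) > \<gamma>}"
  let ?E3 = "{\<omega> \<in> space M. n * (real p)\<^sup>2 \<le> score_square \<omega>}"
  let ?E4 = "{\<omega> \<in> space M. real p ^ 3 / n \<le> (gram_error \<omega>)\<^sup>2}"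
  note m = bad_event_parts_measurable[OF n]
  have "prob (?E1 \<union> ?E2 \<union> ?E3 \<union> ?E4) \<le> prob (?E1 \<union> ?E2 \<union> ?E3) + prob ?E4"
    using m by (intro measure_Un_le sets.Un)
  moreover have "prob (?E1 \<union> ?E2 \<union> ?E3) \<le> prob (?E1 \<union> ?E2) + prob ?E3"
    using m by (intro measure_Un_le sets.Un)
  moreover have "prob (?E1 \<union> ?E2) \<le> prob ?E1 + prob ?E2"
    using m by (intro measure_Un_le)
  moreover have "prob ?E3 \<le> \<sigma>\<^sup>2 * fourth_moment_sum / (real p)\<^sup>2"
    using score_tail[of "n * (real p)\<^sup>2"] n p by simp
  moreover have "prob ?E4 \<le> fourth_moment_sum\<^sup>2 / real p ^ 3"
    using frobenius_tail[of "real p ^ 3 / n"] n p by simp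
  ultimately show ?thesis unfolding bad_event_def by linarith
qed

lemma good_event_error:
  fixes s1 s2 :: nat and l \<kappa> \<gamma> \<alpha> c b F :: real and w a \<mu> \<beta> :: "nat \<Rightarrow> real" and Y :: "'a \<Rightarrow> nat \<Rightarrow> real"
  assumes n: "0 < n" and pos: "0 < l" "0 < \<kappa>" "2 < \<alpha>" "0 < \<gamma>" "\<alpha> * \<gamma> \<le> l" and s: "s1 + s2 \<le> n"
    and \<omega>: "\<omega> \<in> space M - bad_event \<kappa> \<gamma>"
    and Y: "\<And>i. i < n \<Longrightarrow> Y \<omega> i = \<mu> i + (\<Sum>j<p. X i \<omega> j * \<beta> j) + e i \<omega>"
    and min: "is_arg_min (\<lambda>(m, b). penalized_loss n p l (\<lambda>i. X i \<omega>) (Y \<omega>) m b) (\<lambda>_. True) (mh, bh)"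
    and large: "\<And>i. i < s1 \<Longrightarrow> 3 * l \<le> \<bar>\<mu> i\<bar>"
    and moderate: "\<And>i. s1 \<le> i \<Longrightarrow> i < s1 + s2 \<Longrightarrow> \<bar>\<mu> i\<bar> \<le> \<gamma>"
    and zero: "\<And>i. s1 + s2 \<le> i \<Longrightarrow> i < n \<Longrightarrow> \<mu> i = 0"
    and c: "0 < c" "\<And>v. c * (\<Sum>j<p. (v j)\<^sup>2) \<le> bilinear_form {..<p} cov v v"
    and w: "\<And>k. k < p \<Longrightarrow> (\<Sum>j<p. w j * cov j k) = a k"
    and b: "b = \<kappa> * (2 * s1 * l + s2 * \<gamma>) / sqrt n"
    and F: "F = sqrt (real p ^ 3 / n) + s1 * \<kappa>\<^sup>2 / n"
    and F_small: "F \<le> c / 2"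
    and radius: "(p + b) / sqrt n < c / 2 * ((1 - 2 / \<alpha>) * l / \<kappa>)"
  shows "\<bar>sqrt n * (\<Sum>j<p. a j * (bh j - \<beta> j)) - (\<Sum>i<n. e i \<omega> * (\<Sum>j<p. w j * X i \<omega> j)) / sqrt n\<bar> \<le>
    L2_set w {..<p} * (b + F * (2 / c) * (p + b))"
proof -
  define x where "x i = X i \<omega>" for i
  define \<epsilon> where "\<epsilon> i = e i \<omega>" for i
  define \<delta> where "\<delta> j = bh j - \<beta> j" for j
  define r where "r = sqrt (real n)"
  have r: "0 < r" "r * r = n" using n by (simp_all add: r_def)
  have sp: "\<omega> \<in> space M" using \<omega> by simp
  have xk: "L2_set (x i) {..<p} \<le> \<kappa>" if "i < n" for i
    using \<omega> n that by (auto simp: bad_event_def x_def max_gt_iff not_less[symmetric])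
  have e\<gamma>: "\<bar>\<epsilon> i\<bar> \<le> \<gamma>" if "i < n" for i
    using \<omega> n that by (auto simp: bad_event_def \<epsilon>_def max_gt_iff not_less[symmetric])
  have "(L2_set (\<lambda>j. \<Sum>i<n. \<epsilon> i * x i j) {..<p})\<^sup>2 \<le> (p * r)\<^sup>2"
    unfolding L2_set_power2 using \<omega> by (auto simp: bad_event_def \<epsilon>_def x_def r_def power_mult_distrib mult.commute)
  then have u: "L2_set (\<lambda>j. \<Sum>i<n. \<epsilon> i * x i j) {..<p} \<le> p * r"
    by (rule power2_le_imp_le) (use r in simp)
  have fr: "frobenius_norm {..<p} {..<p} (\<lambda>j k. (\<Sum>i<n. x i j * x i k) / n - cov j k) \<le> sqrt (real p ^ 3 / n)"
  proof (rule real_le_rsqrt)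
    show "(frobenius_norm {..<p} {..<p} (\<lambda>j k. (\<Sum>i<n. x i j * x i k) / n - cov j k))\<^sup>2 \<le> real p ^ 3 / n"
      using \<omega> by (auto simp: bad_event_def x_def)
  qed
  have eq: "(\<Sum>i<n. clip l (\<mu> i + \<epsilon> i - (\<Sum>k<p. x i k * \<delta> k)) * x i j) = 0" if "j < p" for j
  proof -
    have res: "\<mu> i + \<epsilon> i - (\<Sum>k<p. x i k * \<delta> k) = Y \<omega> i - (\<Sum>k<p. X i \<omega> k * bh k)" if "i < n" for i
      using Y[OF that] by (simp add: \<epsilon>_def x_def \<delta>_def right_diff_distrib sum_subtractf)
    have "(\<Sum>i<n. clip l (\<mu> i + \<epsilon> i - (\<Sum>k<p. x i k * \<delta> k)) * x i j) =
        (\<Sum>i<n. clip l (Y \<omega> i - (\<Sum>k<p. X i \<omega> k * bh k)) * X i \<omega> j)"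
    proof (rule sum.cong[OF refl])
      fix i assume "i \<in> {..<n}"
      then have i: "i < n" by simp
      show "clip l (\<mu> i + \<epsilon> i - (\<Sum>k<p. x i k * \<delta> k)) * x i j =
          clip l (Y \<omega> i - (\<Sum>k<p. X i \<omega> k * bh k)) * X i \<omega> j"
        unfolding res[OF i] unfolding x_def ..
    qed
    also have "\<dots> = 0" by (rule penalized_minimizer_stationary[OF pos(1) min that])
    finally show ?thesis .
  qed
  have nF: "n * sqrt (real p ^ 3 / n) + s1 * \<kappa>\<^sup>2 = n * F"
    using n by (simp add: F distrib_left)
  have rb: "\<kappa> * (2 * s1 * l + s2 * \<gamma>) = r * b"
    using r by (simp add: b r_def)
  have F_small': "n * sqrt (real p ^ 3 / n) + s1 * \<kappa>\<^sup>2 \<le> n * c / 2"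
    unfolding nF using mult_left_mono[OF F_small, of n] by simp
  have R: "p * r + r * b < n * c / 2 * ((1 - 2 / \<alpha>) * l / \<kappa>)"
  proof -
    have "n * ((p + b) / r) < n * (c / 2 * ((1 - 2 / \<alpha>) * l / \<kappa>))"
      using radius n unfolding r_def by (intro mult_strict_left_mono) auto
    moreover have "n * ((p + b) / r) = p * r + r * b"
      unfolding r(2)[symmetric] using r(1) by (simp add: field_simps)
    ultimately show ?thesis by simp
  qed
  have main: "\<bar>n * (\<Sum>j<p. a j * \<delta> j) - (\<Sum>i<n. \<epsilon> i * (\<Sum>j<p. w j * x i j))\<bar> \<le>
    L2_set w {..<p} * (r * b + (n * F) * (2 / (n * c)) * (p * r + r * b))"
    using clipped_regression_error[OF pos(1-5) s n eq e\<gamma> xk large moderate zero c fr F_small' w rb[symmetric] u R]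
    unfolding nF .
  have "\<bar>r * (\<Sum>j<p. a j * \<delta> j) - (\<Sum>i<n. \<epsilon> i * (\<Sum>j<p. w j * x i j)) / r\<bar> =
      \<bar>n * (\<Sum>j<p. a j * \<delta> j) - (\<Sum>i<n. \<epsilon> i * (\<Sum>j<p. w j * x i j))\<bar> / r"
  proof -
    have "r * (\<Sum>j<p. a j * \<delta> j) - (\<Sum>i<n. \<epsilon> i * (\<Sum>j<p. w j * x i j)) / r =
        (n * (\<Sum>j<p. a j * \<delta> j) - (\<Sum>i<n. \<epsilon> i * (\<Sum>j<p. w j * x i j))) / r"
      unfolding r(2)[symmetric] using r(1) by (simp add: field_simps)
    then show ?thesis using r(1) by simp
  qed
  also have "\<dots> \<le> L2_set w {..<p} * (r * b + (n * F) * (2 / (n * c)) * (p * r + r * b)) / r"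
    using main r(1) by (simp add: divide_right_mono)
  also have "\<dots> = L2_set w {..<p} * (b + F * (2 / c) * (p + b))"
  proof -
    have "r * b + (n * F) * (2 / (n * c)) * (p * r + r * b) = r * (b + F * (2 / c) * (p + b))"
      using n c(1) by (simp add: field_simps)
    then show ?thesis using r(1) by simp
  qed
  finally show ?thesis by (simp add: r_def \<delta>_def \<epsilon>_def x_def)
qed

end

lemma borel_measurable_vec_lambda:
  fixes f :: "'q::finite \<Rightarrow> 'a \<Rightarrow> real"
  assumes "\<And>r. f r \<in> borel_measurable P"
  shows "(\<lambda>x. \<chi> r. f r x) \<in> borel_measurable P"
proof (rule borel_measurable_euclidean_space[THEN iffD2], intro ballI)
  fix b :: "real ^ 'q" assume "b \<in> Basis"
  then obtain r where b: "b = axis r 1" by (auto simp: Basis_vec_def)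
  have "(\<lambda>x. inner (\<chi> r. f r x) b) = f r"
    by (simp add: b inner_axis fun_eq_iff)
  then show "(\<lambda>x. inner (\<chi> r. f r x) b) \<in> borel_measurable P"
    using assms[of r] by (simp only:)
qed

section \<open>The limit theorem\<close>

theorem theorem4p3:
  fixes M :: "nat \<Rightarrow> 'a measure"
    and d s1 s2 :: "nat \<Rightarrow> nat"
    and X :: "nat \<Rightarrow> nat \<Rightarrow> 'a \<Rightarrow> nat \<Rightarrow> real"
    and eps :: "nat \<Rightarrow> nat \<Rightarrow> 'a \<Rightarrow> real"
    and Y :: "nat \<Rightarrow> 'a \<Rightarrow> nat \<Rightarrow> real"
    and LX :: "nat \<Rightarrow> (nat \<Rightarrow> real) measure"
    and Leps :: "real measure"
    and \<mu> \<beta> :: "nat \<Rightarrow> nat \<Rightarrow> real"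
    and \<mu>hat \<beta>hat :: "nat \<Rightarrow> 'a \<Rightarrow> nat \<Rightarrow> real"
    and \<kappa> \<gamma> lam :: "nat \<Rightarrow> real"
    and \<sigma> \<alpha> :: real
    and A :: "nat \<Rightarrow> 'q::finite \<Rightarrow> nat \<Rightarrow> real"
    and GX :: "real ^ 'q ^ 'q"
    and \<Sigma> :: "nat \<Rightarrow> real mat"
  assumes Sigma: "\<And>n. \<Sigma> n = covariance_matrix (LX n) (d n)"
    and prob: "\<And>n. prob_space (M n)"
    and d_pos: "\<And>n. 0 < d n"
    and d_top: "filterlim d at_top at_top"
    and d_small: "(\<lambda>n. real (d n)) \<in> o(\<lambda>n. real n)"
    \<comment> \<open>law of \<open>X\<^sub>0\<close> (depending on n) and law of \<open>\<epsilon>\<^sub>0\<close> (not depending on n)\<close>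
    and LX: "\<And>n. prob_space (LX n)" "\<And>n. sets (LX n) = sets (Rvec (d n))"
    and LX_mean: "\<And>n j. j < d n \<Longrightarrow> integrable (LX n) (\<lambda>x. x j) \<and> (LINT x|LX n. x j) = 0"
    and LX_square: "\<And>n j. j < d n \<Longrightarrow> integrable (LX n) (\<lambda>x. (x j)\<^sup>2)"
    and Sigma_pos_def: "\<And>n. pos_def_mat (\<Sigma> n)"
    and Leps: "prob_space Leps" "sets Leps = sets borel"
    and Leps_mean: "integrable Leps (\<lambda>x. x)" "(LINT x|Leps. x) = 0"
    and Leps_var: "0 < \<sigma>" "integrable Leps (\<lambda>x. x\<^sup>2)" "(LINT x|Leps. x\<^sup>2) = \<sigma>\<^sup>2"
    \<comment> \<open>the data\<close>
    and X_indep: "\<And>n. prob_space.indep_vars (M n) (\<lambda>_. Rvec (d n)) (X n) {..<n}"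
    and X_law: "\<And>n i. i < n \<Longrightarrow> distr (M n) (Rvec (d n)) (X n i) = LX n"
    and eps_indep: "\<And>n. prob_space.indep_vars (M n) (\<lambda>_. borel) (eps n) {..<n}"
    and eps_law: "\<And>n i. i < n \<Longrightarrow> distr (M n) borel (eps n i) = Leps"
    and X_eps_indep: "\<And>n. independent_elements (M n)
          (PiM {..<n} (\<lambda>_. Rvec (d n))) (\<lambda>\<omega>. \<lambda>i\<in>{..<n}. X n i \<omega>)
          (PiM {..<n} (\<lambda>_. borel)) (\<lambda>\<omega>. \<lambda>i\<in>{..<n}. eps n i \<omega>)"
    and Y: "\<And>n \<omega> i. \<omega> \<in> space (M n) \<Longrightarrow> i < n \<Longrightarrow>
          Y n \<omega> i = \<mu> n i + (\<Sum>j<d n. X n i \<omega> j * \<beta> n j) + eps n i \<omega>"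
    \<comment> \<open>Assumption (A)\<close>
    and kappa: "\<And>n. 0 < \<kappa> n" "\<kappa> \<in> o(\<lambda>n. sqrt (real n))"
    and gamma: "\<And>n. 0 < \<gamma> n" "\<gamma> \<in> o(\<lambda>n. sqrt (real n))"
    and A_X: "(\<lambda>n. measure (M n) {\<omega> \<in> space (M n).
          (MAX i\<in>{..<n}. L2_set (X n i \<omega>) {..<d n}) > \<kappa> n}) \<longlonglongrightarrow> 0"
    and A_eps: "(\<lambda>n. measure (M n) {\<omega> \<in> space (M n).
          (MAX i\<in>{..<n}. \<bar>eps n i \<omega>\<bar>) > \<gamma> n}) \<longlonglongrightarrow> 0"
    \<comment> \<open>incidental parameters\<close>
    and s_le: "\<And>n. s1 n + s2 n \<le> n"
    and s_small: "(\<lambda>n. real (s1 n + s2 n)) \<in> o(\<lambda>n. real n)"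
    and mu_large: "(\<lambda>n. ereal (max (\<kappa> n) (\<gamma> n)) / mu_star (\<mu> n) (s1 n)) \<longlonglongrightarrow> 0"
    and mu_moderate: "\<And>n i. s1 n \<le> i \<Longrightarrow> i < s1 n + s2 n \<Longrightarrow> 0 < \<bar>\<mu> n i\<bar> \<and> \<bar>\<mu> n i\<bar> \<le> \<gamma> n"
    and mu_zero: "\<And>n i. s1 n + s2 n \<le> i \<Longrightarrow> i < n \<Longrightarrow> \<mu> n i = 0"
    \<comment> \<open>Assumption (B')\<close>
    and lam_pos: "\<And>n. 0 < lam n"
    and B_kappa: "(\<lambda>n. sqrt (real (d n)) * \<kappa> n) \<in> o(lam)"
    and B_gamma: "2 < \<alpha>" "\<And>n. \<alpha> * \<gamma> n \<le> lam n"
    and B_mu: "(\<lambda>n. ereal (lam n) / mu_star (\<mu> n) (s1 n)) \<longlonglongrightarrow> 0"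
    \<comment> \<open>Assumptions (D'), (D''), (E)\<close>
    and D1: "\<exists>c>0. \<forall>n. c \<le> lambda_min (\<Sigma> n)"
    and D2: "Bseq (\<lambda>n. frobenius_norm {..<d n} {..<d n} (\<lambda>j k. \<Sigma> n $$ (j, k)) / sqrt (real (d n)))"
    and E: "\<And>n j. j < d n \<Longrightarrow> integrable (LX n) (\<lambda>x. (x j)^4)"
           "Bseq (\<lambda>n. (\<Sum>j<d n. sqrt (LINT x|LX n. (x j)^4)) / real (d n))"
    \<comment> \<open>Assumption (F); the norm of \<open>real ^ 'q ^ 'q\<close> is the Frobenius norm\<close>
    and F_A: "Bseq (\<lambda>n. frobenius_norm UNIV {..<d n} (A n))"
    and F_G: "Bseq (\<lambda>n. lambda_max (gram (d n) (A n)))"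
    and F_GX: "Finite_Cartesian_Product.transpose GX = GX" "(\<lambda>n. norm (gram_inv (d n) (A n) (\<Sigma> n) - GX)) \<longlonglongrightarrow> 0"
    \<comment> \<open>Assumption (G)\<close>
    and G_max: "\<And>n. 0 < sqrt (MAX j\<in>{..<d n}. prob_space.variance (LX n) (\<lambda>x. x j))"
               "Bseq (\<lambda>n. sqrt (MAX j\<in>{..<d n}. prob_space.variance (LX n) (\<lambda>x. x j)))"
    and G_third: "\<And>n j. j < d n \<Longrightarrow> integrable (LX n) (\<lambda>x. \<bar>x j\<bar>^3)"
                 "Bseq (\<lambda>n. MAX j\<in>{..<d n}. (LINT x|LX n. \<bar>x j\<bar>^3))"
    and G_min: "\<exists>c>0. \<forall>n. c \<le> sqrt (MIN j\<in>{..<d n}. prob_space.variance (LX n) (\<lambda>x. x j))"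
    \<comment> \<open>the estimator\<close>
    and hat_measurable: "\<And>n. \<mu>hat n \<in> measurable (M n) (Rvec n)"
                        "\<And>n. \<beta>hat n \<in> measurable (M n) (Rvec (d n))"
    and hat_min: "\<And>n \<omega>. \<omega> \<in> space (M n) \<Longrightarrow>
          is_arg_min (\<lambda>(m, b). penalized_loss n (d n) (lam n) (\<lambda>i. X n i \<omega>) (Y n \<omega>) m b)
            (\<lambda>_. True) (\<mu>hat n \<omega>, \<beta>hat n \<omega>)"
    \<comment> \<open>growth conditions\<close>
    and d_growth: "(\<lambda>n. real (d n) ^ 5 * ln (real (d n))) \<in> o(\<lambda>n. real n)"
    and s1_growth: "(\<lambda>n. real (s1 n)) \<in> o(\<lambda>n. sqrt (real n) / (lam n * sqrt (real (d n)) * \<kappa> n))"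
    and s2_growth: "(\<lambda>n. real (s2 n)) \<in> o(\<lambda>n. sqrt (real n) / (sqrt (real (d n)) * \<kappa> n * \<gamma> n))"
  shows "\<exists>N. is_multivariate_normal 0 (\<sigma>\<^sup>2 *\<^sub>R GX) N \<and>
    converges_in_distribution M
      (\<lambda>n \<omega>. sqrt (real n) *\<^sub>R rect_mult_vec (d n) (A n) (\<lambda>j. \<beta>hat n \<omega> j - \<beta> n j)) N"
proof -
  have rs: "regression_sample (M n) n (d n) (X n) (eps n) (LX n) Leps \<sigma>" for n
    by (intro regression_sample.intro regression_sample_axioms.intro prob LX conjunct2[OF LX_mean] E(1)
        Leps Leps_mean(2) Leps_var(2,3) X_indep X_law eps_indep eps_law X_eps_indep)
  define S where "S n = regression_sample.cov (LX n)" for n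
  have S: "S n j k = \<Sigma> n $$ (j, k)" if "j < d n" "k < d n" for n j k
    using LX_mean[OF that(1)] LX_mean[OF that(2)] that
    by (simp add: S_def regression_sample.cov_def[OF rs] Sigma covariance_matrix_def)
  have carrier: "\<Sigma> n \<in> carrier_mat (d n) (d n)" for n
    by (simp add: Sigma covariance_matrix_def)
  have sym: "transpose_mat (\<Sigma> n) = \<Sigma> n" for n
    using Sigma_pos_def by (simp add: pos_def_mat_def)
  have S_sym: "S n j k = S n k j" for n j k
    by (simp add: S_def regression_sample.cov_def[OF rs] mult.commute)
  obtain c where c: "0 < c" "\<And>n. c \<le> lambda_min (\<Sigma> n)" using D1 by blast
  have quad_ge: "c * (\<Sum>j<d n. (v j)\<^sup>2) \<le> bilinear_form {..<d n} (S n) v v" for n v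
  proof -
    have "c * (\<Sum>j<d n. (v j)\<^sup>2) \<le> lambda_min (\<Sigma> n) * (\<Sum>j<d n. (v j)\<^sup>2)"
      by (intro mult_right_mono c sum_nonneg) simp
    also have "\<dots> \<le> (\<Sum>j<d n. \<Sum>k<d n. v j * \<Sigma> n $$ (j, k) * v k)"
      by (rule lambda_min_le_quadratic_form[OF carrier d_pos sym])
    finally show ?thesis by (simp add: S)
  qed
  obtain C :: real where C: "0 < C" "\<And>n. regression_sample.fourth_moment_sum (d n) (LX n) \<le> C * d n"
  proof -
    obtain K where K: "0 < K" "\<And>n. norm ((\<Sum>j<d n. sqrt (LINT x|LX n. (x j)^4)) / real (d n)) \<le> K"
      using E(2) unfolding Bseq_def by blast
    show ?thesis
    proof (rule that[OF K(1)])
      fix n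
      have "(\<Sum>j<d n. sqrt (LINT x|LX n. (x j)^4)) / real (d n) \<le> K"
        using K(2)[of n] by (simp only: real_norm_def abs_le_iff)
      then show "regression_sample.fourth_moment_sum (d n) (LX n) \<le> K * d n"
        using d_pos[of n] by (simp add: regression_sample.fourth_moment_sum_def[OF rs] divide_le_eq)
    qed
  qed
  have m4_nonneg: "0 \<le> regression_sample.fourth_moment_sum (d n) (LX n)" for n
    by (simp add: regression_sample.fourth_moment_sum_def[OF rs] sum_nonneg)
  obtain CA :: real where CA: "0 < CA" "\<And>n. frobenius_norm UNIV {..<d n} (A n) \<le> CA"
  proof -
    obtain K where K: "0 < K" "\<And>n. norm (frobenius_norm UNIV {..<d n} (A n)) \<le> K"
      using F_A unfolding Bseq_def by blast
    show ?thesis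
      using K(2) by (intro that[OF K(1)]) (simp add: abs_le_iff)
  qed
  have A_le: "L2_set (A n r) {..<d n} \<le> CA" for n r
  proof -
    have "(\<Sum>j<d n. (A n r j)\<^sup>2) \<le> (\<Sum>r\<in>UNIV. \<Sum>j<d n. (A n r j)\<^sup>2)"
      by (rule member_le_sum) (auto intro: sum_nonneg)
    then have "L2_set (A n r) {..<d n} \<le> frobenius_norm UNIV {..<d n} (A n)"
      by (simp add: L2_set_def frobenius_norm_def)
    then show ?thesis using CA(2)[of n] by linarith
  qed
  define w where "w n r j = (\<Sum>k<d n. the (mat_inverse (\<Sigma> n)) $$ (j, k) * A n r k)" for n r j
  have Sw: "(\<Sum>k<d n. S n j k * w n r k) = A n r j" if "j < d n" for n r j
  proof -
    obtain B where B: "mat_inverse (\<Sigma> n) = Some B" "B \<in> carrier_mat (d n) (d n)" "\<Sigma> n * B = 1\<^sub>m (d n)"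
      using pos_def_mat_inverse[OF carrier Sigma_pos_def] by metis
    show ?thesis
      using sum_mat_mult_inverse[OF carrier B(2,3) that, of "A n r"] that by (simp add: S w_def B(1))
  qed
  have wS: "(\<Sum>j<d n. w n r j * S n j k) = A n r k" if "k < d n" for n r k
    using Sw[OF that, of r] by (simp add: S_sym[of n k] mult.commute)
  have gram: "bilinear_form {..<d n} (S n) (w n r) (w n s) = gram_inv (d n) (A n) (\<Sigma> n) $ r $ s" for n r s
  proof -
    have "bilinear_form {..<d n} (S n) (w n r) (w n s) = (\<Sum>k<d n. (\<Sum>j<d n. w n r j * S n j k) * w n s k)"
      unfolding sum_distrib_right by (rule sum.swap)
    also have "\<dots> = (\<Sum>k<d n. A n r k * w n s k)" by (simp add: wS)
    finally show ?thesis by (simp add: gram_inv_def w_def sum_distrib_left mult.assoc)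
  qed
  define Cw where "Cw = CA / c"
  have Cw: "0 < Cw" using CA c by (simp add: Cw_def)
  have w_quad: "bilinear_form {..<d n} (S n) (w n r) (w n r) \<le> CA * L2_set (w n r) {..<d n}" for n r
  proof -
    have "bilinear_form {..<d n} (S n) (w n r) (w n r) = (\<Sum>k<d n. (\<Sum>j<d n. w n r j * S n j k) * w n r k)"
      unfolding sum_distrib_right by (rule sum.swap)
    also have "\<dots> = (\<Sum>k<d n. A n r k * w n r k)" by (simp add: wS)
    also have "\<dots> \<le> L2_set (A n r) {..<d n} * L2_set (w n r) {..<d n}"
      using L2_Cauchy_Schwarz[of "A n r" "w n r" "{..<d n}"] by linarith
    also have "\<dots> \<le> CA * L2_set (w n r) {..<d n}"
      by (intro mult_right_mono A_le L2_set_nonneg)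
    finally show ?thesis .
  qed
  have w_le: "L2_set (w n r) {..<d n} \<le> Cw" for n r
  proof -
    define N where "N = L2_set (w n r) {..<d n}"
    have N0: "0 \<le> N" by (simp add: N_def L2_set_nonneg)
    have "c * N\<^sup>2 \<le> CA * N"
      unfolding N_def L2_set_power2 using quad_ge[where n=n and v="w n r"] w_quad[where n=n and r=r] by linarith
    then have "N * (c * N) \<le> N * CA" by (simp add: power2_eq_square ac_simps)
    then have "c * N \<le> CA"
      using N0 CA by (cases "N = 0") (auto simp: mult_le_cancel_left)
    then show ?thesis using c by (simp add: Cw_def N_def field_simps)
  qed
  define Gn where "Gn n = gram_inv (d n) (A n) (\<Sigma> n)" for n
  have Gn: "Gn \<longlonglongrightarrow> GX"
    using F_GX(2) unfolding Gn_def by (simp add: tendsto_norm_zero_iff LIM_zero_iff)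
  define wt where "wt n t j = (\<Sum>r\<in>UNIV. t $ r * w n r j)" for n and t :: "real ^ 'q" and j
  have wt_quad: "bilinear_form {..<d n} (S n) (wt n t) (wt n t) = inner t (Gn n *v t)" for n t
  proof -
    have expand: "wt n t j * S n j k * wt n t k = (\<Sum>r\<in>UNIV. \<Sum>s\<in>UNIV. t $ r * t $ s * (w n r j * S n j k * w n s k))" for j k
    proof -
      have "wt n t j * S n j k * wt n t k = (\<Sum>r\<in>UNIV. \<Sum>s\<in>UNIV. t $ r * w n r j * (t $ s * w n s k)) * S n j k"
        unfolding wt_def sum_product[symmetric] by (simp only: ac_simps)
      also have "\<dots> = (\<Sum>r\<in>UNIV. \<Sum>s\<in>UNIV. t $ r * t $ s * (w n r j * S n j k * w n s k))"
        unfolding sum_distrib_right by (intro sum.cong refl) (simp only: ac_simps)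
      finally show ?thesis .
    qed
    let ?f = "\<lambda>r s j k. t $ r * t $ s * (w n r j * S n j k * w n s k)"
    from expand have "bilinear_form {..<d n} (S n) (wt n t) (wt n t) =
        (\<Sum>j<d n. \<Sum>k<d n. \<Sum>r\<in>UNIV. \<Sum>s\<in>UNIV. ?f r s j k)" by simp
    also have "\<dots> = (\<Sum>j<d n. \<Sum>r\<in>UNIV. \<Sum>k<d n. \<Sum>s\<in>UNIV. ?f r s j k)"
      by (intro sum.cong refl sum.swap)
    also have "\<dots> = (\<Sum>r\<in>UNIV. \<Sum>j<d n. \<Sum>k<d n. \<Sum>s\<in>UNIV. ?f r s j k)"
      by (rule sum.swap)
    also have "\<dots> = (\<Sum>r\<in>UNIV. \<Sum>j<d n. \<Sum>s\<in>UNIV. \<Sum>k<d n. ?f r s j k)"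
      by (intro sum.cong refl sum.swap)
    also have "\<dots> = (\<Sum>r\<in>UNIV. \<Sum>s\<in>UNIV. \<Sum>j<d n. \<Sum>k<d n. ?f r s j k)"
      by (intro sum.cong refl sum.swap)
    also have "\<dots> = (\<Sum>r\<in>UNIV. \<Sum>s\<in>UNIV. t $ r * t $ s * Gn n $ r $ s)"
      by (simp only: Gn_def gram sum_distrib_left[symmetric])
    finally show ?thesis
      by (simp add: inner_vec_def matrix_vector_mult_def sum_distrib_left ac_simps)
  qed
  have quad_lim: "(\<lambda>n. inner t (Gn n *v t)) \<longlonglongrightarrow> inner t (GX *v t)" for t
  proof -
    have "(\<lambda>n. \<Sum>r\<in>UNIV. t $ r * (\<Sum>s\<in>UNIV. Gn n $ r $ s * t $ s)) \<longlonglongrightarrow>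
        (\<Sum>r\<in>UNIV. t $ r * (\<Sum>s\<in>UNIV. GX $ r $ s * t $ s))"
      by (intro tendsto_intros Gn)
    then show ?thesis by (simp add: inner_vec_def matrix_vector_mult_def)
  qed
  have psd: "0 \<le> inner t (GX *v t)" for t
  proof (rule LIMSEQ_le_const[OF quad_lim])
    have "0 \<le> inner t (Gn n *v t)" for n
    proof -
      have "0 \<le> c * (\<Sum>j<d n. (wt n t j)\<^sup>2)" using c by (simp add: sum_nonneg)
      then show ?thesis using quad_ge[where n=n and v="wt n t"] by (simp add: wt_quad)
    qed
    then show "\<exists>N. \<forall>n\<ge>N. 0 \<le> inner t (Gn n *v t)" by blast
  qed
  have GX_scaled: "inner t ((\<sigma>\<^sup>2 *\<^sub>R GX) *v t) = \<sigma>\<^sup>2 * inner t (GX *v t)" for t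
    by (simp add: scaleR_matrix_vector_assoc[symmetric])
  obtain N where N: "is_multivariate_normal 0 (\<sigma>\<^sup>2 *\<^sub>R GX) N"
    "\<And>t. (LINT x|N. iexp (inner t x)) = complex_of_real (exp (- (\<sigma>\<^sup>2 * inner t (GX *v t)) / 2))"
  proof -
    have "Finite_Cartesian_Product.transpose (\<sigma>\<^sup>2 *\<^sub>R GX) = \<sigma>\<^sup>2 *\<^sub>R GX"
      using F_GX(1) by (simp add: transpose_scalar)
    from multivariate_normal_exists[OF this] that show ?thesis
      using psd by (auto simp: GX_scaled)
  qed
  define Z where "Z n \<omega> = sqrt (real n) *\<^sub>R rect_mult_vec (d n) (A n) (\<lambda>j. \<beta>hat n \<omega> j - \<beta> n j)" for n \<omega>
  define Z' :: "nat \<Rightarrow> 'a \<Rightarrow> real ^ 'q" where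
    "Z' n \<omega> = (\<chi> r. (\<Sum>i<n. eps n i \<omega> * (\<Sum>j<d n. w n r j * X n i \<omega> j)) / sqrt n)" for n \<omega>
  have Zm: "Z n \<in> borel_measurable (M n)" for n
  proof -
    have "(\<lambda>\<omega>. \<beta>hat n \<omega> j) \<in> borel_measurable (M n)" if "j < d n" for j
      using measurable_compose[OF hat_measurable(2) measurable_component_singleton] that by simp
    then show ?thesis
      unfolding Z_def rect_mult_vec_def
      by (intro borel_measurable_scaleR borel_measurable_const borel_measurable_vec_lambda
          borel_measurable_sum borel_measurable_times borel_measurable_diff) auto
  qed
  have Z'c: "(\<lambda>\<omega>. (\<Sum>i<n. eps n i \<omega> * (\<Sum>j<d n. w n r j * X n i \<omega> j))) \<in> borel_measurable (M n)" for n r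
    using regression_sample.e_measurable[OF rs] regression_sample.X_coord_measurable[OF rs]
    by (intro borel_measurable_sum borel_measurable_times borel_measurable_const) auto
  have Z'm: "Z' n \<in> borel_measurable (M n)" for n
    unfolding Z'_def by (intro borel_measurable_vec_lambda borel_measurable_divide Z'c borel_measurable_const)
  have inner_Z': "inner t (Z' n \<omega>) = (\<Sum>i<n. eps n i \<omega> * (\<Sum>j<d n. wt n t j * X n i \<omega> j)) / sqrt (real n)" for t n \<omega>
  proof -
    have "(\<Sum>j<d n. wt n t j * X n i \<omega> j) = (\<Sum>r\<in>UNIV. t $ r * (\<Sum>j<d n. w n r j * X n i \<omega> j))" for i
      unfolding wt_def sum_distrib_left sum_distrib_right by (subst sum.swap) (simp add: mult.assoc)
    then have "(\<Sum>i<n. eps n i \<omega> * (\<Sum>j<d n. wt n t j * X n i \<omega> j)) =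
        (\<Sum>i<n. \<Sum>r\<in>UNIV. t $ r * (eps n i \<omega> * (\<Sum>j<d n. w n r j * X n i \<omega> j)))"
      by (simp add: sum_distrib_left mult.left_commute)
    also have "\<dots> = (\<Sum>r\<in>UNIV. t $ r * (\<Sum>i<n. eps n i \<omega> * (\<Sum>j<d n. w n r j * X n i \<omega> j)))"
      by (subst sum.swap) (simp add: sum_distrib_left)
    finally show ?thesis
      by (simp add: inner_vec_def Z'_def sum_divide_distrib[where A="UNIV :: 'q set"])
  qed
  have d1: "1 \<le> real (d n)" for n using d_pos[of n] by linarith
  have d5: "(\<lambda>n. real (d n) ^ 5 / real n) \<longlonglongrightarrow> 0"
  proof (rule Lim_null_comparison)
    show "(\<lambda>n. real (d n) ^ 5 * ln (real (d n)) / real n) \<longlonglongrightarrow> 0"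
      using smalloD_tendsto[OF d_growth] .
    have "\<forall>\<^sub>F n in sequentially. 3 \<le> d n"
      using d_top by (simp add: filterlim_at_top)
    then show "\<forall>\<^sub>F n in sequentially. norm (real (d n) ^ 5 / real n) \<le> real (d n) ^ 5 * ln (real (d n)) / real n"
    proof eventually_elim
      case (elim n)
      have "exp 1 \<le> real (d n)" using exp_le elim by linarith
      then have "1 \<le> ln (real (d n))" using d1[of n] by (simp add: ln_ge_iff)
      then have "real (d n) ^ 5 * 1 \<le> real (d n) ^ 5 * ln (real (d n))"
        by (intro mult_left_mono) auto
      then show ?case by (simp add: divide_right_mono)
    qed
  qed
  have d2: "(\<lambda>n. (real (d n))\<^sup>2 / real n) \<longlonglongrightarrow> 0"
  proof (rule Lim_null_comparison[OF _ d5])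
    have "(real (d n))\<^sup>2 / real n \<le> real (d n) ^ 5 / real n" for n
      using d1[of n] by (intro divide_right_mono power_increasing) auto
    then show "\<forall>\<^sub>F n in sequentially. norm ((real (d n))\<^sup>2 / real n) \<le> real (d n) ^ 5 / real n"
      by simp
  qed
  define b where "b n = \<kappa> n * (2 * s1 n * lam n + s2 n * \<gamma> n) / sqrt (real n)" for n
  define q1 where "q1 n = s1 n * (lam n * sqrt (d n) * \<kappa> n) / sqrt (real n)" for n
  define q2 where "q2 n = s2 n * (sqrt (d n) * \<kappa> n * \<gamma> n) / sqrt (real n)" for n
  have q1: "q1 \<longlonglongrightarrow> 0" unfolding q1_def using smalloD_tendsto[OF s1_growth] by simp
  have q2: "q2 \<longlonglongrightarrow> 0" unfolding q2_def using smalloD_tendsto[OF s2_growth] by simp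
  have pos: "0 < \<kappa> n" "0 < \<gamma> n" "0 < lam n" for n using kappa gamma lam_pos by auto
  have b0: "0 \<le> b n" for n
    using pos[of n] by (simp add: b_def)
  have b_le: "b n \<le> 2 * q1 n + q2 n" for n
  proof -
    have "b n = 2 * (s1 n * (lam n * 1 * \<kappa> n) / sqrt (real n)) + s2 n * (1 * \<kappa> n * \<gamma> n) / sqrt (real n)"
      unfolding b_def by (simp add: field_simps add_divide_distrib)
    also have "\<dots> \<le> 2 * q1 n + q2 n"
      unfolding q1_def q2_def using pos[of n] d1[of n]
      by (intro add_mono mult_left_mono divide_right_mono mult_right_mono) auto
    finally show ?thesis .
  qed
  have b: "b \<longlonglongrightarrow> 0"
  proof (rule Lim_null_comparison)
    have "(\<lambda>n. 2 * q1 n + q2 n) \<longlonglongrightarrow> 2 * 0 + 0" by (intro tendsto_intros q1 q2)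
    then show "(\<lambda>n. 2 * q1 n + q2 n) \<longlonglongrightarrow> 0" by simp
  qed (use b_le b0 in \<open>auto intro!: always_eventually\<close>)
  have lam_ge: "\<forall>\<^sub>F n in sequentially. sqrt (d n) * \<kappa> n \<le> lam n"
    using landau_o.smallD[OF B_kappa, of 1] pos by (simp add: abs_mult less_imp_le)
  have head: "(\<lambda>n. s1 n * (\<kappa> n)\<^sup>2 / real n * d n) \<longlonglongrightarrow> 0"
  proof (rule Lim_null_comparison[OF _ q1])
    show "\<forall>\<^sub>F n in sequentially. norm (s1 n * (\<kappa> n)\<^sup>2 / real n * d n) \<le> q1 n"
      using lam_ge eventually_gt_at_top[of 0]
    proof eventually_elim
      case (elim n)
      have "s1 n * (\<kappa> n)\<^sup>2 * d n = s1 n * ((sqrt (d n) * \<kappa> n) * sqrt (d n) * \<kappa> n)"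
        by (simp add: power2_eq_square)
      also have "\<dots> \<le> s1 n * (lam n * sqrt (d n) * \<kappa> n)"
        using elim pos[of n] by (intro mult_left_mono mult_right_mono) auto
      finally have le: "s1 n * (\<kappa> n)\<^sup>2 * d n \<le> s1 n * (lam n * sqrt (d n) * \<kappa> n)" .
      have "sqrt (real n) \<le> real n"
        using elim by (simp add: real_le_lsqrt power2_eq_square)
      then have "s1 n * (\<kappa> n)\<^sup>2 * d n / real n \<le> s1 n * (lam n * sqrt (d n) * \<kappa> n) / sqrt (real n)"
        using le elim pos[of n] by (intro frac_le) auto
      then show ?case by (simp add: q1_def)
    qed
  qed
  define F where "F n = sqrt (real (d n) ^ 3 / real n) + s1 n * (\<kappa> n)\<^sup>2 / real n" for n
  have F0: "0 \<le> F n" for n by (simp add: F_def)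
  have Fd: "(\<lambda>n. F n * d n) \<longlonglongrightarrow> 0"
  proof -
    have "(\<lambda>n. sqrt (real (d n) ^ 5 / real n) + s1 n * (\<kappa> n)\<^sup>2 / real n * d n) \<longlonglongrightarrow> sqrt 0 + 0"
      by (intro tendsto_intros d5 head)
    moreover have "F n * d n = sqrt (real (d n) ^ 5 / real n) + s1 n * (\<kappa> n)\<^sup>2 / real n * d n" for n
    proof -
      have "sqrt (real (d n) ^ 3 / real n) * sqrt ((real (d n))\<^sup>2) = sqrt (real (d n) ^ 5 / real n)"
        unfolding real_sqrt_mult[symmetric] by (simp add: power_add[symmetric])
      then show ?thesis by (simp add: F_def distrib_right)
    qed
    ultimately show ?thesis by simp
  qed
  have F: "F \<longlonglongrightarrow> 0"
  proof (rule Lim_null_comparison[OF _ Fd])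
    have "F n * 1 \<le> F n * d n" for n using F0 d1 by (intro mult_left_mono) auto
    then show "\<forall>\<^sub>F n in sequentially. norm (F n) \<le> F n * d n" using F0 by simp
  qed
  define err where "err n = Cw * (b n + F n * (2 / c) * (d n + b n))" for n
  have err0: "0 \<le> err n" for n using Cw b0[of n] F0[of n] c by (simp add: err_def)
  have err: "err \<longlonglongrightarrow> 0"
  proof -
    have "(\<lambda>n. Cw * (b n + 2 / c * (F n * d n) + F n * (2 / c) * b n)) \<longlonglongrightarrow> Cw * (0 + 2 / c * 0 + 0 * (2 / c) * 0)"
      by (intro tendsto_intros b Fd F)
    then show ?thesis by (simp add: err_def[abs_def] algebra_simps add_divide_distrib)
  qed
  define \<rho> where "\<rho> = c / 2 * (1 - 2 / \<alpha>)"
  have \<rho>: "0 < \<rho>" using c B_gamma(1) by (simp add: \<rho>_def)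
  have radius: "\<forall>\<^sub>F n in sequentially. (d n + b n) / sqrt (real n) < c / 2 * ((1 - 2 / \<alpha>) * lam n / \<kappa> n)"
  proof -
    have "(\<lambda>n. sqrt ((real (d n))\<^sup>2 / real n) + b n) \<longlonglongrightarrow> sqrt 0 + 0"
      by (intro tendsto_intros d2 b)
    then have "\<forall>\<^sub>F n in sequentially. sqrt ((real (d n))\<^sup>2 / real n) + b n < \<rho>"
      by (rule order_tendstoD) (use \<rho> in simp)
    then show ?thesis
      using lam_ge eventually_gt_at_top[of 0]
    proof eventually_elim
      case (elim n)
      have n1: "1 \<le> sqrt (real n)" using elim by simp
      then have "b n / sqrt (real n) \<le> b n / 1" using b0[of n] by (intro frac_le) auto
      then have "(d n + b n) / sqrt (real n) < \<rho> * 1"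
        using elim(1) by (simp add: real_sqrt_divide add_divide_distrib)
      also have "\<rho> * 1 \<le> \<rho> * (lam n / \<kappa> n)"
      proof (rule mult_left_mono)
        have "1 * \<kappa> n \<le> sqrt (d n) * \<kappa> n" using d1[of n] pos[of n] by (intro mult_right_mono) auto
        then have "\<kappa> n \<le> lam n" using elim by linarith
        then show "1 \<le> lam n / \<kappa> n" using pos[of n] by (simp add: le_divide_eq)
      qed (use \<rho> in simp)
      finally show ?case by (simp add: \<rho>_def)
    qed
  qed
  have large: "\<forall>\<^sub>F n in sequentially. \<forall>i<s1 n. 3 * lam n \<le> \<bar>\<mu> n i\<bar>"
  proof -
    have "\<forall>\<^sub>F n in sequentially. ereal (lam n) / mu_star (\<mu> n) (s1 n) < ereal (1 / 3)"
      by (rule order_tendstoD(2)[OF B_mu]) simp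
    then show ?thesis
    proof eventually_elim
      case (elim n)
      show ?case
      proof (intro allI impI)
        fix i assume i: "i < s1 n"
        have le: "mu_star (\<mu> n) (s1 n) \<le> ereal \<bar>\<mu> n i\<bar>"
          unfolding mu_star_def using i by (intro INF_lower) simp
        have ge: "0 \<le> mu_star (\<mu> n) (s1 n)"
          unfolding mu_star_def by (intro INF_greatest) simp
        obtain m where m: "mu_star (\<mu> n) (s1 n) = ereal m"
          using le ge by (cases "mu_star (\<mu> n) (s1 n)") auto
        have "0 \<le> m" "m \<le> \<bar>\<mu> n i\<bar>" using le ge m by auto
        moreover have "m \<noteq> 0" using elim pos[of n] by (auto simp: m divide_ereal_def)
        ultimately have "0 < m" by simp
        then have "lam n / m < 1 / 3" using elim by (simp add: m)
        then have "3 * lam n < m" using \<open>0 < m\<close> by (simp add: field_simps)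
        then show "3 * lam n \<le> \<bar>\<mu> n i\<bar>" using \<open>m \<le> \<bar>\<mu> n i\<bar>\<close> by linarith
      qed
    qed
  qed
  define bad where "bad n = regression_sample.bad_event (M n) n (d n) (X n) (eps n) (LX n) (\<kappa> n) (\<gamma> n)" for n
  have bad_m: "\<forall>\<^sub>F n in sequentially. bad n \<in> sets (M n)"
    using eventually_gt_at_top[of 0]
    by eventually_elim (simp add: bad_def regression_sample.bad_event_measurable[OF rs])
  have bad_p: "(\<lambda>n. measure (M n) (bad n)) \<longlonglongrightarrow> 0"
  proof (rule Lim_null_comparison)
    let ?p = "\<lambda>n. \<P>(\<omega> in M n. (MAX i\<in>{..<n}. L2_set (X n i \<omega>) {..<d n}) > \<kappa> n) +
      \<P>(\<omega> in M n. (MAX i\<in>{..<n}. \<bar>eps n i \<omega>\<bar>) > \<gamma> n) +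
      (\<sigma>\<^sup>2 * C + C\<^sup>2) * (1 / real (d n))"
    have "(\<lambda>n. 1 / real (d n)) \<longlonglongrightarrow> 0"
      using filterlim_compose[OF filterlim_real_sequentially d_top]
      by (intro tendsto_divide_0[OF tendsto_const]) (rule filterlim_at_top_imp_at_infinity)
    then have "?p \<longlonglongrightarrow> 0 + 0 + (\<sigma>\<^sup>2 * C + C\<^sup>2) * 0"
      by (intro tendsto_intros A_X A_eps)
    then show "?p \<longlonglongrightarrow> 0" by simp
    show "\<forall>\<^sub>F n in sequentially. norm (measure (M n) (bad n)) \<le>
        ?p n"
      using eventually_gt_at_top[of 0]
    proof eventually_elim
      case (elim n)
      define m where "m = regression_sample.fourth_moment_sum (d n) (LX n)"
      have m: "0 \<le> m" "m \<le> C * d n" using m4_nonneg C by (auto simp: m_def)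
      have "\<sigma>\<^sup>2 * m / (real (d n))\<^sup>2 \<le> \<sigma>\<^sup>2 * (C * d n) / (real (d n))\<^sup>2"
        using m by (intro divide_right_mono mult_left_mono) auto
      moreover have "m\<^sup>2 / real (d n) ^ 3 \<le> (C * d n)\<^sup>2 / real (d n) ^ 3"
        using m by (intro divide_right_mono power_mono) auto
      moreover have "\<sigma>\<^sup>2 * (C * d n) / (real (d n))\<^sup>2 + (C * d n)\<^sup>2 / real (d n) ^ 3 = (\<sigma>\<^sup>2 * C + C\<^sup>2) * (1 / real (d n))"
        using d_pos[of n] by (simp add: field_simps power2_eq_square power3_eq_cube)
      ultimately show ?case
        using regression_sample.bad_event_prob[OF rs elim d_pos, of "\<kappa> n" "\<gamma> n"]
        by (simp add: bad_def m_def)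
    qed
  qed
  have close: "\<forall>\<^sub>F n in sequentially. \<forall>\<omega> \<in> space (M n) - bad n. norm (Z n \<omega> - Z' n \<omega>) \<le> CARD('q) * err n"
  proof -
    have "\<forall>\<^sub>F n in sequentially. F n < c / 2"
      by (rule order_tendstoD(2)[OF F]) (use c in simp)
    then show ?thesis
      using radius large eventually_gt_at_top[of 0]
    proof eventually_elim
      case (elim n)
      show ?case
      proof
        fix \<omega> assume \<omega>: "\<omega> \<in> space (M n) - bad n"
        have coord: "\<bar>Z n \<omega> $ r - Z' n \<omega> $ r\<bar> \<le> err n" for r
        proof -
          have "\<bar>sqrt n * (\<Sum>j<d n. A n r j * (\<beta>hat n \<omega> j - \<beta> n j)) -
              (\<Sum>i<n. eps n i \<omega> * (\<Sum>j<d n. w n r j * X n i \<omega> j)) / sqrt n\<bar> \<le>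
              L2_set (w n r) {..<d n} * (b n + F n * (2 / c) * (d n + b n))"
          proof (rule regression_sample.good_event_error[OF rs elim(4) lam_pos kappa(1) B_gamma(1) gamma(1) B_gamma(2) s_le])
            show "\<omega> \<in> space (M n) - regression_sample.bad_event (M n) n (d n) (X n) (eps n) (LX n) (\<kappa> n) (\<gamma> n)"
              using \<omega> by (simp add: bad_def)
            show "Y n \<omega> i = \<mu> n i + (\<Sum>j<d n. X n i \<omega> j * \<beta> n j) + eps n i \<omega>" if "i < n" for i
              using Y that \<omega> by simp
            show "is_arg_min (\<lambda>(m, b). penalized_loss n (d n) (lam n) (\<lambda>i. X n i \<omega>) (Y n \<omega>) m b) (\<lambda>_. True)
                (\<mu>hat n \<omega>, \<beta>hat n \<omega>)"
              using hat_min \<omega> by simp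
            show "3 * lam n \<le> \<bar>\<mu> n i\<bar>" if "i < s1 n" for i using elim that by blast
            show "\<bar>\<mu> n i\<bar> \<le> \<gamma> n" if "s1 n \<le> i" "i < s1 n + s2 n" for i using mu_moderate that by blast
            show "\<mu> n i = 0" if "s1 n + s2 n \<le> i" "i < n" for i using mu_zero that by blast
            show "c * (\<Sum>j<d n. (v j)\<^sup>2) \<le> bilinear_form {..<d n} (regression_sample.cov (LX n)) v v" for v
              using quad_ge unfolding S_def .
            show "(\<Sum>j<d n. w n r j * regression_sample.cov (LX n) j k) = A n r k" if "k < d n" for k
              using wS[OF that] unfolding S_def .
          qed (use c(1) elim in \<open>auto simp: b_def F_def\<close>)
          also have "\<dots> \<le> err n"
            unfolding err_def using b0[of n] F0[of n] c(1) by (intro mult_right_mono w_le) auto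
          finally show ?thesis by (simp add: Z_def Z'_def rect_mult_vec_def)
        qed
        have "norm (Z n \<omega> - Z' n \<omega>) \<le> (\<Sum>r\<in>UNIV. \<bar>(Z n \<omega> - Z' n \<omega>) $ r\<bar>)" by (rule norm_le_l1_cart)
        also have "\<dots> \<le> (\<Sum>r\<in>(UNIV::'q set). err n)" using coord by (intro sum_mono) simp
        finally show "norm (Z n \<omega> - Z' n \<omega>) \<le> CARD('q) * err n" by simp
      qed
    qed
  qed
  have tight: "\<exists>R. \<forall>\<^sub>F n in sequentially. \<P>(\<omega> in M n. R < norm (Z' n \<omega>)) \<le> e" if e: "0 < e" for e
  proof -
    define q where "q = real CARD('q)"
    have q: "0 < q" by (simp add: q_def)
    define V where "V = \<sigma>\<^sup>2 * (CA * Cw)"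
    have V: "0 \<le> V" using CA Cw by (simp add: V_def)
    define R where "R = sqrt (q ^ 3 * V / e) + 1"
    have R: "0 < R" using V q e by (simp add: R_def add_nonneg_pos)
    have "q ^ 3 * V / e \<le> R\<^sup>2"
    proof -
      have "(sqrt (q ^ 3 * V / e))\<^sup>2 \<le> R\<^sup>2"
        unfolding R_def using V q e by (intro power_mono) auto
      then show ?thesis using V q e by simp
    qed
    then have Re: "q * (V / (R / q)\<^sup>2) \<le> e"
      using R q e by (simp add: field_simps power2_eq_square power3_eq_cube)
    have "\<forall>\<^sub>F n in sequentially. \<P>(\<omega> in M n. R < norm (Z' n \<omega>)) \<le> e"
      using eventually_gt_at_top[of 0]
    proof eventually_elim
      case (elim n)
      interpret prob_space "M n" by (rule prob)
      define T where "T r \<omega> = (\<Sum>i<n. eps n i \<omega> * (\<Sum>j<d n. w n r j * X n i \<omega> j))" for r \<omega>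
      have Tm: "T r \<in> borel_measurable (M n)" for r unfolding T_def by (rule Z'c)
      define t where "t = n * (R / q)\<^sup>2"
      have t: "0 < t" using elim R q by (simp add: t_def)
      have "{\<omega> \<in> space (M n). R < norm (Z' n \<omega>)} \<subseteq> (\<Union>r. {\<omega> \<in> space (M n). t \<le> (T r \<omega>)\<^sup>2})"
      proof safe
        fix \<omega> assume \<omega>: "\<omega> \<in> space (M n)" "R < norm (Z' n \<omega>)"
        have "\<exists>r. R / q \<le> \<bar>Z' n \<omega> $ r\<bar>"
        proof (rule ccontr)
          assume "\<nexists>r. R / q \<le> \<bar>Z' n \<omega> $ r\<bar>"
          then have "(\<Sum>r\<in>UNIV. \<bar>Z' n \<omega> $ r\<bar>) \<le> (\<Sum>r\<in>(UNIV::'q set). R / q)"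
            by (intro sum_mono) (auto simp: not_le less_imp_le)
          also have "\<dots> = R" using q by (simp add: q_def)
          finally show False using norm_le_l1_cart[of "Z' n \<omega>"] \<omega> by linarith
        qed
        then obtain r where "R / q \<le> \<bar>Z' n \<omega> $ r\<bar>" by blast
        then have "(R / q)\<^sup>2 \<le> \<bar>Z' n \<omega> $ r\<bar>\<^sup>2"
          using R q by (intro power_mono) auto
        also have "\<dots> = (T r \<omega>)\<^sup>2 / n" by (simp add: Z'_def T_def power_divide)
        finally have "t \<le> (T r \<omega>)\<^sup>2" using elim by (simp add: t_def field_simps)
        then show "\<omega> \<in> (\<Union>r. {\<omega> \<in> space (M n). t \<le> (T r \<omega>)\<^sup>2})" using \<omega> by blast
      qed
      then have "\<P>(\<omega> in M n. R < norm (Z' n \<omega>)) \<le> prob (\<Union>r. {\<omega> \<in> space (M n). t \<le> (T r \<omega>)\<^sup>2})"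
        using Tm by (intro finite_measure_mono sets.finite_UN) auto
      also have "\<dots> \<le> (\<Sum>r\<in>UNIV. \<P>(\<omega> in M n. t \<le> (T r \<omega>)\<^sup>2))"
        using Tm by (intro finite_measure_subadditive_finite) auto
      also have "\<dots> \<le> (\<Sum>r\<in>(UNIV::'q set). V / (R / q)\<^sup>2)"
      proof (rule sum_mono)
        fix r :: 'q
        have "bilinear_form {..<d n} (S n) (w n r) (w n r) \<le> CA * L2_set (w n r) {..<d n}" by (rule w_quad)
        also have "\<dots> \<le> CA * Cw" using CA(1) by (intro mult_left_mono w_le) auto
        finally have "\<sigma>\<^sup>2 * bilinear_form {..<d n} (S n) (w n r) (w n r) \<le> V"
          unfolding V_def by (rule mult_left_mono) simp
        then have "n * (\<sigma>\<^sup>2 * bilinear_form {..<d n} (S n) (w n r) (w n r)) / t \<le> n * V / t"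
          using t by (intro divide_right_mono mult_left_mono) auto
        also have "\<dots> = V / (R / q)\<^sup>2" using elim by (simp add: t_def)
        finally show "\<P>(\<omega> in M n. t \<le> (T r \<omega>)\<^sup>2) \<le> V / (R / q)\<^sup>2"
          using regression_sample.noise_tail[OF rs t, of n "w n r"] unfolding T_def S_def by linarith
      qed
      also have "\<dots> = q * (V / (R / q)\<^sup>2)" by (simp add: q_def)
      also note Re
      finally show ?case .
    qed
    then show ?thesis by blast
  qed
  have char: "(\<lambda>n. LINT \<omega>|M n. iexp (inner t (Z' n \<omega>))) \<longlonglongrightarrow> (LINT x|N. iexp (inner t x))" for t
  proof -
    have "Bseq (\<lambda>n. inner t (Gn n *v t))"
      using quad_lim by (intro convergent_imp_Bseq convergentI)
    then obtain K where K: "0 < K" "\<And>n. norm (inner t (Gn n *v t)) \<le> K" unfolding Bseq_def by blast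
    have wt_le: "L2_set (wt n t) {..<d n} \<le> sqrt (K / c)" for n
    proof (rule real_le_rsqrt)
      have "c * (L2_set (wt n t) {..<d n})\<^sup>2 \<le> inner t (Gn n *v t)"
        unfolding L2_set_power2 wt_quad[symmetric] by (rule quad_ge)
      also have "\<dots> \<le> K" using K(2)[of n] by simp
      finally show "(L2_set (wt n t) {..<d n})\<^sup>2 \<le> K / c" using c by (simp add: field_simps)
    qed
    show ?thesis
      unfolding N(2) inner_Z'
    proof (rule noise_sum_central_limit[OF rs wt_le C(2) _ d2])
      show "(\<lambda>n. \<Sum>j<d n. \<Sum>k<d n. wt n t j * regression_sample.cov (LX n) j k * wt n t k) \<longlonglongrightarrow> inner t (GX *v t)"
        using quad_lim unfolding wt_quad[symmetric] S_def .
    qed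
  qed
  have "converges_in_distribution M Z N"
  proof (rule converges_in_distribution_perturb[OF prob _ _ Zm Z'm tight char bad_m bad_p close])
    show "prob_space N" "sets N = sets borel" using N(1) by (auto simp: is_multivariate_normal_def)
    show "(\<lambda>n. CARD('q) * err n) \<longlonglongrightarrow> 0"
      using tendsto_mult[OF tendsto_const err, of "real CARD('q)"] by simp
    show "0 \<le> CARD('q) * err n" for n using err0 by simp
  qed
  then show ?thesis using N(1) unfolding Z_def by blast
qed

end
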